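(* The algorithm PAWC described in the context, given the source points $x_1,\dots,x_n$, the target points $y_1,\dots,y_m$ (all pairwise distinct), the weight $w$ and the circumference $L$, returns the exact values $C_k^\circ$ and an optimal active set for every $k=0,\dots,K$ (namely the set of atoms with activation rank at most $k$), together with an original support gap $\theta^\star$ satisfying $C^{\mathrm{line}}_{k,\theta^\star}=C_k^\circ$ for every $k=0,\dots,K$. It runs in $O(N\log N)$ time and uses $O(N)$ memory.
   Context: Problem. Fix $L>0$, $w>0$, $n,m\ge 1$. The circle is $\mathbb{S}^1_L=\mathbb{R}/L\mathbb{Z}$ with geodesic distance $d(x,y)=\min\{|x-y|,\,L-|x-y|\}$ for coordinates in $[0,L)$; clockwise means increasing coordinate. Source atoms $x_1,\dots,x_n$ and target atoms $y_1,\dots,y_m$ are pairwise distinct points of the circle, each of mass $w$; $N=n+m$, $K=\min(n,m)$. A matching $M$ is a set of pairs $(x_i,y_j)$ in which no atom appears twice; $C_k^\circ$ is the minimum of $w\sum_{(x_i,y_j)\in M}d(x_i,y_j)$ over matchings with $|M|=k$. An optimal active set for $k$ is the set of atoms incident to a matching of cardinality $k$ and cost $C_k^\circ$. Let $z_1<\dots<z_N$ be the sorted atoms in $[0,L)$, cyclically indexed; original support gaps are the open clockwise arcs from $z_i$ to $z_{i+1}$. For a gap $G$, pick $\theta\in G$ and set $t(z)=(z-\theta)\bmod L$; $C_{k,G}^{\mathrm{line}}$ is the minimum of $w\sum_{(x_i,y_j)\in M}|t(x_i)-t(y_j)|$ over matchings with $|M|=k$. Tables. Let $\sigma_i=+1$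 if $z_i$ is a source and $-1$ if a target; $\tilde z_i=z_i$, $\tilde z_{i+N}=z_i+L$, $\tilde\sigma_i=\tilde\sigma_{i+N}=\sigma_i$ ($1\le i\le N$). For $0\le t\le 2N$: $R_t=\sum_{i\le t}\tilde\sigma_i$, $S_t=\sum_{i\le t}\tilde\sigma_i\tilde z_i$, $p_t=\max\{s<t:R_s=R_t\}$ when this set is nonempty; $Q_0=0$ and, for $t\ge1$, $Q_t=Q_{p_t}+w|S_t-S_{p_t}|$ if $p_t$ exists, $Q_t=0$ otherwise. A clockwise arc from $z_i$ to $z_j$ ($i\ne j$) is represented by $[a,b]=[i,j]$ if $i<j$ and $[i,j+N]$ if $i>j$; its key is $\mathfrak m=(Q_b-Q_{a-1})-(Q_{b-1}-Q_a)$. Algorithm PAWC. 1. Sort the atoms and compute the tables $R,S,p,Q$. 2. Make a circular doubly linked list of all (inactive) atoms in clockwise order. Each cell (clockwise arc from a listed atom to its successor) stores its original gap as free-gap representative. Insert each cell whose endpoints have opposite types into a min-heap, keyed by $\mathfrak m$. Set $C_0=0$. 3. For $k=0,\dots,K-1$: pop the minimum heap entry $(u,v,\mathfrak m)$ repeatedly until $u,v$ are inactive, $v$ is the successor of $u$, and $u,v$ have opposite types. Record activation rank $k+1$ for $u$ and $v$; set $C_{k+1}=C_k+\mathfrak m$. If $u,v$ are the only inactive atoms, let $\theta^\star$ be the representative of the complementary cell from $v$ clockwise to $u$, remove $u,v$ and continue. Otherwise let $p$ be the predecessor of $u$ and $q$ the successor of $v$, remove $u,v$, link $p$ to $q$;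 the new cell from $p$ to $q$ inherits the representative of the cell from $p$ to $u$ or of the cell from $v$ to $q$; if $p,q$ have opposite types, compute the key of the new cell and insert it into the heap. 4. If $\theta^\star$ is not yet set, let it be the representative of any remaining cell. 5. Return $(C_k)_{k=0}^K$ (the claimed values of $C_k^\circ$), the activation ranks and $\theta^\star$. Running time and memory are counted in the usual unit-cost model (arithmetic operations and comparisons on real numbers, and memory accesses, cost $O(1)$; a heap operation on $O(N)$ entries costs $O(\log N)$). *)

theory Defs
  imports
    "HOL-Analysis.Analysis"
    "HOL-Library.Real_Mod"
    "HOL-Library.State_Monad"
    "HOL-Library.While_Combinator"
    "HOL-Library.Discrete_Functions"
    "HOL-Library.Landau_Symbols"
begin

section \<open>Partial matchings on the circle and on the cut circle\<close>

text \<open>Points of the circle are represented by their coordinates in \<open>{0..<L}\<close>.\<close>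

definition circ_dist :: "real \<Rightarrow> real \<Rightarrow> real \<Rightarrow> real" where
  "circ_dist L x y = min \<bar>x - y\<bar> (L - \<bar>x - y\<bar>)"

definition cut_coord :: "real \<Rightarrow> real \<Rightarrow> real \<Rightarrow> real" where
  "cut_coord L \<theta> z = (z - \<theta>) rmod L"

definition line_dist :: "real \<Rightarrow> real \<Rightarrow> real \<Rightarrow> real \<Rightarrow> real" where
  "line_dist L \<theta> x y = \<bar>cut_coord L \<theta> x - cut_coord L \<theta> y\<bar>"

definition matchings :: "real set \<Rightarrow> real set \<Rightarrow> nat \<Rightarrow> (real \<times> real) set set" where
  "matchings X Y k = {M. M \<subseteq> X \<times> Y \<and> inj_on fst M \<and> inj_on snd M \<and> card M = k}"

definition matching_cost :: "real \<Rightarrow> (real \<Rightarrow> real \<Rightarrow> real) \<Rightarrow> (real \<times> real) set \<Rightarrow> real" where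
  "matching_cost w d M = w * (\<Sum>(x, y)\<in>M. d x y)"

definition circ_cost :: "real \<Rightarrow> real \<Rightarrow> real set \<Rightarrow> real set \<Rightarrow> nat \<Rightarrow> real" where
  "circ_cost L w X Y k = Min (matching_cost w (circ_dist L) ` matchings X Y k)"

definition line_cost :: "real \<Rightarrow> real \<Rightarrow> real \<Rightarrow> real set \<Rightarrow> real set \<Rightarrow> nat \<Rightarrow> real" where
  "line_cost L w \<theta> X Y k = Min (matching_cost w (line_dist L \<theta>) ` matchings X Y k)"

definition optimal_active_set ::
    "real \<Rightarrow> real \<Rightarrow> real set \<Rightarrow> real set \<Rightarrow> nat \<Rightarrow> real set \<Rightarrow> bool" where
  "optimal_active_set L w X Y k A \<longleftrightarrow>
     (\<exists>M \<in> matchings X Y k. matching_cost w (circ_dist L) M = circ_cost L w X Y k \<and>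
        A = fst ` M \<union> snd ` M)"

text \<open>The atoms in increasing order of coordinate are \<open>atom X Y 1, \<dots>, atom X Y N\<close>; gap \<open>i\<close> is the
  open clockwise arc that starts at the \<open>i\<close>-th atom, and the last gap contains the coordinate
  \<open>0\<close> unless there is an atom at \<open>0\<close>.\<close>

definition atom :: "real set \<Rightarrow> real set \<Rightarrow> nat \<Rightarrow> real" where
  "atom X Y i = sorted_list_of_set (X \<union> Y) ! (i - 1)"

definition support_gap :: "real \<Rightarrow> real set \<Rightarrow> real set \<Rightarrow> nat \<Rightarrow> real set" where
  "support_gap L X Y i =
     (if i < card (X \<union> Y) then {atom X Y i <..< atom X Y (i + 1)}
      else {atom X Y i <..< L} \<union> {0 ..< atom X Y 1})"

section \<open>Random access machine with unit costs\<close>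

text \<open>The memory consists of named arrays of reals, named arrays of natural numbers, and a
  priority queue of entries (key, payload, payload). The names are those of the arrays of the
  algorithm below.

  \<^item> \<open>tape\<close> resolves every choice that the algorithm leaves open (ties in the priority queue and
    explicit choices). Quantifying over all tapes amounts to quantifying over all runs.
  \<^item> \<open>time\<close> counts the unit operations performed so far.
  \<^item> \<open>peak\<close> is the largest number of memory cells occupied so far.
  \<^item> \<open>ok\<close> becomes false, and stays so, at an access outside the bounds of an array, at an
    extraction from an empty queue, and at a loop that does not terminate.\<close>

datatype rname = Src | Tgt | Zarr | Sarr | Qarr | Carr

datatype nname = Kind | Rarr | Parr | Last | Next | Prev | Rep | Rank | Theta

record ram =
  rarr :: "rname \<Rightarrow> real list"
  narr :: "nname \<Rightarrow> nat list"
  heap :: "(real \<times> nat \<times> nat) list"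
  tape :: "nat \<Rightarrow> nat"
  time :: nat
  peak :: nat
  ok :: bool

type_synonym 'a prog = "(ram, 'a) state"

definition footprint :: "ram \<Rightarrow> nat" where
  "footprint s = (\<Sum>a\<in>UNIV. length (rarr s a)) + (\<Sum>a\<in>UNIV. length (narr s a)) + 3 * length (heap s)"

definition update_peak :: "ram \<Rightarrow> ram" where
  "update_peak s = s\<lparr>peak := max (peak s) (footprint s)\<rparr>"

definition tick :: "nat \<Rightarrow> unit prog" where
  "tick c = State (\<lambda>s. ((), s\<lparr>time := time s + c\<rparr>))"

definition check :: "(ram \<Rightarrow> bool) \<Rightarrow> unit prog" where
  "check P = State (\<lambda>s. ((), s\<lparr>ok := (ok s \<and> P s)\<rparr>))"

text \<open>\<open>calc c e\<close> evaluates an expression \<open>e\<close> over registers that contains \<open>c\<close> operators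
  (arithmetic, comparison or Boolean). Registers are the variables bound in a program; a program
  uses a constant number of them.\<close>

definition calc :: "nat \<Rightarrow> 'a \<Rightarrow> 'a prog" where
  "calc c e = do { tick c; State_Monad.return e }"

definition rget :: "rname \<Rightarrow> nat \<Rightarrow> real prog" where
  "rget a i = do { tick 1; check (\<lambda>s. i < length (rarr s a)); State (\<lambda>s. (rarr s a ! i, s)) }"

definition rput :: "rname \<Rightarrow> nat \<Rightarrow> real \<Rightarrow> unit prog" where
  "rput a i v = do {
     tick 1; check (\<lambda>s. i < length (rarr s a));
     State (\<lambda>s. ((), s\<lparr>rarr := (rarr s)(a := (rarr s a)[i := v])\<rparr>)) }"

definition nget :: "nname \<Rightarrow> nat \<Rightarrow> nat prog" where
  "nget a i = do { tick 1; check (\<lambda>s. i < length (narr s a)); State (\<lambda>s. (narr s a ! i, s)) }"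

definition nput :: "nname \<Rightarrow> nat \<Rightarrow> nat \<Rightarrow> unit prog" where
  "nput a i v = do {
     tick 1; check (\<lambda>s. i < length (narr s a));
     State (\<lambda>s. ((), s\<lparr>narr := (narr s)(a := (narr s a)[i := v])\<rparr>)) }"

definition ralloc :: "rname \<Rightarrow> nat \<Rightarrow> unit prog" where
  "ralloc a l = do {
     tick (1 + l);
     State (\<lambda>s. ((), update_peak (s\<lparr>rarr := (rarr s)(a := replicate l 0)\<rparr>))) }"

definition nalloc :: "nname \<Rightarrow> nat \<Rightarrow> unit prog" where
  "nalloc a l = do {
     tick (1 + l);
     State (\<lambda>s. ((), update_peak (s\<lparr>narr := (narr s)(a := replicate l 0)\<rparr>))) }"

definition tick_heap :: "unit prog" where
  "tick_heap = State (\<lambda>s. ((), s\<lparr>time := time s + 1 + floor_log (1 + length (heap s))\<rparr>))"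

definition push :: "real \<times> nat \<times> nat \<Rightarrow> unit prog" where
  "push e = do { tick_heap; State (\<lambda>s. ((), update_peak (s\<lparr>heap := e # heap s\<rparr>))) }"

definition pick_below :: "nat \<Rightarrow> nat prog" where
  "pick_below c = do {
     tick 1;
     State (\<lambda>s. (tape s 0 mod c, s\<lparr>tape := (\<lambda>i. tape s (Suc i))\<rparr>)) }"

definition min_entries :: "(real \<times> nat \<times> nat) list \<Rightarrow> (real \<times> nat \<times> nat) list" where
  "min_entries h = filter (\<lambda>e. \<forall>e'\<in>set h. fst e \<le> fst e') h"

definition pop :: "(real \<times> nat \<times> nat) prog" where
  "pop = do {
     tick_heap;
     check (\<lambda>s. heap s \<noteq> []);
     mins \<leftarrow> State (\<lambda>s. (min_entries (heap s), s));
     j \<leftarrow> pick_below (length mins);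
     State (\<lambda>s. (mins ! j, s\<lparr>heap := remove1 (mins ! j) (heap s)\<rparr>)) }"

text \<open>In \<open>foreach [i..<j] f\<close> the list only denotes the range of a loop counter.\<close>

primrec foreach :: "nat list \<Rightarrow> (nat \<Rightarrow> unit prog) \<Rightarrow> unit prog" where
  "foreach [] f = tick 1"
| "foreach (i # is) f = do { tick 2; f i; foreach is f }"

text \<open>\<open>until body\<close> repeats \<open>body\<close> until it returns a result.\<close>

definition until :: "'a option prog \<Rightarrow> 'a prog" where
  "until body = State (\<lambda>s.
     case while_option (\<lambda>(r, s). r = None) (\<lambda>(r, s). run_state (do { tick 1; body }) s) (None, s) of
       Some (r, s') \<Rightarrow> (the r, s')
     | None \<Rightarrow> (undefined, s\<lparr>ok := False\<rparr>))"

section \<open>The algorithm\<close>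

text \<open>Atoms are named by their position \<open>1, \<dots>, N\<close> in the sorted order, and entry \<open>0\<close> of an
  array indexed by atoms is unused. \<open>Kind\<close> is \<open>1\<close> for a source and \<open>0\<close> for a target.\<close>

definition sort_atoms :: "nat \<Rightarrow> nat \<Rightarrow> nat \<Rightarrow> real \<Rightarrow> unit prog" where
  "sort_atoms n m N L = do {
     l \<leftarrow> calc 2 (2 * N + 1);
     ralloc Zarr l;
     nalloc Kind l;
     foreach [0..<n] (\<lambda>i. do { x \<leftarrow> rget Src i; push (x, 1, 0) });
     foreach [0..<m] (\<lambda>j. do { y \<leftarrow> rget Tgt j; push (y, 0, 0) });
     foreach [1..<N + 1] (\<lambda>i. do {
       (z, b, _) \<leftarrow> pop;
       i' \<leftarrow> calc 1 (i + N);
       z' \<leftarrow> calc 1 (z + L);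
       rput Zarr i z;
       nput Kind i b;
       rput Zarr i' z';
       nput Kind i' b
     })
   }"

text \<open>\<open>Rarr\<close> holds \<open>R\<^sub>t + 2N\<close>, a natural number that can serve as an index. In \<open>Parr\<close> and \<open>Last\<close>
  the index \<open>s\<close> is stored as \<open>s + 1\<close>, and \<open>0\<close> means that there is none. Before step \<open>t\<close>,
  \<open>Last\<close> at \<open>r + 2N\<close> is the greatest \<open>s < t\<close> with \<open>R\<^sub>s = r\<close>.\<close>

definition compute_tables :: "nat \<Rightarrow> real \<Rightarrow> unit prog" where
  "compute_tables N w = do {
     l \<leftarrow> calc 2 (2 * N + 1);
     nalloc Rarr l;
     ralloc Sarr l;
     nalloc Parr l;
     ralloc Qarr l;
     h \<leftarrow> calc 2 (4 * N + 1);
     nalloc Last h;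
     c \<leftarrow> calc 1 (2 * N);
     nput Rarr 0 c;
     rput Sarr 0 0;
     rput Qarr 0 0;
     nput Last c 1;
     foreach [1..<2 * N + 1] (\<lambda>t. do {
       t' \<leftarrow> calc 1 (t - 1);
       r \<leftarrow> nget Rarr t';
       s \<leftarrow> rget Sarr t';
       z \<leftarrow> rget Zarr t;
       b \<leftarrow> nget Kind t;
       (r, s) \<leftarrow> calc 3 (if b = 1 then (r + 1, s + z) else (r - 1, s - z));
       nput Rarr t r;
       rput Sarr t s;
       p \<leftarrow> nget Last r;
       nput Parr t p;
       none \<leftarrow> calc 1 (p = 0);
       (if none then rput Qarr t 0
       else do {
         p' \<leftarrow> calc 1 (p - 1);
         sp \<leftarrow> rget Sarr p';
         qp \<leftarrow> rget Qarr p';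
         q \<leftarrow> calc 4 (qp + w * \<bar>s - sp\<bar>);
         rput Qarr t q
       });
       t1 \<leftarrow> calc 1 (t + 1);
       nput Last r t1
     })
   }"

definition key :: "nat \<Rightarrow> nat \<Rightarrow> nat \<Rightarrow> real prog" where
  "key N u v = do {
     (a, b) \<leftarrow> calc 2 (if u < v then (u, v) else (u, v + N));
     a' \<leftarrow> calc 1 (a - 1);
     b' \<leftarrow> calc 1 (b - 1);
     qb \<leftarrow> rget Qarr b;
     qa' \<leftarrow> rget Qarr a';
     qb' \<leftarrow> rget Qarr b';
     qa \<leftarrow> rget Qarr a;
     calc 3 ((qb - qa') - (qb' - qa))
   }"

definition insert_cell :: "nat \<Rightarrow> nat \<Rightarrow> nat \<Rightarrow> unit prog" where
  "insert_cell N u v = do {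
     bu \<leftarrow> nget Kind u;
     bv \<leftarrow> nget Kind v;
     opposite \<leftarrow> calc 1 (bu \<noteq> bv);
     if opposite then do { \<kappa> \<leftarrow> key N u v; push (\<kappa>, u, v) }
     else State_Monad.return ()
   }"

text \<open>A cell is identified by the atom \<open>u\<close> at which it starts; it ends at \<open>Next\<close> of \<open>u\<close>, and
  \<open>Rep\<close> of \<open>u\<close> is its free-gap representative. An atom is inactive iff its \<open>Rank\<close> is \<open>0\<close>.
  \<open>Theta\<close> is a single cell; it contains \<open>0\<close> as long as \<open>\<theta>\<^sup>\<star>\<close> is not set.\<close>

definition init_list :: "nat \<Rightarrow> nat \<Rightarrow> unit prog" where
  "init_list N K = do {
     l \<leftarrow> calc 1 (N + 1);
     nalloc Next l;
     nalloc Prev l;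
     nalloc Rep l;
     nalloc Rank l;
     nalloc Theta 1;
     l' \<leftarrow> calc 1 (K + 1);
     ralloc Carr l';
     rput Carr 0 0;
     foreach [1..<N + 1] (\<lambda>i. do {
       j \<leftarrow> calc 2 (if i = N then 1 else i + 1);
       nput Next i j;
       nput Prev j i;
       nput Rep i i
     });
     foreach [1..<N + 1] (\<lambda>i. do { j \<leftarrow> nget Next i; insert_cell N i j })
   }"

definition pop_valid :: "(real \<times> nat \<times> nat) prog" where
  "pop_valid = until (do {
     (\<kappa>, u, v) \<leftarrow> pop;
     ru \<leftarrow> nget Rank u;
     rv \<leftarrow> nget Rank v;
     v' \<leftarrow> nget Next u;
     bu \<leftarrow> nget Kind u;
     bv \<leftarrow> nget Kind v;
     valid \<leftarrow> calc 7 (ru = 0 \<and> rv = 0 \<and> v = v' \<and> bu \<noteq> bv);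
     State_Monad.return (if valid then Some (\<kappa>, u, v) else None)
   })"

text \<open>Given that \<open>v\<close> is the successor of \<open>u\<close>, the atoms \<open>u\<close> and \<open>v\<close> are the only ones in the
  circular list iff the successor of \<open>v\<close> is \<open>u\<close>.\<close>

definition activate :: "nat \<Rightarrow> nat \<Rightarrow> unit prog" where
  "activate N k = do {
     (\<kappa>, u, v) \<leftarrow> pop_valid;
     k' \<leftarrow> calc 1 (k + 1);
     nput Rank u k';
     nput Rank v k';
     c \<leftarrow> rget Carr k;
     c' \<leftarrow> calc 1 (c + \<kappa>);
     rput Carr k' c';
     q \<leftarrow> nget Next v;
     gv \<leftarrow> nget Rep v;
     last_two \<leftarrow> calc 1 (q = u);
     if last_two then nput Theta 0 gv
     else do {
       p \<leftarrow> nget Prev u;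
       gp \<leftarrow> nget Rep p;
       nput Next p q;
       nput Prev q p;
       d \<leftarrow> pick_below 2;
       g \<leftarrow> calc 1 (if d = 0 then gp else gv);
       nput Rep p g;
       insert_cell N p q
     }
   }"

text \<open>The scan visits the remaining cells; since each of them may or may not replace the one
  taken before, every remaining cell can be the one whose representative is kept.\<close>

definition any_remaining_cell :: "nat \<Rightarrow> unit prog" where
  "any_remaining_cell N = foreach [1..<N + 1] (\<lambda>i. do {
     r \<leftarrow> nget Rank i;
     \<theta> \<leftarrow> nget Theta 0;
     d \<leftarrow> pick_below 2;
     take_it \<leftarrow> calc 5 (r = 0 \<and> (\<theta> = 0 \<or> d = 0));
     if take_it then do { g \<leftarrow> nget Rep i; nput Theta 0 g }
     else State_Monad.return ()
   })"

definition pawc_prog :: "nat \<Rightarrow> nat \<Rightarrow> real \<Rightarrow> real \<Rightarrow> unit prog" where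
  "pawc_prog n m w L = do {
     N \<leftarrow> calc 1 (n + m);
     K \<leftarrow> calc 1 (min n m);
     sort_atoms n m N L;
     compute_tables N w;
     init_list N K;
     foreach [0..<K] (activate N);
     \<theta> \<leftarrow> nget Theta 0;
     unset \<leftarrow> calc 1 (\<theta> = 0);
     if unset then any_remaining_cell N else State_Monad.return ()
   }"

text \<open>Initially the memory contains the two input arrays and nothing else.\<close>

definition init_ram :: "real list \<Rightarrow> real list \<Rightarrow> (nat \<Rightarrow> nat) \<Rightarrow> ram" where
  "init_ram xs ys ch = update_peak
     \<lparr>rarr = (\<lambda>_. [])(Src := xs, Tgt := ys), narr = (\<lambda>_. []), heap = [],
      tape = ch, time = 0, peak = 0, ok = True\<rparr>"

definition pawc_run :: "real \<Rightarrow> real \<Rightarrow> real list \<Rightarrow> real list \<Rightarrow> (nat \<Rightarrow> nat) \<Rightarrow> ram" where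
  "pawc_run L w xs ys ch =
     snd (run_state (pawc_prog (length xs) (length ys) w L) (init_ram xs ys ch))"

text \<open>The output, read off the final memory: the costs, the activation ranks (\<open>0\<close> for an atom
  without a rank) and the number of the returned gap.\<close>

definition out_costs :: "ram \<Rightarrow> real list" where
  "out_costs s = rarr s Carr"

definition out_rank :: "ram \<Rightarrow> nat \<Rightarrow> nat" where
  "out_rank s i = narr s Rank ! i"

definition out_gap :: "ram \<Rightarrow> nat" where
  "out_gap s = narr s Theta ! 0"

definition active_set :: "real set \<Rightarrow> real set \<Rightarrow> ram \<Rightarrow> nat \<Rightarrow> real set" where
  "active_set X Y s k =
     {atom X Y i | i. i \<in> {1..card (X \<union> Y)} \<and> out_rank s i \<noteq> 0 \<and> out_rank s i \<le> k}"

definition valid_input :: "real \<Rightarrow> real \<Rightarrow> real list \<Rightarrow> real list \<Rightarrow> bool" where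
  "valid_input L w xs ys \<longleftrightarrow>
     L > 0 \<and> w > 0 \<and> xs \<noteq> [] \<and> ys \<noteq> [] \<and> distinct (xs @ ys) \<and> set (xs @ ys) \<subseteq> {0..<L}"

end

theory Submission
  imports Defs "HOL-Real_Asymp.Real_Asymp"
begin

text \<open>A matching is turned into an integer flow \<open>F\<close> on the gaps of the circle, and its cost is at least
  \<open>\<Sum> ell g * \<bar>F g\<bar>\<close>. If \<open>F\<close> vanishes on some gap, the monotone matching for the circle cut there attains
  this value, on the line as well as on the circle. The inactive atoms divide the circle into cells with
  balanced interiors on whose boundary gaps \<open>F\<close> vanishes. The greedy choice keeps the following dual
  certificate: with the potential \<open>0\<close> at sources and the last key \<open>\<mu>\<close> at targets, shifting \<open>F\<close> by \<open>d\<close> on a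
  cell costs at least \<open>d\<close> times the difference of the potentials of its ends. Summation by parts around the circle
  shows that activating one more source and one more target costs at least the minimum key, and the
  exchange lemma for matchings reduces every matching of size \<open>k + 1\<close> to such an augmentation. A representative
  gap is never crossed by an activated cell, so \<open>F\<close> vanishes on it at all times.\<close>

section \<open>Matchings\<close>

text \<open>On the circle a set of atoms determines its flow only up to a constant, so a competing
  matching may also rotate mass around the whole circle. This is why the certificate is demanded for
  every integer \<open>d\<close> on every cell: an augmentation between two inactive atoms, combined
  with any rotation, shifts each cell by a constant, and a rotation gains nothing because the
  differences of the potentials add up to 0 around the circle. The activated sets are nested,
  whereas an optimal matching of size \<open>k + 1\<close> may use quite different atoms. The
  exchange lemma shows that some optimal set extends the present one. A key can be read off static
  tables because all atoms inside a cell are active: there the flow is the walk \<open>Rtab\<close>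
  measured from its level at the start of the cell, and a difference of \<open>Q\<close> between
  equal levels is \<open>w\<close> times the area between the walk and that level. Heap entries
  become stale and are discarded only when popped. At most \<open>N\<close> entries are pushed
  initially and at most one per activation, so each push can pay in advance for its own
  removal.\<close>

definition partial_matching :: "'a set \<Rightarrow> 'b set \<Rightarrow> ('a \<times> 'b) set \<Rightarrow> bool" where
  "partial_matching P Q M \<longleftrightarrow> finite M \<and> M \<subseteq> P \<times> Q \<and> inj_on fst M \<and> inj_on snd M"

lemma partial_matching_subset:
  "partial_matching P Q M \<Longrightarrow> M' \<subseteq> M \<Longrightarrow> partial_matching P Q M'"
  unfolding partial_matching_def by (meson finite_subset inj_on_subset subset_trans)

lemma partial_matching_insert:
  assumes "partial_matching P Q M" "x \<in> P" "y \<in> Q" "x \<notin> fst ` M" "y \<notin> snd ` M"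
  shows "partial_matching P Q (insert (x, y) M)"
  using assms unfolding partial_matching_def by (auto simp: inj_on_insert)

lemma partial_matching_remove:
  assumes "partial_matching P Q M" "(x, y) \<in> M"
  shows "partial_matching P Q (M - {(x, y)})" "x \<notin> fst ` (M - {(x, y)})" "y \<notin> snd ` (M - {(x, y)})"
proof -
  show "partial_matching P Q (M - {(x, y)})"
    using assms(1) by (rule partial_matching_subset) auto
  have inj: "inj_on fst M" "inj_on snd M" using assms(1) by (auto simp: partial_matching_def)
  show "x \<notin> fst ` (M - {(x, y)})" using inj_onD[OF inj(1) _ assms(2)] by fastforce
  show "y \<notin> snd ` (M - {(x, y)})" using inj_onD[OF inj(2) _ assms(2)] by fastforce
qed

text \<open>The induction contracts the first two edges \<open>(x, y)\<close>, \<open>(x1, y)\<close> of an alternating path that starts at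
  a vertex \<open>x\<close> covered by \<open>M'\<close> only.\<close>

lemma matching_exchange:
  assumes "partial_matching P Q M" "partial_matching P Q M'" "card M < card M'"
  shows "\<exists>T T' x y. partial_matching P Q T \<and> partial_matching P Q T' \<and>
    T \<union> T' = M \<union> M' \<and> T \<inter> T' = M \<inter> M' \<and> card T = card M + 1 \<and>
    x \<in> P - fst ` M \<and> y \<in> Q - snd ` M \<and>
    fst ` T = insert x (fst ` M) \<and> snd ` T = insert y (snd ` M)"
  using assms
proof (induction "card M" arbitrary: M M' rule: less_induct)
  case less
  have fin: "finite M" "finite M'" and inj: "inj_on fst M" "inj_on fst M'" "inj_on snd M" "inj_on snd M'"
    and sub: "M \<subseteq> P \<times> Q" "M' \<subseteq> P \<times> Q"
    using less.prems by (auto simp: partial_matching_def)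
  have "card (fst ` M) < card (fst ` M')"
    using less.prems(3) inj by (simp add: card_image)
  then obtain x where x: "x \<in> fst ` M'" "x \<notin> fst ` M"
    by (metis card_mono fin(1) finite_imageI not_less subsetI)
  then obtain y where xy: "(x, y) \<in> M'" by auto
  have xyPQ: "x \<in> P" "y \<in> Q" using xy sub by auto
  define M1' where "M1' = M' - {(x, y)}"
  have M1': "partial_matching P Q M1'" "M' = insert (x, y) M1'" "(x, y) \<notin> M1'"
    "x \<notin> fst ` M1'" "y \<notin> snd ` M1'"
    unfolding M1'_def using partial_matching_remove[OF less.prems(2) xy] xy by auto
  have xyM: "(x, y) \<notin> M" using x by force
  show ?case
  proof (cases "y \<in> snd ` M")
    case False
    have "partial_matching P Q (insert (x, y) M)"
      using partial_matching_insert less.prems(1) x False xyPQ by metis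
    then show ?thesis using M1' xyM x False xyPQ fin
      by (intro exI[of _ "insert (x, y) M"] exI[of _ M1'] exI[of _ x] exI[of _ y]) auto
  next
    case True
    then obtain x1 where x1: "(x1, y) \<in> M" by auto
    have x1P: "x1 \<in> P" using x1 sub by auto
    have x1x: "x1 \<noteq> x" using x1 x by force
    define M1 where "M1 = M - {(x1, y)}"
    have M1: "partial_matching P Q M1" "M = insert (x1, y) M1" "(x1, y) \<notin> M1"
      "x1 \<notin> fst ` M1" "y \<notin> snd ` M1"
      unfolding M1_def using partial_matching_remove[OF less.prems(1) x1] x1 by auto
    have fin1: "finite M1" "finite M1'" using M1 M1' by (auto simp: partial_matching_def)
    have cM: "card M = card M1 + 1" using M1(2,3) fin1 by simp
    have cM': "card M' = card M1' + 1" using M1'(2,3) fin1 by simp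
    have "\<exists>T T' x y. partial_matching P Q T \<and> partial_matching P Q T' \<and>
      T \<union> T' = M1 \<union> M1' \<and> T \<inter> T' = M1 \<inter> M1' \<and> card T = card M1 + 1 \<and>
      x \<in> P - fst ` M1 \<and> y \<in> Q - snd ` M1 \<and>
      fst ` T = insert x (fst ` M1) \<and> snd ` T = insert y (snd ` M1)"
      using less.hyps[of M1 M1'] M1(1) M1'(1) less.prems(3) cM cM' by simp
    then obtain T T' x2 y2 where T: "partial_matching P Q T" "partial_matching P Q T'"
      "T \<union> T' = M1 \<union> M1'" "T \<inter> T' = M1 \<inter> M1'" "card T = card M1 + 1"
      "x2 \<in> P - fst ` M1" "y2 \<in> Q - snd ` M1"
      "fst ` T = insert x2 (fst ` M1)" "snd ` T = insert y2 (snd ` M1)"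
      by blast
    have finT: "finite T" "finite T'" using T by (auto simp: partial_matching_def)
    have un: "fst ` T \<union> fst ` T' = fst ` M1 \<union> fst ` M1'" "snd ` T \<union> snd ` T' = snd ` M1 \<union> snd ` M1'"
      using T(3) by (metis image_Un)+
    have yn: "y \<notin> snd ` T" "y \<notin> snd ` T'" "y2 \<noteq> y" using un(2) M1 M1' T(9) by blast+
    have x_M1: "x \<notin> fst ` M1" using x M1(2) by blast
    have xn: "x \<notin> fst ` T" "x \<notin> fst ` T'" "x2 \<noteq> x" using un(1) x_M1 M1' T(8) by blast+
    have y2M: "y2 \<in> Q - snd ` M" using T(7) yn(3) M1(2) by auto
    have yPair: "(a, y) \<notin> T" "(a, y) \<notin> T'" "(a, y) \<notin> M1" "(a, y) \<notin> M1'" for a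
      using yn(1,2) M1(5) M1'(5) by (auto simp: image_iff)
    show ?thesis
    \<comment> \<open>The two removed edges at \<open>y\<close> have to be returned, one to each
      side. Which one goes where depends on whether the exchange has newly covered
      \<open>x1\<close>.\<close>
    proof (cases "x2 = x1")
      case False
      \<comment> \<open>Here \<open>T\<close> leaves \<open>x1\<close> free, so both edges return to
        the side they came from.\<close>
      then have x1n: "x1 \<notin> fst ` T" using T(8) M1(4) by auto
      have "partial_matching P Q (insert (x1, y) T)"
        using partial_matching_insert T(1) x1n yn x1P xyPQ by metis
      moreover have "partial_matching P Q (insert (x, y) T')"
        using partial_matching_insert T(2) xn yn xyPQ by metis
      moreover have "insert (x1, y) T \<union> insert (x, y) T' = M \<union> M'"
        using T(3) M1(2) M1'(2) by auto
      moreover have "insert (x1, y) T \<inter> insert (x, y) T' = M \<inter> M'"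
        using T(4) M1(2) M1'(2) yPair x1x by auto
      moreover have "card (insert (x1, y) T) = card M + 1"
        using T(5) yPair finT cM by simp
      moreover have "x2 \<in> P - fst ` M" using T(6) False M1(2) by auto
      moreover have "fst ` insert (x1, y) T = insert x2 (fst ` M)" "snd ` insert (x1, y) T = insert y2 (snd ` M)"
        using T(8,9) M1(2) by auto
      ultimately show ?thesis using y2M by blast
    next
      case True
      have x1T: "x1 \<in> fst ` T" using T(8) True by auto
      \<comment> \<open>Here the edges change sides and \<open>x\<close> takes over as the new first
        component. An edge at \<open>x1\<close> must come from \<open>M1'\<close>; one in
        \<open>T\<close> and one in \<open>T'\<close> would coincide and lie in
        \<open>T \<inter> T' = M1 \<inter> M1'\<close>, which avoids \<open>x1\<close>.\<close>
      have x1T': "x1 \<notin> fst ` T'"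
      proof
        assume "x1 \<in> fst ` T'"
        then obtain b where b: "(x1, b) \<in> T'" by auto
        obtain a where a: "(x1, a) \<in> T" using x1T by auto
        have "(x1, a) \<in> M1'" "(x1, b) \<in> M1'" using a b T(3) M1(4) by force+
        then have "a = b" using M1'(1) unfolding partial_matching_def inj_on_def by fastforce
        then have "(x1, a) \<in> M1" using T(4) a b by blast
        then show False using M1(4) by force
      qed
      have "partial_matching P Q (insert (x, y) T)"
        using partial_matching_insert T(1) xn yn xyPQ by metis
      moreover have "partial_matching P Q (insert (x1, y) T')"
        using partial_matching_insert T(2) x1T' yn xyPQ x1P by metis
      moreover have "insert (x, y) T \<union> insert (x1, y) T' = M \<union> M'"
        using T(3) M1(2) M1'(2) by auto
      moreover have "insert (x, y) T \<inter> insert (x1, y) T' = M \<inter> M'"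
        using T(4) M1(2) M1'(2) yPair x1x by auto
      moreover have "card (insert (x, y) T) = card M + 1"
        using T(5) yPair finT cM by simp
      moreover have "x \<in> P - fst ` M" using x xyPQ by auto
      moreover have "fst ` insert (x, y) T = insert x (fst ` M)" "snd ` insert (x, y) T = insert y2 (snd ` M)"
        using T(8,9) M1(2) True by auto
      ultimately show ?thesis using y2M by blast
    qed
  qed
qed

text \<open>Pairing both sides in the order of \<open>\<tau>\<close> makes all edges across an
  initial segment \<open>D\<close> run in the same direction, so their number is the imbalance of
  \<open>D\<close>. The pairing is built from the top: two maxima are matched and removed.\<close>

lemma monotone_matching:
  fixes \<tau> :: "'a \<Rightarrow> nat"
  assumes "finite P" "finite Q" "card P = card Q"
  shows "\<exists>M. partial_matching P Q M \<and> fst ` M = P \<and> snd ` M = Q \<and>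
    (\<forall>D. (\<forall>a\<in>P \<union> Q. \<forall>b\<in>P \<union> Q. \<tau> b \<le> \<tau> a \<longrightarrow> a \<in> D \<longrightarrow> b \<in> D) \<longrightarrow>
      (\<Sum>(a, b)\<in>M. \<bar>of_bool (a \<in> D) - of_bool (b \<in> D)\<bar>) = \<bar>int (card (P \<inter> D)) - int (card (Q \<inter> D))\<bar>)"
  using assms
proof (induction "card P" arbitrary: P Q)
  case 0
  then show ?case by (intro exI[of _ "{}"]) (auto simp: partial_matching_def)
next
  case (Suc k)
  have ne: "P \<noteq> {}" "Q \<noteq> {}" using Suc by auto
  obtain p where p: "p \<in> P" "\<And>a. a \<in> P \<Longrightarrow> \<tau> a \<le> \<tau> p"
    using Max_in[of "\<tau> ` P"] Max_ge[of "\<tau> ` P"] ne Suc.prems(1) by (metis (no_types, lifting) finite_imageI image_iff image_is_empty)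
  obtain q where q: "q \<in> Q" "\<And>a. a \<in> Q \<Longrightarrow> \<tau> a \<le> \<tau> q"
    using Max_in[of "\<tau> ` Q"] Max_ge[of "\<tau> ` Q"] ne Suc.prems(2) by (metis (no_types, lifting) finite_imageI image_iff image_is_empty)
  define P' where "P' = P - {p}"
  define Q' where "Q' = Q - {q}"
  have PQ: "P = insert p P'" "Q = insert q Q'" "p \<notin> P'" "q \<notin> Q'" "finite P'" "finite Q'"
    using p q Suc.prems by (auto simp: P'_def Q'_def)
  have c: "card P' = k" "card Q' = k" using PQ Suc by auto
  obtain M where M: "partial_matching P' Q' M" "fst ` M = P'" "snd ` M = Q'" and
    D: "\<And>D. (\<forall>a\<in>P' \<union> Q'. \<forall>b\<in>P' \<union> Q'. \<tau> b \<le> \<tau> a \<longrightarrow> a \<in> D \<longrightarrow> b \<in> D) \<Longrightarrow>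
      (\<Sum>(a, b)\<in>M. \<bar>of_bool (a \<in> D) - of_bool (b \<in> D)\<bar>) = \<bar>int (card (P' \<inter> D)) - int (card (Q' \<inter> D))\<bar>"
    using Suc.hyps(1)[of P' Q'] c PQ by metis
  have finM: "finite M" using M(1) by (simp add: partial_matching_def)
  have pq: "(p, q) \<notin> M" using M(2) PQ(3) by (metis fst_conv image_eqI)
  have "partial_matching P Q (insert (p, q) M)"
    by (rule partial_matching_insert) (use M PQ p q in \<open>auto simp: partial_matching_def\<close>)
  moreover have "(\<Sum>(a, b)\<in>insert (p, q) M. \<bar>of_bool (a \<in> D) - of_bool (b \<in> D)\<bar>) = \<bar>int (card (P \<inter> D)) - int (card (Q \<inter> D))\<bar>"
    if down: "\<forall>a\<in>P \<union> Q. \<forall>b\<in>P \<union> Q. \<tau> b \<le> \<tau> a \<longrightarrow> a \<in> D \<longrightarrow> b \<in> D" for D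
  proof -
    have IH: "(\<Sum>(a, b)\<in>M. \<bar>of_bool (a \<in> D) - of_bool (b \<in> D)\<bar>) = \<bar>int (card (P' \<inter> D)) - int (card (Q' \<inter> D))\<bar>"
      by (rule D) (use down PQ in auto)
    have cP: "card (P \<inter> D) = card (P' \<inter> D) + of_bool (p \<in> D)"
      "card (Q \<inter> D) = card (Q' \<inter> D) + of_bool (q \<in> D)"
      using PQ by (auto simp: Int_insert_left)
    have le: "card (P' \<inter> D) \<le> k" "card (Q' \<inter> D) \<le> k"
      using card_mono[of P' "P' \<inter> D"] card_mono[of Q' "Q' \<inter> D"] PQ c by auto
    \<comment> \<open>If the maximum \<open>p\<close> lies in \<open>D\<close>, then so does all of
      \<open>P'\<close>, and \<open>k\<close> is the largest possible count. Hence an edge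
      \<open>(p, q)\<close> with just one end in \<open>D\<close> enlarges the imbalance and never
      cancels it.\<close>
    have "p \<in> D \<Longrightarrow> P' \<inter> D = P'" "q \<in> D \<Longrightarrow> Q' \<inter> D = Q'"
      using down p q PQ by blast+
    then have "p \<in> D \<Longrightarrow> card (P' \<inter> D) = k" "q \<in> D \<Longrightarrow> card (Q' \<inter> D) = k"
      using c by auto
    then show ?thesis using IH cP le finM pq by auto
  qed
  ultimately show ?case using M PQ by (intro exI[of _ "insert (p, q) M"]) auto
qed

section \<open>Flows on the gaps of the circle\<close>

lemma cut_coord_eq:
  assumes "0 < L" "z \<in> {0..<L}" "\<theta> \<in> {0..<L}"
  shows "cut_coord L \<theta> z = z - \<theta> + (if z < \<theta> then L else 0)"
  unfolding cut_coord_def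
proof (rule rmod_unique)
  show "(z - \<theta>) = z - \<theta> + (if z < \<theta> then L else 0) + of_int (if z < \<theta> then -1 else 0) * L" by simp
qed (use assms in auto)

text \<open>Atoms are numbered from 1 and gap \<open>g\<close> is the one that starts at atom
  \<open>g\<close>, so one index set serves for both. The signs are constrained for every natural
  number, which saves range conditions.\<close>

locale circle_atoms =
  fixes L :: real and N :: nat and z :: "nat \<Rightarrow> real" and \<sigma> :: "nat \<Rightarrow> int"
  assumes L_pos: "0 < L" and N_pos: "1 \<le> N"
    and z_strict: "\<And>i j. 1 \<le> i \<Longrightarrow> i < j \<Longrightarrow> j \<le> N \<Longrightarrow> z i < z j"
    and z_range: "\<And>i. 1 \<le> i \<Longrightarrow> i \<le> N \<Longrightarrow> z i \<in> {0..<L}"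
    and \<sigma>_cases: "\<And>i. \<sigma> i = 1 \<or> \<sigma> i = -1"
begin

definition src :: "nat set" where "src = {i\<in>{1..N}. \<sigma> i = 1}"
definition tgt :: "nat set" where "tgt = {i\<in>{1..N}. \<sigma> i = -1}"

definition ell :: "nat \<Rightarrow> real" where
  "ell g = (if g < N then z (g + 1) - z g else z 1 + L - z N)"

definition gap :: "nat \<Rightarrow> real set" where
  "gap j = (if j < N then {z j<..<z (j + 1)} else {z N<..<L} \<union> {0..<z 1})"

text \<open>The unit flow from \<open>i\<close> to \<open>k\<close> along the arc that avoids gap
  \<open>N\<close>. Any other unit flow with these ends differs from it by a constant.\<close>

definition step :: "nat \<Rightarrow> nat \<Rightarrow> nat \<Rightarrow> int" where
  "step i k g = of_bool (i \<le> g) - of_bool (k \<le> g)"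

text \<open>The flow with the charges of \<open>B\<close> that vanishes just before atom 1. If
  \<open>B\<close> is balanced it also vanishes on gap \<open>N\<close>, so it closes up around the
  circle.\<close>

definition prefix :: "nat set \<Rightarrow> nat \<Rightarrow> int" where
  "prefix B g = (\<Sum>i\<in>B. \<sigma> i * of_bool (i \<le> g))"

definition flow_cost :: "(nat \<Rightarrow> int) \<Rightarrow> real" where
  "flow_cost F = (\<Sum>g\<in>{1..N}. ell g * \<bar>F g\<bar>)"

lemma z_mono: "1 \<le> i \<Longrightarrow> i \<le> j \<Longrightarrow> j \<le> N \<Longrightarrow> z i \<le> z j"
  using z_strict by (cases "i = j") (auto simp: less_imp_le)

lemma z_less_iff: "i \<in> {1..N} \<Longrightarrow> j \<in> {1..N} \<Longrightarrow> z i < z j \<longleftrightarrow> i < j"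
  using z_strict z_mono by (meson atLeastAtMost_iff not_less)

lemma inj_z: "inj_on z {1..N}"
  by (rule inj_onI) (metis z_less_iff less_irrefl nat_neq_iff)

lemma ell_pos: "g \<in> {1..N} \<Longrightarrow> 0 < ell g"
  using z_strict[of g "g+1"] z_range[of 1] z_range[of N] N_pos by (auto simp: ell_def)

lemma sum_ell_from:
  assumes "1 \<le> i" "i \<le> N"
  shows "(\<Sum>g\<in>{i..N}. ell g) = z 1 + L - z i"
  using assms(2,1)
proof (induction rule: inc_induct)
  case base
  then show ?case by (simp add: ell_def)
next
  case (step n)
  have "{n..N} = insert n {Suc n..N}" using step by auto
  then show ?case using step by (simp add: ell_def)
qed

lemma sum_ell_ge:
  assumes "i \<in> {1..N}"
  shows "(\<Sum>g\<in>{1..N}. ell g * of_bool (i \<le> g)) = z 1 + L - z i"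
proof -
  have "(\<Sum>g\<in>{1..N}. ell g * of_bool (i \<le> g)) = (\<Sum>g\<in>{1..N}. if i \<le> g then ell g else 0)"
    by (rule sum.cong) auto
  also have "\<dots> = (\<Sum>g\<in>{1..N} \<inter> {g. i \<le> g}. ell g)" by (subst sum.If_cases) auto
  also have "{1..N} \<inter> {g. i \<le> g} = {i..N}" using assms by auto
  finally show ?thesis using sum_ell_from assms by simp
qed

lemma sum_ell: "(\<Sum>g\<in>{1..N}. ell g) = L"
  using sum_ell_from[of 1] N_pos by simp

lemma sum_ell_step:
  assumes "i \<in> {1..N}" "k \<in> {1..N}"
  shows "(\<Sum>g\<in>{1..N}. ell g * of_int (step i k g + \<delta>)) = z k - z i + of_int \<delta> * L"
proof -
  have "(\<Sum>g\<in>{1..N}. ell g * of_int (step i k g + \<delta>)) =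
    (\<Sum>g\<in>{1..N}. ell g * of_bool (i \<le> g)) - (\<Sum>g\<in>{1..N}. ell g * of_bool (k \<le> g)) + of_int \<delta> * (\<Sum>g\<in>{1..N}. ell g)"
    by (simp add: step_def sum_distrib_left algebra_simps sum.distrib sum_subtractf)
  then show ?thesis using sum_ell_ge assms sum_ell by simp
qed

text \<open>A flow of constant sign allows the absolute value to be moved out of the sum.\<close>

lemma sum_ell_abs_step:
  assumes "i \<in> {1..N}" "k \<in> {1..N}" "(\<forall>g. 0 \<le> step i k g + \<delta>) \<or> (\<forall>g. step i k g + \<delta> \<le> 0)"
  shows "(\<Sum>g\<in>{1..N}. ell g * \<bar>step i k g + \<delta>\<bar>) = \<bar>z k - z i + of_int \<delta> * L\<bar>"
proof -
  obtain s :: int where s: "s = 1 \<or> s = -1" "\<And>g. \<bar>step i k g + \<delta>\<bar> = s * (step i k g + \<delta>)"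
  proof (cases "\<forall>g. 0 \<le> step i k g + \<delta>")
    case True
    then show ?thesis using that[of 1] by simp
  next
    case False
    then have "\<forall>g. step i k g + \<delta> \<le> 0" using assms(3) by blast
    then show ?thesis using that[of "-1"] by simp
  qed
  have "(\<Sum>g\<in>{1..N}. ell g * of_int \<bar>step i k g + \<delta>\<bar>) = of_int s * (\<Sum>g\<in>{1..N}. ell g * of_int (step i k g + \<delta>))"
    unfolding s(2) by (simp add: sum_distrib_left mult.assoc mult.left_commute)
  then have eq: "(\<Sum>g\<in>{1..N}. ell g * of_int \<bar>step i k g + \<delta>\<bar>) = of_int s * (z k - z i + of_int \<delta> * L)"
    using sum_ell_step assms by simp
  moreover have "0 \<le> (\<Sum>g\<in>{1..N}. ell g * of_int \<bar>step i k g + \<delta>\<bar>)"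
    by (intro sum_nonneg mult_nonneg_nonneg) (auto intro!: less_imp_le ell_pos)
  ultimately show ?thesis using s(1) by auto
qed

lemma z_diff_bound: "i \<in> {1..N} \<Longrightarrow> k \<in> {1..N} \<Longrightarrow> \<bar>z i - z k\<bar> < L"
  using z_range[of i] z_range[of k] by auto

lemma circ_dist_step:
  assumes "i \<in> {1..N}" "k \<in> {1..N}"
  shows "\<exists>\<delta>. circ_dist L (z i) (z k) = (\<Sum>g\<in>{1..N}. ell g * \<bar>step i k g + \<delta>\<bar>)"
proof (cases "\<bar>z i - z k\<bar> \<le> L - \<bar>z i - z k\<bar>")
  case True
  have "(\<forall>g. 0 \<le> step i k g + 0) \<or> (\<forall>g. step i k g + 0 \<le> 0)"
    by (cases "i \<le> k") (auto simp: step_def)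
  from sum_ell_abs_step[OF assms this] show ?thesis
    using True by (intro exI[of _ 0]) (simp add: circ_dist_def)
next
  case False
  \<comment> \<open>The way round the other side: cancelling the unit on the direct arc leaves an
    opposite unit on the complementary arc.\<close>
  define \<delta> :: int where "\<delta> = (if i \<le> k then -1 else 1)"
  have "(\<forall>g. 0 \<le> step i k g + \<delta>) \<or> (\<forall>g. step i k g + \<delta> \<le> 0)"
    by (cases "i \<le> k") (auto simp: step_def \<delta>_def)
  from sum_ell_abs_step[OF assms this] have "(\<Sum>g\<in>{1..N}. ell g * \<bar>step i k g + \<delta>\<bar>) = \<bar>z k - z i + of_int \<delta> * L\<bar>" .
  also have "\<dots> = L - \<bar>z i - z k\<bar>"
  proof (cases "i \<le> k")
    case True
    then show ?thesis using z_mono[of i k] z_diff_bound[OF assms] assms by (simp add: \<delta>_def)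
  next
    case False
    then show ?thesis using z_mono[of k i] z_diff_bound[OF assms] assms by (simp add: \<delta>_def)
  qed
  finally show ?thesis using False by (intro exI[of _ \<delta>]) (simp add: circ_dist_def)
qed

lemma gap_range:
  assumes "j \<in> {1..N}" "\<theta> \<in> gap j" shows "\<theta> \<in> {0..<L}"
proof -
  have "0 \<le> z j" "j < N \<Longrightarrow> z (j+1) < L" "0 \<le> z N" "z 1 < L"
    using z_range[of j] z_range[of "j+1"] z_range[of N] z_range[of 1] assms N_pos by auto
  then show ?thesis using assms(2) by (auto simp: gap_def split: if_splits)
qed

text \<open>In coordinates gap \<open>N\<close> has a piece after the last atom and a piece before
  the first one. From the one all cut coordinates are raised by \<open>L\<close>, from the other
  none, so distances between atoms agree.\<close>

lemma gap_cut:
  assumes "j \<in> {1..N}" "\<theta> \<in> gap j"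
  shows "(\<forall>i\<in>{1..N}. z i < \<theta> \<longleftrightarrow> i \<le> j) \<or> (j = N \<and> (\<forall>i\<in>{1..N}. \<not> z i < \<theta>))"
proof (cases "j < N")
  case True
  have "z i < \<theta> \<longleftrightarrow> i \<le> j" if "i \<in> {1..N}" for i
  proof
    assume "z i < \<theta>"
    then have "z i < z (j+1)" using assms True by (auto simp: gap_def)
    then show "i \<le> j" using z_less_iff[of i "j+1"] True that by auto
  next
    assume "i \<le> j"
    then show "z i < \<theta>" using z_mono[of i j] assms True that by (auto simp: gap_def)
  qed
  then show ?thesis by blast
next
  case False
  then have "z N < \<theta> \<or> \<theta> < z 1" using assms by (auto simp: gap_def)
  then show ?thesis using z_mono[of _ N] z_mono[of 1] False assms(1) by fastforce
qed

lemma line_dist_cases: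
  assumes "i \<in> {1..N}" "k \<in> {1..N}" "j \<in> {1..N}" "\<theta> \<in> gap j"
  shows "line_dist L \<theta> (z i) (z k) = \<bar>z k - z i - of_int (step i k j) * L\<bar>"
proof -
  have t: "cut_coord L \<theta> (z i) = z i - \<theta> + (if z i < \<theta> then L else 0)" if "i \<in> {1..N}" for i
    using cut_coord_eq[OF L_pos] z_range that gap_range assms(3,4) by auto
  show ?thesis using gap_cut[OF assms(3,4)] t[OF assms(1)] t[OF assms(2)] assms(1,2)
    by (auto simp: line_dist_def step_def)
qed

lemma line_dist_step:
  assumes "i \<in> {1..N}" "k \<in> {1..N}" "j \<in> {1..N}" "\<theta> \<in> gap j"
  shows "line_dist L \<theta> (z i) (z k) = (\<Sum>g\<in>{1..N}. ell g * \<bar>step i k g - step i k j\<bar>)"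
proof -
  have "(\<forall>g. 0 \<le> step i k g + (- step i k j)) \<or> (\<forall>g. step i k g + (- step i k j) \<le> 0)"
    by (cases "i \<le> k") (auto simp: step_def)
  from sum_ell_abs_step[OF assms(1,2) this] line_dist_cases[OF assms]
  show ?thesis by simp
qed

lemma circ_dist_le_line_dist:
  assumes "i \<in> {1..N}" "k \<in> {1..N}" "j \<in> {1..N}" "\<theta> \<in> gap j"
  shows "circ_dist L (z i) (z k) \<le> line_dist L \<theta> (z i) (z k)"
proof -
  have "step i k j \<in> {-1, 0, 1}" by (auto simp: step_def)
  then show ?thesis using z_diff_bound[OF assms(1,2)]
    unfolding line_dist_cases[OF assms] circ_dist_def by auto
qed

lemma src_tgt: "src \<inter> tgt = {}" "src \<union> tgt = {1..N}" "finite src" "finite tgt"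
  using \<sigma>_cases by (auto simp: src_def tgt_def)

lemma circ_cost_le_line_cost:
  assumes "partial_matching src tgt M" "j \<in> {1..N}" "\<theta> \<in> gap j"
  shows "(\<Sum>(i, k)\<in>M. circ_dist L (z i) (z k)) \<le> (\<Sum>(i, k)\<in>M. line_dist L \<theta> (z i) (z k))"
proof (intro sum_mono, clarify)
  fix a b assume "(a, b) \<in> M"
  then have "a \<in> {1..N}" "b \<in> {1..N}" using assms(1) src_tgt(2) by (auto simp: partial_matching_def)
  then show "circ_dist L (z a) (z b) \<le> line_dist L \<theta> (z a) (z b)"
    using circ_dist_le_line_dist assms by blast
qed

section \<open>Translation between matchings and flows\<close>

lemma sum_split_types:
  assumes "B \<subseteq> {1..N}"
  shows "(\<Sum>i\<in>B. \<sigma> i * f i) = (\<Sum>i\<in>B \<inter> src. f i) - (\<Sum>i\<in>B \<inter> tgt. f i)"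
proof -
  have fin: "finite B" using assms finite_subset by blast
  have B: "B = (B \<inter> src) \<union> (B \<inter> tgt)" using assms src_tgt by blast
  have "(\<Sum>i\<in>B. \<sigma> i * f i) = (\<Sum>i\<in>B \<inter> src. \<sigma> i * f i) + (\<Sum>i\<in>B \<inter> tgt. \<sigma> i * f i)"
    by (subst B, rule sum.union_disjoint) (use fin src_tgt in auto)
  moreover have "(\<Sum>i\<in>B \<inter> src. \<sigma> i * f i) = (\<Sum>i\<in>B \<inter> src. f i)"
    by (rule sum.cong) (auto simp: src_def)
  moreover have "(\<Sum>i\<in>B \<inter> tgt. \<sigma> i * f i) = (\<Sum>i\<in>B \<inter> tgt. - f i)"
    by (rule sum.cong) (auto simp: tgt_def)
  ultimately show ?thesis by (simp add: sum_negf)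
qed

lemma sum_matching_step:
  assumes "partial_matching src tgt M"
  shows "(\<Sum>(i, k)\<in>M. step i k g) = prefix (fst ` M \<union> snd ` M) g"
proof -
  have M: "M \<subseteq> src \<times> tgt" "inj_on fst M" "inj_on snd M" using assms by (auto simp: partial_matching_def)
  have f: "fst ` M \<subseteq> src" "snd ` M \<subseteq> tgt" using M(1) by auto
  have B: "(fst ` M \<union> snd ` M) \<inter> src = fst ` M" "(fst ` M \<union> snd ` M) \<inter> tgt = snd ` M"
    using f src_tgt(1) by blast+
  have "fst ` M \<union> snd ` M \<subseteq> {1..N}" using f src_tgt(2) by blast
  from sum_split_types[OF this] show ?thesis
    unfolding prefix_def B
    by (simp add: sum.reindex[OF M(2)] sum.reindex[OF M(3)] step_def case_prod_unfold sum_subtractf)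
qed

text \<open>Each edge sends one unit along its geodesic. Opposite units on a gap cancel in the total
  flow but not in the cost, which is the triangle inequality on each gap; \<open>c\<close> collects
  the offsets of the individual geodesics.\<close>

lemma circ_cost_ge_flow_cost:
  assumes "partial_matching src tgt M"
  shows "\<exists>c. flow_cost (\<lambda>g. prefix (fst ` M \<union> snd ` M) g + c) \<le> (\<Sum>(i, k)\<in>M. circ_dist L (z i) (z k))"
proof -
  have M: "M \<subseteq> {1..N} \<times> {1..N}" using assms src_tgt(2) by (auto simp: partial_matching_def)
  then have "\<forall>e\<in>M. \<exists>\<delta>. circ_dist L (z (fst e)) (z (snd e)) = (\<Sum>g\<in>{1..N}. ell g * \<bar>step (fst e) (snd e) g + \<delta>\<bar>)"
    by (intro ballI circ_dist_step) auto
  then obtain \<delta> where \<delta>: "\<And>e. e \<in> M \<Longrightarrow> circ_dist L (z (fst e)) (z (snd e)) = (\<Sum>g\<in>{1..N}. ell g * \<bar>step (fst e) (snd e) g + \<delta> e\<bar>)"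
    by metis
  have "flow_cost (\<lambda>g. prefix (fst ` M \<union> snd ` M) g + (\<Sum>e\<in>M. \<delta> e))
    = (\<Sum>g\<in>{1..N}. ell g * \<bar>\<Sum>e\<in>M. step (fst e) (snd e) g + \<delta> e\<bar>)"
    using sum_matching_step[OF assms] by (simp add: flow_cost_def sum.distrib case_prod_unfold)
  also have "\<dots> \<le> (\<Sum>g\<in>{1..N}. ell g * (\<Sum>e\<in>M. \<bar>step (fst e) (snd e) g + \<delta> e\<bar>))"
  proof (intro sum_mono mult_left_mono)
    fix g assume "g \<in> {1..N}"
    show "real_of_int \<bar>\<Sum>e\<in>M. step (fst e) (snd e) g + \<delta> e\<bar> \<le> real_of_int (\<Sum>e\<in>M. \<bar>step (fst e) (snd e) g + \<delta> e\<bar>)"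
      using sum_abs of_int_le_iff by blast
  qed (use ell_pos less_imp_le in blast)
  also have "\<dots> = (\<Sum>e\<in>M. \<Sum>g\<in>{1..N}. ell g * \<bar>step (fst e) (snd e) g + \<delta> e\<bar>)"
    unfolding of_int_sum sum_distrib_left by (rule sum.swap)
  also have "\<dots> = (\<Sum>(i, k)\<in>M. circ_dist L (z i) (z k))"
    using \<delta> by (simp add: case_prod_unfold)
  finally show ?thesis by blast
qed

text \<open>Seen from gap \<open>j\<close>, the atoms passed on the way to gap \<open>g\<close> form
  an initial segment whose imbalance is the flow through \<open>g\<close>. The monotone matching
  crosses \<open>g\<close> exactly that often.\<close>

lemma line_matching_exists:
  assumes B: "B \<subseteq> {1..N}" and c: "card (B \<inter> src) = card (B \<inter> tgt)" and j: "j \<in> {1..N}"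
  shows "\<exists>M. partial_matching src tgt M \<and> fst ` M = B \<inter> src \<and> snd ` M = B \<inter> tgt \<and>
    (\<forall>\<theta>\<in>gap j. (\<Sum>(i, k)\<in>M. line_dist L \<theta> (z i) (z k)) = flow_cost (\<lambda>g. prefix B g - prefix B j))"
proof -
  have fin: "finite (B \<inter> src)" "finite (B \<inter> tgt)" using src_tgt by auto
  \<comment> \<open>The clockwise order that begins just after gap \<open>j\<close>.\<close>
  define \<tau> where "\<tau> = (\<lambda>i. if i \<le> j then i + N else i)"
  obtain M where M: "partial_matching (B \<inter> src) (B \<inter> tgt) M" "fst ` M = B \<inter> src" "snd ` M = B \<inter> tgt" and
    MD: "\<And>D. (\<forall>a\<in>(B \<inter> src) \<union> (B \<inter> tgt). \<forall>b\<in>(B \<inter> src) \<union> (B \<inter> tgt). \<tau> b \<le> \<tau> a \<longrightarrow> a \<in> D \<longrightarrow> b \<in> D) \<Longrightarrow>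
      (\<Sum>(a, b)\<in>M. \<bar>of_bool (a \<in> D) - of_bool (b \<in> D)\<bar>) = \<bar>int (card ((B \<inter> src) \<inter> D)) - int (card ((B \<inter> tgt) \<inter> D))\<bar>"
    using monotone_matching[OF fin c, of \<tau>] by metis
  have un: "(B \<inter> src) \<union> (B \<inter> tgt) = B" using B src_tgt(2) by blast
  have M': "M \<subseteq> {1..N} \<times> {1..N}" using M B unfolding partial_matching_def by blast
  have sum0: "(\<Sum>i\<in>B. \<sigma> i) = 0" using sum_split_types[OF B, of "\<lambda>_. 1"] c by simp
  have key: "(\<Sum>(i, k)\<in>M. \<bar>step i k g - step i k j\<bar>) = \<bar>prefix B g - prefix B j\<bar>" if g: "g \<in> {1..N}" for g
  proof -
    define D where "D = (if j \<le> g then {i. j < i \<and> i \<le> g} else {i. j < i \<or> i \<le> g})"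
    have "\<forall>a\<in>B. \<forall>b\<in>B. \<tau> b \<le> \<tau> a \<longrightarrow> a \<in> D \<longrightarrow> b \<in> D"
      using B j g by (auto simp: \<tau>_def D_def split: if_splits)
    then have 1: "(\<Sum>(a, b)\<in>M. \<bar>of_bool (a \<in> D) - of_bool (b \<in> D)\<bar>) = \<bar>int (card ((B \<inter> src) \<inter> D)) - int (card ((B \<inter> tgt) \<inter> D))\<bar>"
      using MD[of D] un by simp
    have 2: "\<bar>step i k g - step i k j\<bar> = \<bar>of_bool (i \<in> D) - of_bool (k \<in> D)\<bar>" for i k
      by (auto simp: step_def D_def)
    \<comment> \<open>If the way from gap \<open>j\<close> to gap \<open>g\<close> passes gap
      \<open>N\<close>, the two prefix indicators fall short by one for every atom. Since
      \<open>B\<close> is balanced, \<open>sum0\<close> removes this constant.\<close>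
    have 3: "(of_bool (i \<in> D) :: int) = (of_bool (i \<le> g) - of_bool (i \<le> j)) + of_bool (\<not> j \<le> g)" for i
      by (auto simp: D_def)
    have "prefix B g - prefix B j + (\<Sum>i\<in>B. \<sigma> i) * of_bool (\<not> j \<le> g) = (\<Sum>i\<in>B. \<sigma> i * of_bool (i \<in> D))"
      unfolding prefix_def 3 by (simp only: sum_distrib_right sum.distrib sum_subtractf distrib_left right_diff_distrib)
    also have "\<dots> = int (card ((B \<inter> src) \<inter> D)) - int (card ((B \<inter> tgt) \<inter> D))"
      using fin by (simp add: sum_split_types[OF B])
    finally show ?thesis using 1 2 sum0 by (simp add: case_prod_unfold)
  qed
  have "(\<Sum>(i, k)\<in>M. line_dist L \<theta> (z i) (z k)) = flow_cost (\<lambda>g. prefix B g - prefix B j)" if "\<theta> \<in> gap j" for \<theta>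
  proof -
    have "(\<Sum>(i, k)\<in>M. line_dist L \<theta> (z i) (z k)) = (\<Sum>e\<in>M. \<Sum>g\<in>{1..N}. ell g * \<bar>step (fst e) (snd e) g - step (fst e) (snd e) j\<bar>)"
      using M' line_dist_step[OF _ _ j that] by (intro sum.cong) (fastforce simp: subset_iff)+
    also have "\<dots> = (\<Sum>g\<in>{1..N}. ell g * (\<Sum>e\<in>M. \<bar>step (fst e) (snd e) g - step (fst e) (snd e) j\<bar>))"
      unfolding of_int_sum sum_distrib_left by (rule sum.swap)
    also have "\<dots> = flow_cost (\<lambda>g. prefix B g - prefix B j)"
      unfolding flow_cost_def
      by (rule sum.cong) (use key in \<open>auto simp: case_prod_unfold simp del: of_int_sum of_int_diff\<close>)
    finally show ?thesis .
  qed
  moreover have "partial_matching src tgt M" using M(1) by (auto simp: partial_matching_def)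
  ultimately show ?thesis using M by blast
qed

section \<open>Cells and greedy activation\<close>


definition arc :: "nat \<Rightarrow> nat \<Rightarrow> nat set" where
  "arc u v = (if u < v then {u<..<v} else {u<..N} \<union> {1..<v})"

text \<open>While \<open>arc\<close> is a set of atoms, \<open>cell\<close> is read as a set of gap
  numbers: adding the starting atom gives all gaps passed clockwise from \<open>u\<close> to
  \<open>v\<close>. For \<open>u = v\<close> these are all gaps, as needed when a single atom is
  left in the list.\<close>

definition cell :: "nat \<Rightarrow> nat \<Rightarrow> nat set" where
  "cell u v = insert u (arc u v)"

definition ring_links :: "nat set \<Rightarrow> (nat \<Rightarrow> nat) \<Rightarrow> (nat \<Rightarrow> nat) \<Rightarrow> bool" where
  "ring_links I nx pv \<longleftrightarrow> I \<subseteq> {1..N} \<and>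
    (\<forall>u\<in>I. nx u \<in> I \<and> pv (nx u) = u \<and> arc u (nx u) \<inter> I = {} \<and> pv u \<in> I \<and> nx (pv u) = u)"

lemma finite_cell [simp]: "finite (cell u v)"
  by (simp add: cell_def arc_def)

lemma cell_subset: "u \<in> {1..N} \<Longrightarrow> v \<in> {1..N} \<Longrightarrow> cell u v \<subseteq> {1..N}"
  by (auto simp: cell_def arc_def)

lemma ring_linksD:
  assumes "ring_links I nx pv" "u \<in> I"
  shows "u \<in> {1..N}" "nx u \<in> I" "pv (nx u) = u" "arc u (nx u) \<inter> I = {}" "pv u \<in> I" "nx (pv u) = u"
  using assms by (auto simp: ring_links_def)

text \<open>A common gap would put an end of one cell into the interior of the other, but interiors
  contain no listed atom.\<close>

lemma ring_cells_disjoint: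
  assumes R: "ring_links I nx pv" and u: "u \<in> I" "u' \<in> I" "u \<noteq> u'"
  shows "cell u (nx u) \<inter> cell u' (nx u') = {}"
proof (rule ccontr)
  assume "\<not> ?thesis"
  then obtain g where g: "g \<in> cell u (nx u)" "g \<in> cell u' (nx u')" by auto
  note U = ring_linksD[OF R u(1)] and U' = ring_linksD[OF R u(2)]
  have n: "nx u \<noteq> nx u'" using U(3) U'(3) u(3) by metis
  have "u' \<notin> arc u (nx u)" "nx u' \<notin> arc u (nx u)" "u \<notin> arc u' (nx u')" "nx u \<notin> arc u' (nx u')"
    using U U' u by auto
  then show False using g U(1) U'(1) ring_linksD(1)[OF R U(2)] ring_linksD(1)[OF R U'(2)] u(3) n
    by (auto simp: cell_def arc_def split: if_splits)
qed

lemma ring_cells_cover: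
  assumes R: "ring_links I nx pv" and ne: "I \<noteq> {}"
  shows "(\<Union>u\<in>I. cell u (nx u)) = {1..N}"
proof
  show "(\<Union>u\<in>I. cell u (nx u)) \<subseteq> {1..N}"
    using cell_subset ring_linksD(1,2)[OF R] by blast
  have fin: "finite I" using R by (meson finite_atLeastAtMost finite_subset ring_links_def)
  show "{1..N} \<subseteq> (\<Union>u\<in>I. cell u (nx u))"
  proof
    fix g assume g: "g \<in> {1..N}"
    show "g \<in> (\<Union>u\<in>I. cell u (nx u))"
    proof (cases "{u\<in>I. u \<le> g} = {}")
      case False
      define u where "u = Max {u\<in>I. u \<le> g}"
      have u: "u \<in> I" "u \<le> g" using Max_in[OF _ False] fin by (auto simp: u_def)
      have mx: "\<And>a. a \<in> I \<Longrightarrow> a \<le> g \<Longrightarrow> a \<le> u" using fin by (auto simp: u_def)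
      have "g \<in> cell u (nx u)"
        using u mx[OF ring_linksD(2)[OF R u(1)]] g by (fastforce simp: cell_def arc_def)
      then show ?thesis using u by blast
    next
      case True
      \<comment> \<open>No listed atom comes before \<open>g\<close>, so \<open>g\<close> belongs to
        the cell that wraps around, and this one starts at the last listed atom.\<close>
      define u where "u = Max I"
      have u: "u \<in> I" using ne fin by (simp add: u_def)
      have mx: "\<And>a. a \<in> I \<Longrightarrow> a \<le> u" using fin by (auto simp: u_def)
      have n: "nx u \<in> I" using ring_linksD(2)[OF R u] .
      then have "nx u \<le> u" "g < nx u" using mx True by auto
      then have "g \<in> cell u (nx u)" using g by (auto simp: cell_def arc_def)
      then show ?thesis using u by blast
    qed
  qed
qed

lemma ring_finite: "ring_links I nx pv \<Longrightarrow> finite I"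
  by (meson finite_atLeastAtMost finite_subset ring_links_def)

lemma sum_over_ring_cells:
  assumes R: "ring_links I nx pv" and ne: "I \<noteq> {}"
  shows "(\<Sum>g\<in>{1..N}. f g) = (\<Sum>u\<in>I. \<Sum>g\<in>cell u (nx u). f g)"
  unfolding ring_cells_cover[OF R ne, symmetric]
  by (rule sum.UNION_disjoint) (use ring_finite[OF R] ring_cells_disjoint[OF R] in auto)

lemma ring_bij: "ring_links I nx pv \<Longrightarrow> bij_betw nx I I"
  by (rule bij_betwI[where g = pv]) (auto simp: ring_links_def)

text \<open>Three consecutive cells merge into one. The case \<open>p = q\<close> is included: it
  arises when three atoms are listed, and the merged cell is then the whole circle.\<close>

lemma ring_remove:
  assumes R: "ring_links I nx pv" and u: "u \<in> I" and nuv: "u \<noteq> nx u" and nq: "nx (nx u) \<noteq> u"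
  defines "v \<equiv> nx u" and "p \<equiv> pv u" and "q \<equiv> nx (nx u)"
  shows "p \<in> I - {u, v}" "q \<in> I - {u, v}" "ring_links (I - {u, v}) (nx(p := q)) (pv(q := p))"
    "cell p q = cell p u \<union> cell u v \<union> cell v q"
proof -
  have v: "v \<in> I" and q: "q \<in> I" and p: "p \<in> I"
    using ring_linksD[OF R u] ring_linksD[OF R] by (auto simp: v_def q_def p_def)
  note U = ring_linksD[OF R u] and V = ring_linksD[OF R v] and P = ring_linksD[OF R p]
  have np: "nx p = u" by (simp add: p_def U)
  have pu: "p \<noteq> u" using np nuv by metis
  have pv': "p \<noteq> v" using np nq by (auto simp: v_def)
  have qv: "q \<noteq> v" using U(3) V(3) nuv by (metis q_def v_def)
  have qu: "q \<noteq> u" using nq by (simp add: q_def)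
  show p': "p \<in> I - {u, v}" and q': "q \<in> I - {u, v}" using p q pu pv' qv qu by auto
  have arcs: "arc p u \<inter> I = {}" "arc u v \<inter> I = {}" "arc v q \<inter> I = {}"
    using P(4) np U(4) V(4) by (auto simp: v_def q_def)
  have mem: "p \<in> {1..N}" "q \<in> {1..N}" "u \<in> {1..N}" "v \<in> {1..N}"
    using ring_linksD(1)[OF R] p q u v by auto
  have out: "q \<notin> arc p u" "v \<notin> arc p u" "p \<notin> arc u v" "q \<notin> arc u v" "p \<notin> arc v q" "u \<notin> arc v q"
    using arcs p q u v by auto
  have uv: "u \<noteq> v" using nuv by (simp add: v_def)
  show cell: "cell p q = cell p u \<union> cell u v \<union> cell v q"
    using out mem pu pv' qv qu uv unfolding cell_def arc_def
    by (cases "p < u"; cases "u < v"; cases "v < q"; cases "p < q") auto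
  have "arc p q \<subseteq> arc p u \<union> arc u v \<union> arc v q \<union> {u, v}"
    using cell by (auto simp: cell_def arc_def)
  then have arcpq: "arc p q \<inter> (I - {u, v}) = {}" using arcs by blast
  show "ring_links (I - {u, v}) (nx(p := q)) (pv(q := p))"
    unfolding ring_links_def
  proof (intro conjI ballI)
    show "I - {u, v} \<subseteq> {1..N}" using R by (auto simp: ring_links_def)
    fix w assume w: "w \<in> I - {u, v}"
    note W = ring_linksD[OF R, of w]
    have a: "w \<noteq> p \<Longrightarrow> nx w \<noteq> u" using W(3) w by (auto simp: p_def)
    have b: "nx w \<noteq> v" using W(3) w U(3) by (auto simp: v_def)
    have c: "w \<noteq> p \<Longrightarrow> nx w \<noteq> q" using W(3) w V(3) by (auto simp: q_def v_def)
    have d: "w \<noteq> q \<Longrightarrow> pv w \<noteq> v" using W(6) w by (auto simp: q_def v_def)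
    have e: "pv w \<noteq> u" using W(6) w by (auto simp: v_def)
    have f: "w \<noteq> q \<Longrightarrow> pv w \<noteq> p" using W(6) w np by auto
    show "(nx(p := q)) w \<in> I - {u, v}" using W(2) w a b q' by auto
    show "(pv(q := p)) ((nx(p := q)) w) = w" using W(3) w c by auto
    show "arc w ((nx(p := q)) w) \<inter> (I - {u, v}) = {}" using W(4) w arcpq by auto
    show "(pv(q := p)) w \<in> I - {u, v}" using W(5) w d e p' by auto
    show "(nx(p := q)) ((pv(q := p)) w) = w" using W(6) w f by auto
  qed
qed

lemma ring_last_two:
  assumes R: "ring_links I nx pv" and u: "u \<in> I" and nq: "nx (nx u) = u"
  shows "I = {u, nx u}"
proof -
  note U = ring_linksD[OF R u] and V = ring_linksD[OF R ring_linksD(2)[OF R u]]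
  have "w = u \<or> w = nx u" if "w \<in> I" for w
  proof -
    have "w \<notin> arc u (nx u)" "w \<notin> arc (nx u) u" using U(4) V(4) that nq by auto
    then show ?thesis using ring_linksD(1)[OF R that] by (auto simp: arc_def split: if_splits)
  qed
  then show ?thesis using u U(2) by auto
qed

text \<open>Between two listed atoms \<open>a < b\<close> of different types, the last listed atom
  before \<open>b\<close> with the type of \<open>a\<close> has a successor of the other
  type.\<close>

lemma ring_opposite_exists:
  assumes R: "ring_links I nx pv" and s: "s \<in> I \<inter> src" and t: "t \<in> I \<inter> tgt"
  shows "\<exists>u\<in>I. \<sigma> u \<noteq> \<sigma> (nx u)"
proof -
  have *: "\<exists>u\<in>I. \<sigma> u \<noteq> \<sigma> (nx u)" if ab: "a \<in> I" "b \<in> I" "a < b" "\<sigma> a \<noteq> \<sigma> b" for a b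
  proof -
    define S where "S = {i\<in>I. i < b \<and> \<sigma> i = \<sigma> a}"
    define u where "u = Max S"
    have fin: "finite S" and ne: "S \<noteq> {}" using ring_finite[OF R] ab by (auto simp: S_def)
    have u: "u \<in> I" "u < b" "\<sigma> u = \<sigma> a" using Max_in[OF fin ne] by (auto simp: u_def S_def)
    have mx: "\<And>i. i \<in> I \<Longrightarrow> i < b \<Longrightarrow> \<sigma> i = \<sigma> a \<Longrightarrow> i \<le> u" using fin by (auto simp: u_def S_def)
    note U = ring_linksD[OF R u(1)]
    have "b \<notin> arc u (nx u)" using U(4) ab by auto
    then have "u < nx u" "nx u \<le> b" using u(2) ring_linksD(1)[OF R ab(2)] by (auto simp: arc_def split: if_splits)
    then have "\<sigma> (nx u) \<noteq> \<sigma> a" using mx[OF U(2)] ab by (cases "nx u = b") auto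
    then show ?thesis using u by (intro bexI[of _ u]) auto
  qed
  have st: "\<sigma> s \<noteq> \<sigma> t" "s \<noteq> t" using s t by (auto simp: src_def tgt_def)
  then show ?thesis using *[of s t] *[of t s] s t by (cases "s < t") auto
qed

text \<open>A unit flow between listed atoms jumps only at its two ends. This also holds across gap
  \<open>N\<close>, where \<open>step\<close> is 0.\<close>

lemma step_on_cell:
  assumes R: "ring_links I nx pv" and u: "u \<in> I" and xy: "x \<in> I" "y \<in> I"
  shows "g \<in> cell u (nx u) \<Longrightarrow> step x y g = step x y u"
    and "step x y (nx u) - step x y u = of_bool (nx u = x) - of_bool (nx u = y)"
proof -
  note U = ring_linksD[OF R u]
  have out: "x \<notin> arc u (nx u)" "y \<notin> arc u (nx u)" using U(4) xy by auto
  have mem: "x \<in> {1..N}" "y \<in> {1..N}" "u \<in> {1..N}" "nx u \<in> {1..N}" using ring_linksD(1)[OF R] xy u U(2) by auto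
  show "g \<in> cell u (nx u) \<Longrightarrow> step x y g = step x y u"
    using out mem by (auto simp: cell_def arc_def step_def split: if_splits)
  show "step x y (nx u) - step x y u = of_bool (nx u = x) - of_bool (nx u = y)"
    using out mem by (auto simp: arc_def step_def split: if_splits)
qed

section \<open>Costs of shifting a flow on a cell, and the dual certificate\<close>

definition shift :: "(nat \<Rightarrow> int) \<Rightarrow> nat set \<Rightarrow> int \<Rightarrow> real" where
  "shift F A d = (\<Sum>g\<in>A. ell g * (\<bar>F g + d\<bar> - \<bar>F g\<bar>))"

definition potential :: "real \<Rightarrow> nat \<Rightarrow> real" where
  "potential \<mu> u = (if \<sigma> u = 1 then 0 else \<mu>)"

definition dual_feasible :: "(nat \<Rightarrow> int) \<Rightarrow> nat set \<Rightarrow> (nat \<Rightarrow> nat) \<Rightarrow> real \<Rightarrow> bool" where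
  "dual_feasible F I nx \<mu> \<longleftrightarrow>
    (\<forall>u\<in>I. \<forall>d. of_int d * (potential \<mu> (nx u) - potential \<mu> u) \<le> shift F (cell u (nx u)) d)"

definition flow_of :: "nat set \<Rightarrow> (nat \<Rightarrow> int) \<Rightarrow> bool" where
  "flow_of B F \<longleftrightarrow> (\<exists>c. \<forall>g\<in>{1..N}. F g = prefix B g + c)"

text \<open>Convexity: in either direction every gap contributes a convex function of the shift that
  vanishes at 0, so \<open>n\<close> unit steps cost at least \<open>n\<close> times the first
  one.\<close>

lemma shift_superlinear:
  assumes "A \<subseteq> {1..N}" "0 \<le> n" "s = 1 \<or> s = -1"
  shows "of_int n * shift F A s \<le> shift F A (n * s)"
proof -
  have "real_of_int n * (\<bar>F g + s\<bar> - \<bar>F g\<bar>) \<le> \<bar>F g + n * s\<bar> - \<bar>F g\<bar>" for g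
  proof (cases "n = 0")
    case False
    then have n: "1 \<le> n" using assms by simp
    have "n * (\<bar>F g + s\<bar> - \<bar>F g\<bar>) \<le> \<bar>F g + n * s\<bar> - \<bar>F g\<bar>"
    proof (cases "0 \<le> s * F g")
      case True
      then have "\<bar>F g + s\<bar> - \<bar>F g\<bar> = 1" "\<bar>F g + n * s\<bar> - \<bar>F g\<bar> = n" using assms(3) n by auto
      then show ?thesis by simp
    next
      case False
      then have "\<bar>F g + s\<bar> - \<bar>F g\<bar> = -1" using assms(3) by auto
      moreover have "- n \<le> \<bar>F g + n * s\<bar> - \<bar>F g\<bar>" using assms(3) n by auto
      ultimately show ?thesis by simp
    qed
    then show ?thesis by (metis (mono_tags) of_int_diff of_int_le_iff of_int_mult)
  qed simp
  then show ?thesis unfolding shift_def sum_distrib_left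
    using ell_pos assms(1)
    by (intro sum_mono) (smt (verit, best) in_mono mult.left_commute mult_left_mono)
qed

lemma shift_shift: "shift (\<lambda>g. F g + a) A d = shift F A (a + d) - shift F A a"
  by (simp add: shift_def flip: sum_subtractf) (simp add: algebra_simps)

text \<open>A cell with ends of equal type does not see the potential. Otherwise the difference of
  the potentials is \<open>\<sigma> u * \<mu>\<close>: for shifts \<open>d\<close> with the sign of
  \<open>\<sigma> u\<close> the new constraint follows from the unit shift by convexity, and for the
  opposite sign it is weaker than the old one.\<close>

lemma dual_feasible_raise:
  assumes R: "ring_links I nx pv" and D: "dual_feasible F I nx \<mu>"
    and le: "\<mu> \<le> \<kappa>" and min: "\<And>u. u \<in> I \<Longrightarrow> \<sigma> u \<noteq> \<sigma> (nx u) \<Longrightarrow> \<kappa> \<le> shift F (cell u (nx u)) (\<sigma> u)"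
  shows "dual_feasible F I nx \<kappa>"
  unfolding dual_feasible_def
proof (intro ballI allI)
  fix u and d :: int assume u: "u \<in> I"
  note U = ring_linksD[OF R u]
  have D: "of_int d * (potential \<mu> (nx u) - potential \<mu> u) \<le> shift F (cell u (nx u)) d"
    using D u by (auto simp: dual_feasible_def)
  show "of_int d * (potential \<kappa> (nx u) - potential \<kappa> u) \<le> shift F (cell u (nx u)) d"
  proof (cases "\<sigma> u = \<sigma> (nx u)")
    case True
    then show ?thesis using D by (simp add: potential_def)
  next
    case False
    have pd: "potential m (nx u) - potential m u = real_of_int (\<sigma> u) * m" for m
      using False \<sigma>_cases[of u] \<sigma>_cases[of "nx u"] by (auto simp: potential_def)
    show ?thesis
    proof (cases "0 \<le> d * \<sigma> u")
      case True
      have sub: "cell u (nx u) \<subseteq> {1..N}" using cell_subset ring_linksD(1)[OF R] U by blast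
      have "real_of_int (d * \<sigma> u) * \<kappa> \<le> of_int (d * \<sigma> u) * shift F (cell u (nx u)) (\<sigma> u)"
        using True min[OF u False] by (intro mult_left_mono) (simp_all only: of_int_0_le_iff)
      also have "\<dots> \<le> shift F (cell u (nx u)) (d * \<sigma> u * \<sigma> u)"
        using shift_superlinear[OF sub True \<sigma>_cases] .
      also have "d * \<sigma> u * \<sigma> u = d" using \<sigma>_cases[of u] by auto
      finally show ?thesis by (simp add: pd)
    next
      case False
      then have "of_int (d * \<sigma> u) * \<kappa> \<le> of_int (d * \<sigma> u) * \<mu>"
        using le by (intro mult_left_mono_neg) (simp_all only: of_int_le_0_iff)
      then show ?thesis using D unfolding pd by simp
    qed
  qed
qed

lemma augmentation_bound:
  assumes R: "ring_links I nx pv" and D: "dual_feasible F I nx \<kappa>"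
    and x: "x \<in> I" "\<sigma> x = 1" and y: "y \<in> I" "\<sigma> y = -1"
  shows "flow_cost F + \<kappa> \<le> flow_cost (\<lambda>g. F g + (step x y g + c))"
proof -
  have ne: "I \<noteq> {}" using x by auto
  have fin: "finite I" using ring_finite[OF R] .
  define h where "h u = step x y u + c" for u
  have "flow_cost (\<lambda>g. F g + h g) - flow_cost F = (\<Sum>g\<in>{1..N}. ell g * (\<bar>F g + h g\<bar> - \<bar>F g\<bar>))"
    by (simp add: flow_cost_def algebra_simps flip: sum_subtractf)
  also have "\<dots> = (\<Sum>u\<in>I. shift F (cell u (nx u)) (h u))"
    unfolding sum_over_ring_cells[OF R ne] shift_def h_def
    using step_on_cell(1)[OF R _ x(1) y(1)] by (intro sum.cong refl) auto
  also have "\<dots> \<ge> (\<Sum>u\<in>I. h u * (potential \<kappa> (nx u) - potential \<kappa> u))"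
    using D by (intro sum_mono) (auto simp: dual_feasible_def)
  \<comment> \<open>Since \<open>nx\<close> permutes \<open>I\<close>, the summation by parts has no
    boundary terms. What remains are the differences of \<open>h\<close>, in which the rotation
    \<open>c\<close> no longer occurs and which vanish except at \<open>x\<close> and
    \<open>y\<close>.\<close>
  also have "(\<Sum>u\<in>I. h u * (potential \<kappa> (nx u) - potential \<kappa> u)) =
    (\<Sum>u\<in>I. h u * potential \<kappa> (nx u)) - (\<Sum>u\<in>I. h (nx u) * potential \<kappa> (nx u))"
    using sum.reindex_bij_betw[OF ring_bij[OF R], of "\<lambda>u. h u * potential \<kappa> u"]
    by (simp add: right_diff_distrib sum_subtractf)
  also have "\<dots> = (\<Sum>u\<in>I. (of_bool (nx u = y) - of_bool (nx u = x)) * potential \<kappa> (nx u))"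
  proof -
    have "h u - h (nx u) = of_bool (nx u = y) - of_bool (nx u = x)" if "u \<in> I" for u
      using step_on_cell(2)[OF R that x(1) y(1)] by (simp add: h_def)
    then have "real_of_int (h u) - h (nx u) = of_bool (nx u = y) - of_bool (nx u = x)" if "u \<in> I" for u
      using that by (metis (mono_tags) of_int_diff of_int_of_bool)
    then show ?thesis by (simp flip: sum_subtractf left_diff_distrib)
  qed
  also have "\<dots> = (\<Sum>u\<in>I. (of_bool (u = y) - of_bool (u = x)) * potential \<kappa> u)"
    using sum.reindex_bij_betw[OF ring_bij[OF R], of "\<lambda>u. (of_bool (u = y) - of_bool (u = x)) * potential \<kappa> u"] by simp
  also have "\<dots> = potential \<kappa> y - potential \<kappa> x"
    using fin x y by (simp add: left_diff_distrib sum_subtractf)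
  also have "\<dots> = \<kappa>" using x y by (simp add: potential_def)
  finally show ?thesis unfolding h_def by simp
qed

lemma prefix_insert_pair:
  assumes "finite A" "x \<notin> A" "y \<notin> A" "\<sigma> x = 1" "\<sigma> y = -1"
  shows "prefix (insert x (insert y A)) g = prefix A g + step x y g"
proof -
  have "x \<noteq> y" using assms by auto
  then show ?thesis using assms by (simp add: prefix_def step_def)
qed

text \<open>The new unit runs clockwise on the cell if \<open>u\<close> is a source and backwards if
  it is a target. On a cell that passes gap \<open>N\<close> this differs from
  \<open>\<sigma> u * step u v\<close> by the constant \<open>\<sigma> u\<close>.\<close>

lemma flow_of_insert_pair:
  assumes "flow_of A F" "finite A" "u \<notin> A" "v \<notin> A" "\<sigma> u \<noteq> \<sigma> v" "u \<in> {1..N}" "v \<in> {1..N}"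
  shows "flow_of (insert u (insert v A)) (\<lambda>g. F g + (if g \<in> cell u v then \<sigma> u else 0))"
proof -
  obtain c where c: "\<And>g. g \<in> {1..N} \<Longrightarrow> F g = prefix A g + c" using assms(1) by (auto simp: flow_of_def)
  have uv: "u \<noteq> v" "\<sigma> v = - \<sigma> u" using assms(5) \<sigma>_cases[of u] \<sigma>_cases[of v] by auto
  have "prefix (insert u (insert v A)) g = prefix A g + \<sigma> u * step u v g" for g
    using assms uv by (auto simp: prefix_def step_def)
  moreover have "(if g \<in> cell u v then \<sigma> u else 0) = \<sigma> u * step u v g + (if u < v then 0 else \<sigma> u)" if "g \<in> {1..N}" for g
    using that uv assms(6,7) by (auto simp: cell_def arc_def step_def)
  ultimately show ?thesis unfolding flow_of_def using c
    by (intro exI[of _ "c + (if u < v then 0 else \<sigma> u)"]) auto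
qed

section \<open>The invariant of greedy activation and its preservation\<close>

definition active :: "(nat \<Rightarrow> nat) \<Rightarrow> nat \<Rightarrow> nat set" where
  "active rk j = {i\<in>{1..N}. rk i \<noteq> 0 \<and> rk i \<le> j}"

definition inactive :: "(nat \<Rightarrow> nat) \<Rightarrow> nat set" where
  "inactive rk = {i\<in>{1..N}. rk i = 0}"

text \<open>Only the lower bound is recorded. That it is attained follows as soon as
  \<open>F\<close> vanishes on some gap, see \<open>optimal_flow_matching\<close>.\<close>

definition optimal_flow :: "nat set \<Rightarrow> nat \<Rightarrow> (nat \<Rightarrow> int) \<Rightarrow> bool" where
  "optimal_flow B k F \<longleftrightarrow> flow_of B F \<and> card (B \<inter> src) = k \<and> card (B \<inter> tgt) = k \<and>
    (\<forall>M. partial_matching src tgt M \<longrightarrow> card M = k \<longrightarrow> flow_cost F \<le> (\<Sum>(i, k)\<in>M. circ_dist L (z i) (z k)))"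

text \<open>All flows \<open>Fs 0\<close>, ..., \<open>Fs k\<close> are remembered because a
  representative must be free in each of them. The number \<open>\<mu>\<close> is the last key
  divided by the weight, and 0 at the start.\<close>

definition greedy_state ::
    "nat \<Rightarrow> (nat \<Rightarrow> nat) \<Rightarrow> (nat \<Rightarrow> nat) \<Rightarrow> (nat \<Rightarrow> nat) \<Rightarrow> (nat \<Rightarrow> nat) \<Rightarrow> (nat \<Rightarrow> nat \<Rightarrow> int) \<Rightarrow> real \<Rightarrow> bool"
  where
  "greedy_state k rk nx pv rp Fs \<mu> \<longleftrightarrow>
    (\<forall>i\<in>{1..N}. rk i \<le> k) \<and> ring_links (inactive rk) nx pv \<and>
    (\<forall>j\<le>k. optimal_flow (active rk j) j (Fs j)) \<and>
    (\<forall>u\<in>inactive rk. Fs k u = 0 \<and> rp u \<in> cell u (nx u) \<and> (\<forall>j\<le>k. Fs j (rp u) = 0)) \<and>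
    dual_feasible (Fs k) (inactive rk) nx \<mu>"

lemma active_subset: "active rk j \<subseteq> {1..N}" "finite (active rk j)"
  by (auto simp: active_def)

lemma flow_with_zero:
  assumes "flow_of B F" "F j = 0" "j \<in> {1..N}"
  shows "flow_cost (\<lambda>g. prefix B g - prefix B j) = flow_cost F"
proof -
  obtain c where c: "\<And>g. g \<in> {1..N} \<Longrightarrow> F g = prefix B g + c" using assms(1) by (auto simp: flow_of_def)
  have "prefix B g - prefix B j = F g" if "g \<in> {1..N}" for g
    using c[OF that] c[OF assms(3)] assms(2) by simp
  then show ?thesis by (simp add: flow_cost_def flip: of_int_diff)
qed

text \<open>Circle distances are at most line distances, and the line matching for the cut at gap
  \<open>j\<close> costs \<open>flow_cost F\<close>, which is also a lower bound on the circle. So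
  all three values coincide.\<close>

lemma optimal_flow_matching:
  assumes O: "optimal_flow B k F" and B: "B \<subseteq> {1..N}" and j: "j \<in> {1..N}" "F j = 0"
  obtains M where "partial_matching src tgt M" "card M = k" "fst ` M = B \<inter> src" "snd ` M = B \<inter> tgt"
    "(\<Sum>(i, k)\<in>M. circ_dist L (z i) (z k)) = flow_cost F"
    "\<forall>\<theta>\<in>gap j. (\<Sum>(i, k)\<in>M. line_dist L \<theta> (z i) (z k)) = flow_cost F"
proof -
  have c: "card (B \<inter> src) = k" "card (B \<inter> tgt) = k" and fl: "flow_of B F" and
    opt: "\<And>M. partial_matching src tgt M \<Longrightarrow> card M = k \<Longrightarrow> flow_cost F \<le> (\<Sum>(i, k)\<in>M. circ_dist L (z i) (z k))"
    using O by (auto simp: optimal_flow_def)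
  obtain M where M: "partial_matching src tgt M" "fst ` M = B \<inter> src" "snd ` M = B \<inter> tgt"
    "\<And>\<theta>. \<theta> \<in> gap j \<Longrightarrow> (\<Sum>(i, k)\<in>M. line_dist L \<theta> (z i) (z k)) = flow_cost F"
    using line_matching_exists[OF B _ j(1)] flow_with_zero[OF fl j(2,1)] c by metis
  have cM: "card M = k" using M(1,2) c card_image[of fst M] by (simp add: partial_matching_def)
  obtain \<theta> where \<theta>: "\<theta> \<in> gap j"
  proof (cases "j < N")
    case True
    then show ?thesis using that[of "(z j + z (j+1)) / 2"] z_strict[of j "j+1"] j(1) by (auto simp: gap_def)
  next
    case False
    then show ?thesis using that[of "(z N + L) / 2"] z_range[of N] N_pos by (auto simp: gap_def)
  qed
  have "(\<Sum>(i, k)\<in>M. circ_dist L (z i) (z k)) \<le> (\<Sum>(i, k)\<in>M. line_dist L \<theta> (z i) (z k))"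
    by (rule circ_cost_le_line_cost) (fact M(1) j(1) \<theta>)+
  then have "(\<Sum>(i, k)\<in>M. circ_dist L (z i) (z k)) = flow_cost F" using opt[OF M(1) cM] M(4)[OF \<theta>] by linarith
  then show ?thesis using that M cM by blast
qed

text \<open>The exchange redistributes the edges of \<open>M\<close> and \<open>M'\<close> without
  changing their total cost. Since \<open>T'\<close> has size \<open>k\<close> and \<open>M\<close>
  is optimal for \<open>k\<close>, \<open>T'\<close> costs at least as much as \<open>M\<close>,
  hence \<open>T\<close> at most as much as \<open>M'\<close>. The flow of \<open>T\<close> is
  \<open>F\<close> plus one augmentation, to which \<open>augmentation_bound\<close>
  applies.\<close>

lemma greedy_step_optimal:
  assumes O: "optimal_flow A k F" and A: "A = {1..N} - I" and R: "ring_links I nx pv"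
    and D: "dual_feasible F I nx \<kappa>" and j: "j \<in> {1..N}" "F j = 0"
    and M': "partial_matching src tgt M'" "card M' = k + 1"
  shows "flow_cost F + \<kappa> \<le> (\<Sum>(i, k)\<in>M'. circ_dist L (z i) (z k))"
proof -
  let ?c = "\<lambda>M. \<Sum>(i, k)\<in>M. circ_dist L (z i) (z k)"
  have sub: "A \<subseteq> {1..N}" using A by auto
  obtain M where M: "partial_matching src tgt M" "card M = k" "fst ` M = A \<inter> src" "snd ` M = A \<inter> tgt" "?c M = flow_cost F"
    using optimal_flow_matching[OF O sub j] by metis
  have less: "card M < card M'" using M M' by simp
  obtain T T' x y where T: "partial_matching src tgt T" "partial_matching src tgt T'"
    "T \<union> T' = M \<union> M'" "T \<inter> T' = M \<inter> M'" "card T = card M + 1"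
    "x \<in> src - fst ` M" "y \<in> tgt - snd ` M" "fst ` T = insert x (fst ` M)" "snd ` T = insert y (snd ` M)"
    using matching_exchange[OF M(1) M'(1) less] by blast
  have fin: "finite T" "finite T'" "finite M" "finite M'"
    using T M M' by (auto simp: partial_matching_def)
  have "card T + card T' = card M + card M'"
    using card_Un_Int[OF fin(1,2)] card_Un_Int[OF fin(3,4)] T by simp
  then have "card T' = k" using T M M' by simp
  then have "?c M \<le> ?c T'" using O T(2) M(5) by (auto simp: optimal_flow_def)
  moreover have "?c T + ?c T' = ?c M + ?c M'"
    using sum.union_inter[OF fin(1,2)] sum.union_inter[OF fin(3,4)] T(3,4) by metis
  ultimately have le: "?c T \<le> ?c M'" by linarith
  have xy: "x \<in> I" "y \<in> I" "\<sigma> x = 1" "\<sigma> y = -1"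
    using T(6,7) M(3,4) A by (auto simp: src_def tgt_def)
  have atoms: "fst ` T \<union> snd ` T = insert x (insert y A)"
  proof -
    have "(A \<inter> src) \<union> (A \<inter> tgt) = A" using src_tgt(2) sub by blast
    then show ?thesis unfolding T(8,9) M(3,4) by auto
  qed
  have fA: "finite A" "x \<notin> A" "y \<notin> A" using A xy by auto
  obtain c where c: "flow_cost (\<lambda>g. prefix (fst ` T \<union> snd ` T) g + c) \<le> ?c T"
    using circ_cost_ge_flow_cost[OF T(1)] by blast
  obtain c0 where c0: "\<And>g. g \<in> {1..N} \<Longrightarrow> F g = prefix A g + c0" using O by (auto simp: optimal_flow_def flow_of_def)
  have "prefix (fst ` T \<union> snd ` T) g + c = F g + (step x y g + (c - c0))" if "g \<in> {1..N}" for g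
    unfolding atoms using prefix_insert_pair[OF fA xy(3,4)] c0[OF that] by simp
  then have "flow_cost (\<lambda>g. prefix (fst ` T \<union> snd ` T) g + c) = flow_cost (\<lambda>g. F g + (step x y g + (c - c0)))"
    unfolding flow_cost_def by (intro sum.cong) (auto simp only:)
  then show ?thesis using augmentation_bound[OF R D xy(1,3,2,4), of "c - c0"] c le by linarith
qed

lemma flow_cost_change:
  assumes "C \<subseteq> {1..N}"
  shows "flow_cost (\<lambda>g. F g + (if g \<in> C then s else 0)) = flow_cost F + shift F C s"
proof -
  have "flow_cost (\<lambda>g. F g + (if g \<in> C then s else 0)) - flow_cost F
    = (\<Sum>g\<in>{1..N}. if g \<in> C then ell g * (\<bar>F g + s\<bar> - \<bar>F g\<bar>) else 0)"
    unfolding flow_cost_def sum_subtractf[symmetric] by (intro sum.cong) (auto simp: algebra_simps)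
  also have "\<dots> = shift F C s"
    using assms by (subst sum.inter_restrict[symmetric]) (auto simp: shift_def Int_absorb1)
  finally show ?thesis by simp
qed

lemma shift_cong: "(\<And>g. g \<in> A \<Longrightarrow> F g = G g) \<Longrightarrow> shift F A d = shift G A d"
  by (simp add: shift_def)

lemma active_update:
  assumes "\<forall>i\<in>{1..N}. rk i \<le> k" "u \<in> inactive rk" "v \<in> inactive rk"
  defines "rk' \<equiv> rk(u := k + 1, v := k + 1)"
  shows "inactive rk' = inactive rk - {u, v}"
    "j \<le> k \<Longrightarrow> active rk' j = active rk j"
    "active rk' (k + 1) = insert u (insert v (active rk k))"
    "active rk k = {1..N} - inactive rk"
  using assms by (auto simp: inactive_def active_def le_Suc_eq)

lemma greedy_step:
  assumes G: "greedy_state k rk nx pv rp Fs \<mu>"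
    and u: "u \<in> inactive rk" "\<sigma> u \<noteq> \<sigma> (nx u)"
    and \<kappa>: "\<kappa> = shift (Fs k) (cell u (nx u)) (\<sigma> u)"
    and min: "\<forall>a\<in>inactive rk. \<sigma> a \<noteq> \<sigma> (nx a) \<longrightarrow> \<kappa> \<le> shift (Fs k) (cell a (nx a)) (\<sigma> a)"
  defines "v \<equiv> nx u" and "p \<equiv> pv u" and "q \<equiv> nx (nx u)"
    and "rk' \<equiv> rk(u := k + 1, nx u := k + 1)"
    and "F' \<equiv> \<lambda>g. Fs k g + (if g \<in> cell u (nx u) then \<sigma> u else 0)"
  shows "flow_cost F' = flow_cost (Fs k) + \<kappa>"
    "q = u \<Longrightarrow> greedy_state (k + 1) rk' nx pv rp (Fs(k + 1 := F')) \<kappa> \<and> inactive rk' = {} \<and>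
       rp v \<in> {1..N} \<and> (\<forall>j\<le>k + 1. (Fs(k + 1 := F')) j (rp v) = 0)"
    "q \<noteq> u \<Longrightarrow> g \<in> {rp p, rp v} \<Longrightarrow>
       greedy_state (k + 1) rk' (nx(p := q)) (pv(q := p)) (rp(p := g)) (Fs(k + 1 := F')) \<kappa> \<and> inactive rk' \<noteq> {}"
proof -
  let ?I = "inactive rk" and ?F = "Fs k" and ?Fs = "Fs(k + 1 := F')"
  have R: "ring_links ?I nx pv" and rk: "\<forall>i\<in>{1..N}. rk i \<le> k"
    and O: "\<And>j. j \<le> k \<Longrightarrow> optimal_flow (active rk j) j (Fs j)"
    and Z: "\<And>u. u \<in> ?I \<Longrightarrow> ?F u = 0" and rp: "\<And>u. u \<in> ?I \<Longrightarrow> rp u \<in> cell u (nx u)"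
    and rp0: "\<And>u j. u \<in> ?I \<Longrightarrow> j \<le> k \<Longrightarrow> Fs j (rp u) = 0" and D: "dual_feasible ?F ?I nx \<mu>"
    using G by (auto simp: greedy_state_def)
  note U = ring_linksD[OF R u(1)]
  have v: "v \<in> ?I" using U by (simp add: v_def)
  have uv: "u \<noteq> v" using u(2) by (auto simp: v_def)
  have vN: "v \<in> {1..N}" using ring_linksD(1)[OF R v] .
  have sub: "cell u v \<subseteq> {1..N}" using cell_subset U(1) vN by blast
  have pot: "potential m v - potential m u = real_of_int (\<sigma> u) * m" for m
    using u(2) \<sigma>_cases[of u] \<sigma>_cases[of v] by (auto simp: potential_def v_def)
  \<comment> \<open>Keys never decrease: this is the old certificate for the chosen cell at the
    shift \<open>d = \<sigma> u\<close>.\<close>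
  have "\<mu> \<le> \<kappa>"
  proof -
    have "\<sigma> u * (potential \<mu> v - potential \<mu> u) \<le> \<kappa>" using D u(1) \<kappa> by (auto simp: dual_feasible_def v_def)
    then show ?thesis unfolding pot using \<sigma>_cases[of u] by auto
  qed
  then have D': "dual_feasible ?F ?I nx \<kappa>" by (rule dual_feasible_raise[OF R D]) (use min in blast)
  have \<kappa>: "\<kappa> = shift ?F (cell u v) (\<sigma> u)" and F': "F' = (\<lambda>g. ?F g + (if g \<in> cell u v then \<sigma> u else 0))"
    using \<kappa> by (auto simp: v_def F'_def)
  note act = active_update[OF rk u(1) v, folded rk'_def[folded v_def]]
  show fc: "flow_cost F' = flow_cost ?F + \<kappa>"
    unfolding \<kappa> F' by (rule flow_cost_change[OF sub])
  have "Fs k (rp u) = 0" "rp u \<in> {1..N}" using rp0[OF u(1)] rp[OF u(1)] sub by (auto simp: v_def)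
  then have opt: "flow_cost F' \<le> (\<Sum>(i, k)\<in>M. circ_dist L (z i) (z k))"
    if "partial_matching src tgt M" "card M = k + 1" for M
    using greedy_step_optimal[OF O[OF order_refl] act(4) R D' _ _ that] fc by auto
  have "optimal_flow (active rk' (k + 1)) (k + 1) F'"
  proof -
    have nin: "u \<notin> active rk k" "v \<notin> active rk k" using act(4) u(1) v by auto
    have fl: "flow_of (active rk k) ?F" "card (active rk k \<inter> src) = k" "card (active rk k \<inter> tgt) = k"
      using O[OF order_refl] by (auto simp: optimal_flow_def)
    have 1: "flow_of (active rk' (k+1)) F'"
      unfolding act(3) F' using flow_of_insert_pair[OF fl(1) active_subset(2) nin _ U(1) vN] u(2) by (simp add: v_def)
    have "(\<sigma> u = 1 \<and> \<sigma> v = -1) \<or> (\<sigma> u = -1 \<and> \<sigma> v = 1)"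
      using u(2) \<sigma>_cases[of u] \<sigma>_cases[of v] by (auto simp: v_def)
    then have "(u \<in> src \<and> u \<notin> tgt \<and> v \<in> tgt \<and> v \<notin> src) \<or> (u \<in> tgt \<and> u \<notin> src \<and> v \<in> src \<and> v \<notin> tgt)"
      using U(1) vN by (auto simp: src_def tgt_def)
    then have "card (active rk' (k+1) \<inter> src) = k + 1" "card (active rk' (k+1) \<inter> tgt) = k + 1"
      unfolding act(3) using fl nin active_subset(2)[of rk k] by (auto simp: Int_insert_left)
    then show ?thesis using 1 opt by (auto simp: optimal_flow_def)
  qed
  then have O': "optimal_flow (active rk' j) j (?Fs j)" if "j \<le> k + 1" for j
    using that O[of j] act(2)[of j] by (cases "j = k + 1") auto
  have rk': "\<forall>i\<in>{1..N}. rk' i \<le> k + 1" using rk by (auto simp: rk'_def le_SucI)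
  have disj: "cell w (nx w) \<inter> cell u v = {}" if "w \<in> ?I" "w \<noteq> u" for w
    using ring_cells_disjoint[OF R that(1) u(1) that(2)] by (simp add: v_def)
  have zero: "?Fs j (rp w) = 0" if "w \<in> ?I" "w \<noteq> u" "j \<le> k + 1" for w j
  proof (cases "j = k + 1")
    case True
    have "rp w \<notin> cell u v" using rp[OF that(1)] disj[OF that(1,2)] by auto
    then show ?thesis using True rp0[OF that(1)] by (auto simp: F')
  qed (use that rp0 in auto)
  show "greedy_state (k + 1) rk' nx pv rp ?Fs \<kappa> \<and> inactive rk' = {} \<and>
       rp v \<in> {1..N} \<and> (\<forall>j\<le>k + 1. ?Fs j (rp v) = 0)" if "q = u"
  proof -
    have "?I = {u, v}" using ring_last_two[OF R u(1)] that by (simp add: q_def v_def)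
    then have e: "inactive rk' = {}" using act by auto
    have "rp v \<in> {1..N}" using rp[OF v] cell_subset[OF vN] ring_linksD(1)[OF R ring_linksD(2)[OF R v]] by blast
    then show ?thesis using e rk' O' zero[OF v] uv
      unfolding greedy_state_def by (auto simp: ring_links_def dual_feasible_def simp del: fun_upd_apply)
  qed
  assume nq: "q \<noteq> u" and g: "g \<in> {rp p, rp v}"
  note RR = ring_remove[OF R u(1), folded v_def, folded p_def q_def[folded v_def]]
  have nxv: "nx v = q" by (simp add: q_def v_def)
  note RR = RR[OF uv, unfolded nxv, OF nq]
  have np: "nx p = u" using U(6) by (simp add: p_def)
  have pI: "p \<in> ?I" "p \<noteq> u" "p \<noteq> v" using RR(1) by auto
  have dj: "cell p u \<inter> cell u v = {}" "cell v q \<inter> cell u v = {}" "cell p u \<inter> cell v q = {}"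
    using disj[OF pI(1,2)] disj[OF v] uv ring_cells_disjoint[OF R pI(1) v pI(3)] np nxv by auto
  have sh: "shift F' (cell w x) d = shift ?F (cell w x) d" if "cell w x \<inter> cell u v = {}" for w x d
    by (rule shift_cong) (use that in \<open>auto simp: F'\<close>)
  have dual: "of_int d * (potential \<kappa> (nx w) - potential \<kappa> w) \<le> shift ?F (cell w (nx w)) d" if "w \<in> ?I" for w d
    using D' that by (auto simp: dual_feasible_def)
  \<comment> \<open>The constraint of the activated cell is tight at the shift
    \<open>\<sigma> u\<close>, where both sides equal \<open>\<kappa>\<close>. Measured from the new
    flow, the certificate therefore holds on it for every \<open>d\<close> with the same potentials.
    Adding the constraints of the three merged cells telescopes to the one from \<open>p\<close> to
    \<open>q\<close>.\<close>
  have dpq: "of_int d * (potential \<kappa> q - potential \<kappa> p) \<le> shift F' (cell p q) d" for d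
  proof -
    have "shift F' (cell u v) d = shift (\<lambda>g. ?F g + \<sigma> u) (cell u v) d"
      by (rule shift_cong) (auto simp: F')
    also have "\<dots> = shift ?F (cell u v) (\<sigma> u + d) - \<kappa>" by (simp add: shift_shift \<kappa>)
    also have "\<dots> \<ge> of_int (\<sigma> u + d) * (potential \<kappa> v - potential \<kappa> u) - \<kappa>"
      using dual[OF u(1), of "\<sigma> u + d"] by (simp add: v_def)
    also have "of_int (\<sigma> u + d) * (potential \<kappa> v - potential \<kappa> u) - \<kappa> = of_int d * (potential \<kappa> v - potential \<kappa> u)"
      using \<sigma>_cases[of u] unfolding pot by (auto simp: algebra_simps)
    finally have 1: "of_int d * (potential \<kappa> v - potential \<kappa> u) \<le> shift F' (cell u v) d" .
    have "shift F' (cell p q) d = shift F' (cell p u) d + shift F' (cell u v) d + shift F' (cell v q) d"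
    proof -
      have "(cell p u \<union> cell u v) \<inter> cell v q = {}" using dj by blast
      then show ?thesis unfolding RR(4) shift_def using dj(1)
        by (simp only: sum.union_disjoint finite_cell finite_UnI)
    qed
    then have "shift F' (cell p q) d = shift ?F (cell p u) d + shift F' (cell u v) d + shift ?F (cell v q) d"
      using sh dj by simp
    then show ?thesis using dual[OF pI(1), of d] dual[OF v, of d] 1 np nxv by (simp add: algebra_simps)
  qed
  have I': "inactive rk' = ?I - {u, v}" using act(1) .
  have dF: "dual_feasible F' (inactive rk') (nx(p := q)) \<kappa>"
    unfolding dual_feasible_def I'
  proof (intro ballI allI)
    fix w d assume w: "w \<in> ?I - {u, v}"
    show "of_int d * (potential \<kappa> ((nx(p := q)) w) - potential \<kappa> w) \<le> shift F' (cell w ((nx(p := q)) w)) d"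
      using dpq[of d] dual[of w d] sh[OF disj[of w]] w by auto
  qed
  have zF: "F' w = 0" if "w \<in> ?I - {u, v}" for w
  proof -
    have "w \<notin> arc u v" using U(4) that by (auto simp: v_def)
    then show ?thesis using Z that by (auto simp: F' cell_def)
  qed
  have rF: "(rp(p := g)) w \<in> cell w ((nx(p := q)) w) \<and> (\<forall>j\<le>k + 1. ?Fs j ((rp(p := g)) w) = 0)" if "w \<in> ?I - {u, v}" for w
  proof (cases "w = p")
    case True
    have "rp p \<in> cell p q" "rp v \<in> cell p q" using rp[OF pI(1)] rp[OF v] np nxv RR(4) by auto
    then show ?thesis using True g zero[OF pI(1,2)] zero[OF v] uv by (auto simp del: fun_upd_apply simp: fun_upd_same)
  next
    case False
    then show ?thesis using that rp zero[of w] by (simp del: fun_upd_apply add: fun_upd_other)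
  qed
  have upd: "?Fs (k + 1) = F'" by simp
  have "greedy_state (k + 1) rk' (nx(p := q)) (pv(q := p)) (rp(p := g)) ?Fs \<kappa>"
    unfolding greedy_state_def I' upd
  proof (intro conjI)
    show "\<forall>u\<in>?I - {u, v}. F' u = 0 \<and> (rp(p := g)) u \<in> cell u ((nx(p := q)) u) \<and> (\<forall>j\<le>k + 1. ?Fs j ((rp(p := g)) u) = 0)"
      using zF rF by blast
    show "dual_feasible F' (?I - {u, v}) (nx(p := q)) \<kappa>" using dF unfolding I' .
    show "\<forall>j\<le>k + 1. optimal_flow (active rk' j) j (?Fs j)" using O' by blast
  qed (fact rk' RR(3))+
  then show "greedy_state (k + 1) rk' (nx(p := q)) (pv(q := p)) (rp(p := g)) ?Fs \<kappa> \<and> inactive rk' \<noteq> {}"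
    using I' RR(1) by blast
qed

section \<open>Keys from prefix tables\<close>


lemma greedy_init:
  assumes rk: "\<And>i. i \<in> {1..N} \<Longrightarrow> rk i = 0"
    and nx: "\<And>i. i \<in> {1..N} \<Longrightarrow> nx i = (if i = N then 1 else i + 1)"
    and pv: "\<And>i. i \<in> {1..N} \<Longrightarrow> pv i = (if i = 1 then N else i - 1)"
    and rp: "\<And>i. i \<in> {1..N} \<Longrightarrow> rp i = i"
  shows "greedy_state 0 rk nx pv rp (\<lambda>_ _. 0) 0"
proof -
  have I: "inactive rk = {1..N}" and act: "active rk 0 = {}" using rk by (auto simp: inactive_def active_def)
  have nxpv: "nx u \<in> {1..N}" "pv u \<in> {1..N}" "pv (nx u) = u" "nx (pv u) = u" if "u \<in> {1..N}" for u
  proof -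
    show 1: "nx u \<in> {1..N}" "pv u \<in> {1..N}" using that nx[OF that] pv[OF that] by auto
    show "pv (nx u) = u" using pv[OF 1(1)] nx[OF that] that by (auto split: if_splits)
    show "nx (pv u) = u" using nx[OF 1(2)] pv[OF that] that by (auto split: if_splits)
  qed
  have ring: "ring_links {1..N} nx pv"
    unfolding ring_links_def
  proof (intro conjI ballI)
    fix u assume u: "u \<in> {1..N}"
    show "arc u (nx u) \<inter> {1..N} = {}" using nx[OF u] u by (auto simp: arc_def)
  qed (use nxpv in auto)
  have "optimal_flow {} 0 (\<lambda>_. 0)"
    unfolding optimal_flow_def flow_of_def
    by (auto simp: prefix_def flow_cost_def partial_matching_def)
  moreover have "dual_feasible (\<lambda>_. 0) {1..N} nx 0"
    unfolding dual_feasible_def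
  proof (intro ballI allI)
    fix u d assume u: "u \<in> {1..N}"
    \<comment> \<open>Starting from the zero flow no shift is profitable, so the zero potential is
      feasible.\<close>
    have "0 \<le> shift (\<lambda>_. 0) (cell u (nx u)) d"
      unfolding shift_def
    proof (rule sum_nonneg)
      fix g assume "g \<in> cell u (nx u)"
      then have "0 < ell g" using cell_subset[OF u nxpv(1)[OF u]] ell_pos by blast
      then show "0 \<le> ell g * real_of_int (\<bar>0 + d\<bar> - \<bar>0\<bar>)" by simp
    qed
    then show "real_of_int d * (potential 0 (nx u) - potential 0 u) \<le> shift (\<lambda>_. 0) (cell u (nx u)) d"
      by (simp add: potential_def)
  qed
  ultimately show ?thesis
    unfolding greedy_state_def I using ring rk rp act by (auto simp: cell_def)
qed

lemma greedy_opposite_exists: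
  assumes G: "greedy_state k rk nx pv rp Fs \<mu>" and k: "k < card src" "k < card tgt"
  shows "\<exists>u\<in>inactive rk. \<sigma> u \<noteq> \<sigma> (nx u)"
proof -
  have R: "ring_links (inactive rk) nx pv" and O: "optimal_flow (active rk k) k (Fs k)"
    and rk: "\<forall>i\<in>{1..N}. rk i \<le> k"
    using G by (auto simp: greedy_state_def)
  have act: "i \<in> active rk k" if "i \<in> {1..N}" "i \<notin> inactive rk" for i
    using that rk by (auto simp: active_def inactive_def)
  have "\<not> src \<subseteq> active rk k" "\<not> tgt \<subseteq> active rk k"
    using O k card_mono[of "active rk k \<inter> src" src] card_mono[of "active rk k \<inter> tgt" tgt] active_subset(2)
    by (auto simp: optimal_flow_def)
  then obtain s t where "s \<in> src" "s \<notin> active rk k" "t \<in> tgt" "t \<notin> active rk k" by blast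
  then have "s \<in> inactive rk \<inter> src" "t \<in> inactive rk \<inter> tgt" using act src_tgt(2) by blast+
  then show ?thesis using ring_opposite_exists[OF R] by blast
qed

section \<open>Transfer from atom numbers to points of the circle\<close>

definition src_pts :: "real set" where "src_pts = z ` src"
definition tgt_pts :: "real set" where "tgt_pts = z ` tgt"

lemma inj_z_types: "inj_on z src" "inj_on z tgt" "inj_on (map_prod z z) (src \<times> tgt)"
proof -
  show 1: "inj_on z src" "inj_on z tgt" using inj_on_subset[OF inj_z] src_tgt(2) by auto
  show "inj_on (map_prod z z) (src \<times> tgt)" by (rule map_prod_inj_on[OF 1])
qed

lemma sum_map_prod_z:
  assumes "partial_matching src tgt M"
  shows "(\<Sum>(x, y)\<in>map_prod z z ` M. f x y) = (\<Sum>(i, k)\<in>M. f (z i) (z k))"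
proof -
  have "inj_on (map_prod z z) M" using assms inj_z_types(3) by (auto simp: partial_matching_def intro: inj_on_subset)
  then show ?thesis by (simp add: sum.reindex case_prod_unfold)
qed

lemma matchings_eq:
  "matchings src_pts tgt_pts k = (\<lambda>M. map_prod z z ` M) ` {M. partial_matching src tgt M \<and> card M = k}"
proof (intro equalityI subsetI)
  fix M' assume M': "M' \<in> matchings src_pts tgt_pts k"
  define M where "M = {(i, k). i \<in> src \<and> k \<in> tgt \<and> (z i, z k) \<in> M'}"
  have sub: "M \<subseteq> src \<times> tgt" by (auto simp: M_def)
  have eq: "map_prod z z ` M = M'"
    using M' unfolding matchings_def src_pts_def tgt_pts_def M_def by (fastforce simp: image_iff)
  have inj: "inj_on (map_prod z z) M" using inj_z_types(3) sub by (rule inj_on_subset)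
  have "card M = k" using M' eq card_image[OF inj] by (auto simp: matchings_def)
  moreover have "inj_on fst M" "inj_on snd M"
  proof -
    have i: "inj_on fst M'" "inj_on snd M'" using M' by (auto simp: matchings_def)
    show "inj_on fst M"
    proof (rule inj_onI)
      fix e e' assume e: "e \<in> M" "e' \<in> M" "fst e = fst e'"
      have "map_prod z z e \<in> M'" "map_prod z z e' \<in> M'" using e eq by auto
      moreover have "fst (map_prod z z e) = fst (map_prod z z e')" using e(3) by (simp add: fst_map_prod)
      ultimately have "map_prod z z e = map_prod z z e'" using i(1) by (meson inj_onD)
      then show "e = e'" using inj e by (auto dest: inj_onD)
    qed
    show "inj_on snd M"
    proof (rule inj_onI)
      fix e e' assume e: "e \<in> M" "e' \<in> M" "snd e = snd e'"
      have "map_prod z z e \<in> M'" "map_prod z z e' \<in> M'" using e eq by auto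
      moreover have "snd (map_prod z z e) = snd (map_prod z z e')" using e(3) by (simp add: snd_map_prod)
      ultimately have "map_prod z z e = map_prod z z e'" using i(2) by (meson inj_onD)
      then show "e = e'" using inj e by (auto dest: inj_onD)
    qed
  qed
  moreover have "finite M" using sub src_tgt by (meson finite_SigmaI finite_subset)
  ultimately show "M' \<in> (\<lambda>M. map_prod z z ` M) ` {M. partial_matching src tgt M \<and> card M = k}"
    using eq sub unfolding partial_matching_def by blast
next
  fix M' assume "M' \<in> (\<lambda>M. map_prod z z ` M) ` {M. partial_matching src tgt M \<and> card M = k}"
  then obtain M where M: "partial_matching src tgt M" "card M = k" "M' = map_prod z z ` M" by auto
  have sub: "M \<subseteq> src \<times> tgt" and i: "inj_on fst M" "inj_on snd M" using M by (auto simp: partial_matching_def)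
  have inj: "inj_on (map_prod z z) M" using inj_z_types(3) sub by (rule inj_on_subset)
  have "card M' = k" using M card_image[OF inj] by auto
  moreover have "M' \<subseteq> src_pts \<times> tgt_pts" using sub M(3) by (auto simp: src_pts_def tgt_pts_def)
  moreover have "inj_on fst M'" "inj_on snd M'"
  proof -
    have "fst ` M \<subseteq> src" "snd ` M \<subseteq> tgt" using sub by auto
    note iz = inj_on_subset[OF inj_z_types(1) this(1)] inj_on_subset[OF inj_z_types(2) this(2)]
    have "inj_on (\<lambda>e. z (fst e)) M" using comp_inj_on[OF i(1) iz(1)] by (simp add: comp_def)
    then show "inj_on fst M'" unfolding M(3) by (intro inj_on_imageI) (simp add: comp_def)
    have "inj_on (\<lambda>e. z (snd e)) M" using comp_inj_on[OF i(2) iz(2)] by (simp add: comp_def)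
    then show "inj_on snd M'" unfolding M(3) by (intro inj_on_imageI) (simp add: comp_def)
  qed
  ultimately show "M' \<in> matchings src_pts tgt_pts k" by (simp add: matchings_def)
qed

lemma finite_matchings: "finite (matchings src_pts tgt_pts k)"
proof -
  have "finite (src_pts \<times> tgt_pts)" using src_tgt by (simp add: src_pts_def tgt_pts_def)
  then have "finite (Pow (src_pts \<times> tgt_pts))" by simp
  then show ?thesis by (rule finite_subset[rotated]) (auto simp: matchings_def)
qed

lemma optimal_flow_costs:
  assumes O: "optimal_flow B k F" and B: "B \<subseteq> {1..N}" and j: "j \<in> {1..N}" "F j = 0" and w: "0 < w"
  shows "circ_cost L w src_pts tgt_pts k = w * flow_cost F"
    and "optimal_active_set L w src_pts tgt_pts k (z ` B)"
    and "\<theta> \<in> gap j \<Longrightarrow> line_cost L w \<theta> src_pts tgt_pts k = w * flow_cost F"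
proof -
  obtain M where M: "partial_matching src tgt M" "card M = k" "fst ` M = B \<inter> src" "snd ` M = B \<inter> tgt"
    "(\<Sum>(i, k)\<in>M. circ_dist L (z i) (z k)) = flow_cost F"
    "\<And>\<theta>. \<theta> \<in> gap j \<Longrightarrow> (\<Sum>(i, k)\<in>M. line_dist L \<theta> (z i) (z k)) = flow_cost F"
    using optimal_flow_matching[OF O B j] by metis
  have opt: "flow_cost F \<le> (\<Sum>(i, k)\<in>M. circ_dist L (z i) (z k))" if "partial_matching src tgt M" "card M = k" for M
    using O that by (auto simp: optimal_flow_def)
  define M' where "M' = map_prod z z ` M"
  have M': "M' \<in> matchings src_pts tgt_pts k" using M by (auto simp: matchings_eq M'_def)
  have c: "matching_cost w d M' = w * (\<Sum>(i, k)\<in>M. d (z i) (z k))" for d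
    unfolding matching_cost_def M'_def sum_map_prod_z[OF M(1)] ..
  show cc: "circ_cost L w src_pts tgt_pts k = w * flow_cost F"
    unfolding circ_cost_def
  proof (rule Min_eqI)
    show "finite (matching_cost w (circ_dist L) ` matchings src_pts tgt_pts k)" using finite_matchings by simp
    show "w * flow_cost F \<in> matching_cost w (circ_dist L) ` matchings src_pts tgt_pts k"
      using M' c[of "circ_dist L"] M(5) by (metis image_eqI)
  next
    fix y assume "y \<in> matching_cost w (circ_dist L) ` matchings src_pts tgt_pts k"
    then obtain T where T: "partial_matching src tgt T" "card T = k" "y = matching_cost w (circ_dist L) (map_prod z z ` T)"
      by (auto simp: matchings_eq)
    then show "w * flow_cost F \<le> y" using opt[OF T(1,2)] w
      by (simp only: matching_cost_def sum_map_prod_z[OF T(1)] mult_le_cancel_left_pos)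
  qed
  have "fst ` M' \<union> snd ` M' = z ` (fst ` M \<union> snd ` M)" unfolding M'_def by (force simp: image_iff)
  also have "fst ` M \<union> snd ` M = B" using M(3,4) src_tgt(2) B by (simp flip: Int_Un_distrib) (simp add: Int_absorb2)
  finally show "optimal_active_set L w src_pts tgt_pts k (z ` B)"
    unfolding optimal_active_set_def cc using M' c[of "circ_dist L"] M(5) by (metis (no_types, lifting))
  assume \<theta>: "\<theta> \<in> gap j"
  show "line_cost L w \<theta> src_pts tgt_pts k = w * flow_cost F"
    unfolding line_cost_def
  proof (rule Min_eqI)
    show "finite (matching_cost w (line_dist L \<theta>) ` matchings src_pts tgt_pts k)" using finite_matchings by simp
    show "w * flow_cost F \<in> matching_cost w (line_dist L \<theta>) ` matchings src_pts tgt_pts k"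
      using M' c[of "line_dist L \<theta>"] M(6)[OF \<theta>] by (metis image_eqI)
  next
    fix y assume "y \<in> matching_cost w (line_dist L \<theta>) ` matchings src_pts tgt_pts k"
    then obtain T where T: "partial_matching src tgt T" "card T = k" "y = matching_cost w (line_dist L \<theta>) (map_prod z z ` T)"
      by (auto simp: matchings_eq)
    have "(\<Sum>(i, k)\<in>T. circ_dist L (z i) (z k)) \<le> (\<Sum>(i, k)\<in>T. line_dist L \<theta> (z i) (z k))"
      by (rule circ_cost_le_line_cost) (fact T(1) j(1) \<theta>)+
    then show "w * flow_cost F \<le> y" using opt[OF T(1,2)] w T(3)
      by (simp only: matching_cost_def sum_map_prod_z[OF T(1)] mult_le_cancel_left_pos)
  qed
qed

section \<open>The tables on the circle unrolled twice\<close>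

definition ext_z :: "nat \<Rightarrow> real" where "ext_z i = (if i \<le> N then z i else z (i - N) + L)"
definition ext_\<sigma> :: "nat \<Rightarrow> int" where "ext_\<sigma> i = (if i \<le> N then \<sigma> i else \<sigma> (i - N))"
text \<open>At \<open>g = 0\<close> this value has no geometric meaning. It enters only the sums
  that start at \<open>s = 0\<close>, where its factor \<open>Rtab 0 - Rtab 0\<close> is 0.\<close>

definition ext_ell :: "nat \<Rightarrow> real" where "ext_ell g = ext_z (g + 1) - ext_z g"
definition Rtab :: "nat \<Rightarrow> int" where "Rtab t = (\<Sum>i\<in>{1..t}. ext_\<sigma> i)"
definition Stab :: "nat \<Rightarrow> real" where "Stab t = (\<Sum>i\<in>{1..t}. ext_\<sigma> i * ext_z i)"

definition is_Qtab :: "real \<Rightarrow> (nat \<Rightarrow> real) \<Rightarrow> nat \<Rightarrow> bool" where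
  "is_Qtab w Q n \<longleftrightarrow> (\<forall>t\<le>n.
    ((\<forall>s<t. Rtab s \<noteq> Rtab t) \<longrightarrow> Q t = 0) \<and>
    (\<forall>p<t. Rtab p = Rtab t \<longrightarrow> (\<forall>s. p < s \<longrightarrow> s < t \<longrightarrow> Rtab s \<noteq> Rtab t) \<longrightarrow> Q t = Q p + w * \<bar>Stab t - Stab p\<bar>))"

lemma Rtab_Suc: "Rtab (Suc t) = Rtab t + ext_\<sigma> (Suc t)" and Stab_Suc: "Stab (Suc t) = Stab t + ext_\<sigma> (Suc t) * ext_z (Suc t)"
  and RS_0: "Rtab 0 = 0" "Stab 0 = 0"
  by (simp_all add: Rtab_def Stab_def)

lemma ext_\<sigma>_cases: "ext_\<sigma> i = 1 \<or> ext_\<sigma> i = -1"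
  using \<sigma>_cases by (simp add: ext_\<sigma>_def)

lemma ext_ell_wrap:
  assumes "1 \<le> g" "g < 2 * N"
  shows "ext_ell g = ell (if g \<le> N then g else g - N)"
  using assms by (auto simp: ext_ell_def ext_z_def ell_def Suc_diff_le)

lemma ext_ell_pos: "1 \<le> g \<Longrightarrow> g < 2 * N \<Longrightarrow> 0 < ext_ell g"
proof -
  assume g: "1 \<le> g" "g < 2 * N"
  then have "(if g \<le> N then g else g - N) \<in> {1..N}" by auto
  then show ?thesis using ell_pos ext_ell_wrap[OF g] by simp
qed

text \<open>Abel summation: up to a boundary term, the signed sum of positions is minus the signed
  area between the walk \<open>Rtab\<close> and its level at \<open>s\<close>.\<close>

lemma Stab_diff:
  assumes "s \<le> t"
  shows "Stab t - Stab s = (Rtab t - Rtab s) * ext_z t - (\<Sum>g\<in>{s..<t}. ext_ell g * (Rtab g - Rtab s))"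
  using assms
proof (induction rule: dec_induct)
  case (step n)
  then show ?case by (simp add: Stab_Suc Rtab_Suc ext_ell_def algebra_simps)
qed simp

text \<open>A walk with steps of size one cannot change sides of a level without visiting it, so the
  first step fixes the side.\<close>

lemma Rtab_const_sign:
  assumes st: "s < t" "Rtab s = Rtab t" and no: "\<And>r. s < r \<Longrightarrow> r < t \<Longrightarrow> Rtab r \<noteq> Rtab s"
  obtains e :: int where "e = 1 \<or> e = -1" "\<And>g. s \<le> g \<Longrightarrow> g < t \<Longrightarrow> \<bar>Rtab g - Rtab s\<bar> = e * (Rtab g - Rtab s)"
proof -
  define e where "e = ext_\<sigma> (Suc s)"
  have e: "e = 1 \<or> e = -1" using ext_\<sigma>_cases by (simp add: e_def)
  have pos: "0 < e * (Rtab g - Rtab s)" if "Suc s \<le> g" "g < t" for g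
    using that
  proof (induction rule: dec_induct)
    case base
    show ?case using e by (auto simp: Rtab_Suc e_def)
  next
    case (step n)
    have "Rtab (Suc n) \<noteq> Rtab s" using no[of "Suc n"] step by auto
    moreover have "\<bar>Rtab (Suc n) - Rtab n\<bar> = 1" using ext_\<sigma>_cases[of "Suc n"] by (auto simp: Rtab_Suc)
    ultimately show ?case using step e by auto
  qed
  have "\<bar>Rtab g - Rtab s\<bar> = e * (Rtab g - Rtab s)" if "s \<le> g" "g < t" for g
    using pos[of g] that e by (cases "g = s") auto
  then show ?thesis using that e by blast
qed

lemma Stab_excursion:
  assumes st: "s < t" "t \<le> 2 * N" "Rtab s = Rtab t" and no: "\<And>r. s < r \<Longrightarrow> r < t \<Longrightarrow> Rtab r \<noteq> Rtab s"
  shows "\<bar>Stab t - Stab s\<bar> = (\<Sum>g\<in>{s..<t}. ext_ell g * \<bar>Rtab g - Rtab s\<bar>)"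
proof -
  obtain e :: int where e: "e = 1 \<or> e = -1" "\<And>g. s \<le> g \<Longrightarrow> g < t \<Longrightarrow> \<bar>Rtab g - Rtab s\<bar> = e * (Rtab g - Rtab s)"
    using Rtab_const_sign[OF st(1,3) no] by blast
  have "(\<Sum>g\<in>{s..<t}. ext_ell g * real_of_int \<bar>Rtab g - Rtab s\<bar>) = of_int e * (\<Sum>g\<in>{s..<t}. ext_ell g * (Rtab g - Rtab s))"
    using e(2) by (simp add: sum_distrib_left mult.left_commute del: of_int_diff of_int_abs)
  also have "\<dots> = of_int (- e) * (Stab t - Stab s)"
    using Stab_diff[of s t] st by simp
  finally have eq: "(\<Sum>g\<in>{s..<t}. ext_ell g * real_of_int \<bar>Rtab g - Rtab s\<bar>) = of_int (- e) * (Stab t - Stab s)" .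
  moreover have "0 \<le> (\<Sum>g\<in>{s..<t}. ext_ell g * real_of_int \<bar>Rtab g - Rtab s\<bar>)"
  proof (rule sum_nonneg)
    fix g assume g: "g \<in> {s..<t}"
    show "0 \<le> ext_ell g * real_of_int \<bar>Rtab g - Rtab s\<bar>"
    \<comment> \<open>At \<open>g = s\<close> the second factor is 0. This also covers
      \<open>s = 0\<close>, where nothing is known about the sign of \<open>ext_ell\<close>.\<close>
    proof (cases "g = s")
      case False
      then show ?thesis using g st(2) ext_ell_pos[of g] by (intro mult_nonneg_nonneg) auto
    qed simp
  qed
  ultimately show ?thesis using e(1) by auto
qed

text \<open>One step of the recursion for \<open>Q\<close> adds the area of the excursion since the
  last visit to the same level. Going back from \<open>t\<close> through last visits,
  \<open>s\<close> is reached because it is itself a visit.\<close>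

lemma Qtab_diff:
  assumes Q: "is_Qtab w Q (2 * N)" and st: "s \<le> t" "t \<le> 2 * N" "Rtab s = Rtab t"
  shows "Q t - Q s = w * (\<Sum>g\<in>{s..<t}. ext_ell g * \<bar>Rtab g - Rtab s\<bar>)"
  using st
proof (induction t arbitrary: s rule: less_induct)
  case (less t)
  show ?case
  proof (cases "s = t")
    case False
    define P where "P = {p. p < t \<and> Rtab p = Rtab t}"
    define p where "p = Max P"
    have P: "finite P" "s \<in> P" using less False by (auto simp: P_def)
    have p: "p < t" "Rtab p = Rtab t" using Max_in[of P, folded p_def] P by (auto simp: P_def)
    have mx: "\<And>r. r < t \<Longrightarrow> Rtab r = Rtab t \<Longrightarrow> r \<le> p" using P by (auto simp: p_def P_def)
    have sp: "s \<le> p" using mx less False by auto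
    have no: "\<And>r. p < r \<Longrightarrow> r < t \<Longrightarrow> Rtab r \<noteq> Rtab t" using mx by fastforce
    have "Q t = Q p + w * \<bar>Stab t - Stab p\<bar>" using Q p no less.prems(2) unfolding is_Qtab_def by blast
    also have "\<bar>Stab t - Stab p\<bar> = (\<Sum>g\<in>{p..<t}. ext_ell g * \<bar>Rtab g - Rtab p\<bar>)"
      by (rule Stab_excursion) (use p no less.prems in auto)
    finally have 1: "Q t = Q p + w * (\<Sum>g\<in>{p..<t}. ext_ell g * \<bar>Rtab g - Rtab s\<bar>)" using p less.prems by simp
    have 2: "Q p - Q s = w * (\<Sum>g\<in>{s..<p}. ext_ell g * \<bar>Rtab g - Rtab s\<bar>)"
      using less.IH[OF p(1) sp] p less.prems by simp
    have "(\<Sum>g\<in>{s..<t}. ext_ell g * real_of_int \<bar>Rtab g - Rtab s\<bar>) =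
      (\<Sum>g\<in>{s..<p}. ext_ell g * \<bar>Rtab g - Rtab s\<bar>) + (\<Sum>g\<in>{p..<t}. ext_ell g * \<bar>Rtab g - Rtab s\<bar>)"
      using sp p(1) by (simp add: sum.atLeastLessThan_concat)
    then show ?thesis using 1 2 by (simp add: distrib_left)
  qed simp
qed

definition wrap :: "nat \<Rightarrow> nat" where "wrap g = (if g \<le> N then g else g - N)"

definition cell_key :: "(nat \<Rightarrow> real) \<Rightarrow> nat \<Rightarrow> nat \<Rightarrow> real" where
  "cell_key Q u v = (let b = (if u < v then v else v + N) in (Q b - Q (u - 1)) - (Q (b - 1) - Q u))"

lemma sum_cell_wrap:
  assumes "u \<in> {1..N}" "v \<in> {1..N}"
  shows "(\<Sum>g\<in>cell u v. f g) = (\<Sum>g\<in>{u..<(if u < v then v else v + N)}. f (wrap g))"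
proof (cases "u < v")
  case True
  have "cell u v = {u..<v}" using True by (auto simp: cell_def arc_def)
  then show ?thesis using True assms by (auto simp: wrap_def intro!: sum.cong)
next
  case False
  have c: "cell u v = {u..N} \<union> {1..<v}" using False assms by (auto simp: cell_def arc_def)
  have "(\<Sum>g\<in>{u..<v + N}. f (wrap g)) = (\<Sum>g\<in>{u..<N + 1}. f (wrap g)) + (\<Sum>g\<in>{N + 1..<v + N}. f (wrap g))"
    using assms by (subst sum.atLeastLessThan_concat) auto
  also have "(\<Sum>g\<in>{u..<N + 1}. f (wrap g)) = (\<Sum>g\<in>{u..N}. f g)"
    by (rule sum.cong) (auto simp: wrap_def)
  also have "(\<Sum>g\<in>{N + 1..<v + N}. f (wrap g)) = (\<Sum>g\<in>{1..<v}. f (wrap (g + N)))"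
    using sum.shift_bounds_nat_ivl[of "\<lambda>g. f (wrap g)" 1 N v] by (simp add: add.commute)
  also have "\<dots> = (\<Sum>g\<in>{1..<v}. f g)"
    by (rule sum.cong) (auto simp: wrap_def)
  finally show ?thesis unfolding c using False by (subst sum.union_disjoint) auto
qed

text \<open>Only active atoms change the flow. The rule persists from gap \<open>N\<close> to gap 1
  because the active set is balanced.\<close>

lemma flow_step_wrap:
  assumes F: "flow_of A F" and A: "A \<subseteq> {1..N}" "(\<Sum>i\<in>A. \<sigma> i) = 0" and g: "1 \<le> g" "g < 2 * N"
  shows "F (wrap (g + 1)) = F (wrap g) + ext_\<sigma> (g + 1) * of_bool (wrap (g + 1) \<in> A)"
proof -
  have fin: "finite A" using A(1) finite_subset by blast
  obtain c where c: "\<And>g. g \<in> {1..N} \<Longrightarrow> F g = prefix A g + c" using F by (auto simp: flow_of_def)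
  have pre: "prefix A (Suc h) = prefix A h + \<sigma> (Suc h) * of_bool (Suc h \<in> A)" for h
  proof -
    have "(\<Sum>i\<in>A. \<sigma> i * of_bool (i \<le> Suc h)) = (\<Sum>i\<in>A. \<sigma> i * of_bool (i \<le> h) + (if i = Suc h then \<sigma> i else 0))"
      by (rule sum.cong) (auto simp: le_Suc_eq)
    then show ?thesis using fin by (simp add: prefix_def sum.distrib sum.delta)
  qed
  have "prefix A N = (\<Sum>i\<in>A. \<sigma> i)" unfolding prefix_def by (rule sum.cong) (use A in auto)
  moreover have "prefix A 0 = 0" unfolding prefix_def by (rule sum.neutral) (use A in auto)
  ultimately have cyc: "prefix A N = prefix A 0" using A by simp
  consider "g < N" | "g = N" | "N < g" by linarith
  then show ?thesis
  proof cases
    case 1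
    then show ?thesis using pre[of g] c g by (simp add: wrap_def ext_\<sigma>_def)
  next
    case 2
    then show ?thesis using pre[of 0] c g cyc by (simp add: wrap_def ext_\<sigma>_def)
  next
    case 3
    then have "g - N \<in> {1..N}" "Suc g - N \<in> {1..N}" using g by auto
    then show ?thesis using 3 pre[of "g - N"] c[of "Suc g - N"] c[of "g - N"] g by (simp add: wrap_def ext_\<sigma>_def Suc_diff_le)
  qed
qed

text \<open>Inside the cell \<open>F\<close> is the walk relative to its level at \<open>u\<close>.
  The first difference of \<open>Q\<close> in the key refers to the level just before
  \<open>u\<close>, which gives the gap terms with \<open>F + \<sigma> u\<close>; the second refers
  to the level at \<open>u\<close> and gives those with \<open>F\<close>.\<close>

lemma cell_key_eq_shift:
  assumes Q: "is_Qtab w Q (2 * N)" and F: "flow_of A F" and A: "A \<subseteq> {1..N}" "(\<Sum>i\<in>A. \<sigma> i) = 0"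
    and uv: "u \<in> {1..N}" "v \<in> {1..N}" "v \<notin> A" "F u = 0" "F v = 0" "arc u v \<subseteq> A" "\<sigma> u \<noteq> \<sigma> v"
  shows "cell_key Q u v = w * shift F (cell u v) (\<sigma> u)"
proof -
  define b where "b = (if u < v then v else v + N)"
  have ne: "u \<noteq> v" using uv by auto
  have b: "u < b" "b \<le> 2 * N" "wrap b = v" "ext_\<sigma> b = \<sigma> v" using uv ne by (auto simp: b_def wrap_def ext_\<sigma>_def)
  have wu: "wrap u = u" "ext_\<sigma> u = \<sigma> u" using uv by (auto simp: wrap_def ext_\<sigma>_def)
  have inA: "wrap g \<in> A" if "u < g" "g < b" for g
  proof -
    have "wrap g \<in> arc u v" using that uv ne by (auto simp: b_def wrap_def arc_def split: if_splits)
    then show ?thesis using uv by auto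
  qed
  have R: "F (wrap g) = Rtab g - Rtab u" if "u \<le> g" "g < b" for g
    using that
  proof (induction rule: dec_induct)
    case base
    show ?case using wu uv by simp
  next
    case (step n)
    then show ?case using flow_step_wrap[OF F A, of n] inA[of "n + 1"] uv b by (simp add: Rtab_Suc)
  qed
  define b1 where "b1 = b - 1"
  have b1: "b = Suc b1" "u \<le> b1" using b by (auto simp: b1_def)
  \<comment> \<open>The inactive atom \<open>v\<close> leaves the flow unchanged, so it vanishes on
    the last gap of the cell as it does on the gap after \<open>v\<close>.\<close>
  have "F (wrap b1) = 0" using flow_step_wrap[OF F A, of b1] b b1 uv by simp
  then have Rb1: "Rtab b1 = Rtab u" using R[of b1] b1 by simp
  have Ru: "Rtab u = Rtab (u - 1) + \<sigma> u" using Rtab_Suc[of "u - 1"] wu uv by simp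
  have "\<sigma> v = - \<sigma> u" using uv(7) \<sigma>_cases[of u] \<sigma>_cases[of v] by auto
  then have Rb: "Rtab b = Rtab (u - 1)" using Rtab_Suc[of b1] b1 b Rb1 Ru by simp
  have ellw: "ext_ell g = ell (wrap g)" if "u \<le> g" "g < b" for g
    using ext_ell_wrap[of g] that uv b by (simp add: wrap_def)
  have "Q b - Q (u - 1) = w * (\<Sum>g\<in>{u - 1..<b}. ext_ell g * \<bar>Rtab g - Rtab (u - 1)\<bar>)"
    by (rule Qtab_diff[OF Q]) (use b Rb in auto)
  \<comment> \<open>The gap before \<open>u\<close> contributes nothing: there the walk is at its
    reference level.\<close>
  also have "(\<Sum>g\<in>{u - 1..<b}. ext_ell g * real_of_int \<bar>Rtab g - Rtab (u - 1)\<bar>) = (\<Sum>g\<in>{u..<b}. ext_ell g * \<bar>Rtab g - Rtab (u - 1)\<bar>)"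
    using uv b by (subst sum.atLeast_Suc_lessThan) auto
  also have "\<dots> = (\<Sum>g\<in>{u..<b}. ell (wrap g) * \<bar>F (wrap g) + \<sigma> u\<bar>)"
    by (rule sum.cong) (use R ellw Ru in auto)
  finally have 1: "Q b - Q (u - 1) = w * (\<Sum>g\<in>{u..<b}. ell (wrap g) * \<bar>F (wrap g) + \<sigma> u\<bar>)" .
  have "Q b1 - Q u = w * (\<Sum>g\<in>{u..<b1}. ext_ell g * \<bar>Rtab g - Rtab u\<bar>)"
    by (rule Qtab_diff[OF Q]) (use b b1 Rb1 in auto)
  also have "(\<Sum>g\<in>{u..<b1}. ext_ell g * real_of_int \<bar>Rtab g - Rtab u\<bar>) = (\<Sum>g\<in>{u..<b}. ext_ell g * \<bar>Rtab g - Rtab u\<bar>)"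
    using b1 Rb1 by simp
  also have "\<dots> = (\<Sum>g\<in>{u..<b}. ell (wrap g) * \<bar>F (wrap g)\<bar>)"
    by (rule sum.cong) (use R ellw in auto)
  finally have 2: "Q b1 - Q u = w * (\<Sum>g\<in>{u..<b}. ell (wrap g) * \<bar>F (wrap g)\<bar>)" .
  have "shift F (cell u v) (\<sigma> u) = (\<Sum>g\<in>{u..<b}. ell (wrap g) * (\<bar>F (wrap g) + \<sigma> u\<bar> - \<bar>F (wrap g)\<bar>))"
    unfolding shift_def b_def by (rule sum_cell_wrap[OF uv(1,2)])
  then have "w * shift F (cell u v) (\<sigma> u) = (Q b - Q (u - 1)) - (Q b1 - Q u)"
    unfolding 1 2 by (simp add: right_diff_distrib sum_subtractf)
  then show ?thesis unfolding cell_key_def b_def[symmetric] b1_def Let_def by simp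
qed

lemma greedy_cell_key:
  assumes G: "greedy_state k rk nx pv rp Fs \<mu>" and Q: "is_Qtab w Q (2 * N)"
    and u: "u \<in> inactive rk" "\<sigma> u \<noteq> \<sigma> (nx u)"
  shows "cell_key Q u (nx u) = w * shift (Fs k) (cell u (nx u)) (\<sigma> u)"
proof -
  have R: "ring_links (inactive rk) nx pv" and O: "optimal_flow (active rk k) k (Fs k)"
    and Z: "\<And>u. u \<in> inactive rk \<Longrightarrow> Fs k u = 0" and rk: "\<forall>i\<in>{1..N}. rk i \<le> k"
    using G by (auto simp: greedy_state_def)
  note U = ring_linksD[OF R u(1)]
  have act: "active rk k = {1..N} - inactive rk" using rk by (auto simp: active_def inactive_def)
  have nN: "nx u \<in> {1..N}" using ring_linksD(1)[OF R U(2)] .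
  have "(\<Sum>i\<in>active rk k. \<sigma> i) = 0"
    using O sum_split_types[OF active_subset(1), of "\<lambda>_. 1" rk k] by (simp add: optimal_flow_def)
  moreover have "arc u (nx u) \<subseteq> active rk k" using U(1,4) nN act by (auto simp: arc_def)
  ultimately show ?thesis
    using cell_key_eq_shift[OF Q _ active_subset(1) _ U(1) nN _ Z[OF u(1)] Z[OF U(2)] _ u(2), of rk k] O U(2)
    by (auto simp: optimal_flow_def act)
qed

end

section \<open>Symbolic execution\<close>

text \<open>Every program is a total function on states, so this condition needs no termination
  clause. Failed accesses and endless loops are visible in \<open>ok\<close> only.\<close>

definition wp :: "'a prog \<Rightarrow> ('a \<Rightarrow> ram \<Rightarrow> bool) \<Rightarrow> ram \<Rightarrow> bool" where
  "wp c Q s = (case run_state c s of (r, s') \<Rightarrow> Q r s')"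

lemma wp_bind: "wp (State_Monad.bind c f) Q s = wp c (\<lambda>r. wp (f r) Q) s"
  by (simp add: wp_def State_Monad.bind_def split: prod.split)

lemma wp_State: "wp (State f) Q s = (case f s of (r, s') \<Rightarrow> Q r s')"
  by (simp add: wp_def)

lemma wp_If: "wp (if b then c else d) Q s = (if b then wp c Q s else wp d Q s)"
  by simp

lemma wp_mono: "wp c P s \<Longrightarrow> (\<And>r s'. P r s' \<Longrightarrow> Q r s') \<Longrightarrow> wp c Q s"
  by (auto simp: wp_def split: prod.splits)

abbreviation ram_of where
  "ram_of ra na h tp tm pk k \<equiv> \<lparr>rarr = ra, narr = na, heap = h, tape = tp, time = tm, peak = pk, ok = k\<rparr>"

definition cells_used :: "(rname \<Rightarrow> real list) \<Rightarrow> (nname \<Rightarrow> nat list) \<Rightarrow> (real \<times> nat \<times> nat) list \<Rightarrow> nat" where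
  "cells_used ra na h = (\<Sum>a\<in>UNIV. length (ra a)) + (\<Sum>a\<in>UNIV. length (na a)) + 3 * length h"

text \<open>The rules are stated for states that are displayed field by field: symbolic execution then keeps
  the state linear in the number of executed operations, which nested record updates do not.\<close>

lemma wp_return: "wp (State_Monad.return x) Q s = Q x s"
  by (simp add: wp_def State_Monad.return_def)

lemma wp_calc:
  "wp (calc c e) Q (ram_of ra na h tp tm pk k) =
   Q e (ram_of ra na h tp (tm + c) pk k)"
  by (simp add: calc_def tick_def wp_bind wp_return wp_State)

lemma wp_rget:
  "wp (rget a i) Q (ram_of ra na h tp tm pk k) =
   Q (ra a ! i) (ram_of ra na h tp (tm + 1) pk (k \<and> i < length (ra a)))"
  by (simp add: rget_def tick_def check_def wp_bind wp_State)

lemma wp_nget: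
  "wp (nget b i) Q (ram_of ra na h tp tm pk k) =
   Q (na b ! i) (ram_of ra na h tp (tm + 1) pk (k \<and> i < length (na b)))"
  by (simp add: nget_def tick_def check_def wp_bind wp_State)

lemma wp_rput:
  "wp (rput a i x) Q (ram_of ra na h tp tm pk k) =
   Q () (ram_of (ra(a := (ra a)[i := x])) na h tp (tm + 1) pk (k \<and> i < length (ra a)))"
  by (simp add: rput_def tick_def check_def wp_bind wp_State)

lemma wp_nput:
  "wp (nput b i y) Q (ram_of ra na h tp tm pk k) =
   Q () (ram_of ra (na(b := (na b)[i := y])) h tp (tm + 1) pk (k \<and> i < length (na b)))"
  by (simp add: nput_def tick_def check_def wp_bind wp_State)

lemma wp_ralloc:
  "wp (ralloc a l) Q (ram_of ra na h tp tm pk k) =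
   Q () (ram_of (ra(a := replicate l 0)) na h tp (tm + 1 + l) (max pk (cells_used (ra(a := replicate l 0)) na h)) k)"
  by (simp add: ralloc_def tick_def wp_bind wp_State update_peak_def footprint_def cells_used_def del: fun_upd_apply)

lemma wp_nalloc:
  "wp (nalloc b l) Q (ram_of ra na h tp tm pk k) =
   Q () (ram_of ra (na(b := replicate l 0)) h tp (tm + 1 + l) (max pk (cells_used ra (na(b := replicate l 0)) h)) k)"
  by (simp add: nalloc_def tick_def wp_bind wp_State update_peak_def footprint_def cells_used_def del: fun_upd_apply)

lemma wp_push:
  "wp (push e) Q (ram_of ra na h tp tm pk k) =
   Q () (ram_of ra na (e # h) tp (tm + 1 + floor_log (1 + length h)) (max pk (cells_used ra na (e # h))) k)"
  by (simp add: push_def tick_heap_def wp_bind wp_State update_peak_def footprint_def cells_used_def)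

lemma wp_pick_below:
  "wp (pick_below c) Q (ram_of ra na h tp tm pk k) =
   Q (tp 0 mod c) (ram_of ra na h (\<lambda>i. tp (Suc i)) (tm + 1) pk k)"
  by (simp add: pick_below_def tick_def wp_bind wp_State)

lemmas wp_simps = wp_bind wp_return wp_calc wp_rget wp_nget wp_rput wp_nput wp_ralloc wp_nalloc wp_push wp_pick_below
  prod.case wp_If

lemma min_entries_nonempty:
  assumes "h \<noteq> []" shows "min_entries h \<noteq> []"
proof -
  obtain e where "e \<in> set h" "fst e = Min (fst ` set h)"
    using Min_in[of "fst ` set h"] assms by (metis (no_types, lifting) finite_imageI finite_set image_iff image_is_empty set_empty)
  then have "e \<in> set (min_entries h)" by (auto simp: min_entries_def)
  then show ?thesis by auto
qed

text \<open>The extracted minimum and the remaining tape are arbitrary in the premise, so a proof by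
  this rule covers every way of breaking ties.\<close>

lemma wp_pop:
  assumes "h \<noteq> []"
    and "\<And>e tp. e \<in> set h \<Longrightarrow> (\<And>e'. e' \<in> set h \<Longrightarrow> fst e \<le> fst e') \<Longrightarrow>
      Q e (ram_of ra na (remove1 e h) tp (tm + 2 + floor_log (1 + length h)) pk k)"
  shows "wp pop Q (ram_of ra na h tp tm pk k)"
proof -
  define e where "e = min_entries h ! (tp 0 mod length (min_entries h))"
  have "e \<in> set (min_entries h)"
    unfolding e_def using min_entries_nonempty[OF assms(1)] by (intro nth_mem) auto
  then have "e \<in> set h" "\<And>e'. e' \<in> set h \<Longrightarrow> fst e \<le> fst e'"
    by (auto simp: min_entries_def)
  from assms(2)[OF this, of "\<lambda>i. tp (Suc i)"] show ?thesis
    using assms(1) by (simp add: pop_def tick_heap_def check_def wp_bind wp_State wp_pick_below e_def)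
qed

text \<open>The time updates in the premises are the costs of the loop counter: 2 per round, charged
  before the body, and 1 for the final test.\<close>

lemma wp_foreach:
  assumes "a \<le> b" "J a s"
    and "\<And>i s. a \<le> i \<Longrightarrow> i < b \<Longrightarrow> J i s \<Longrightarrow> wp (f i) (\<lambda>_ s'. J (i + 1) s') (s\<lparr>time := time s + 2\<rparr>)"
    and "\<And>s. J b s \<Longrightarrow> Q () (s\<lparr>time := time s + 1\<rparr>)"
  shows "wp (foreach [a..<b] f) Q s"
  using assms(1,2,3)
proof (induction "b - a" arbitrary: a s)
  case 0
  then show ?case using assms(4)[of s] by (simp add: tick_def wp_State)
next
  case (Suc n)
  then have ab: "a < b" by simp
  have "wp (f a) (\<lambda>_ s'. J (a + 1) s') (s\<lparr>time := time s + 2\<rparr>)"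
    using Suc.prems ab by blast
  then have "wp (f a) (\<lambda>_ s'. wp (foreach [Suc a..<b] f) Q s') (s\<lparr>time := time s + 2\<rparr>)"
    by (rule wp_mono) (rule Suc.hyps(1), use Suc ab in auto)
  then show ?case unfolding upt_conv_Cons[OF ab] by (simp add: wp_bind tick_def wp_State)
qed

text \<open>The decreasing measure \<open>m\<close> is what makes \<open>while_option\<close> return
  a value.\<close>

lemma wp_until:
  assumes "J s"
    and body: "\<And>s. J s \<Longrightarrow> wp body (\<lambda>r s'. case r of None \<Rightarrow> J s' \<and> m s' < (m s :: nat) | Some x \<Rightarrow> Q x s') (s\<lparr>time := time s + 1\<rparr>)"
  shows "wp (until body) Q s"
proof -
  let ?b = "\<lambda>(r :: 'a option, s :: ram). r = None"
  define C where "C = (\<lambda>(r :: 'a option, s). run_state (do { tick 1; body }) s)"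
  have "\<exists>x s'. while_option ?b C (None, s) = Some (Some x, s') \<and> Q x s'" using assms(1)
  proof (induction "m s" arbitrary: s rule: less_induct)
    case less
    obtain r s' where r: "run_state (do { tick 1; body }) s = (r, s')" by fastforce
    have "run_state body (s\<lparr>time := time s + 1\<rparr>) = (r, s')"
      using r by (simp add: tick_def State_Monad.bind_def)
    then have post: "case r of None \<Rightarrow> J s' \<and> m s' < m s | Some x \<Rightarrow> Q x s'"
      using body[OF less.prems] by (simp add: wp_def)
    have step: "while_option ?b C (None, s) = while_option ?b C (r, s')"
    proof (subst while_option_unfold)
      have "C (None, s) = (r, s')" using r by (simp only: C_def prod.case)
      then show "(if ?b (None, s) then while_option ?b C (C (None, s)) else Some (None, s)) = while_option ?b C (r, s')" by simp
    qed
    show ?case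
    proof (cases r)
      case None
      then show ?thesis using less.hyps[of s'] post step by auto
    next
      case (Some x)
      then show ?thesis using post step by (simp add: while_option_unfold)
    qed
  qed
  then obtain x s' where "while_option ?b C (None, s) = Some (Some x, s')" "Q x s'" by blast
  then show ?thesis unfolding until_def wp_State C_def[symmetric] by simp
qed

lemma UNIV_rname: "UNIV = {Src, Tgt, Zarr, Sarr, Qarr, Carr}"
  by (auto intro: rname.exhaust)

lemma UNIV_nname: "UNIV = {Kind, Rarr, Parr, Last, Next, Prev, Rep, Rank, Theta}"
  by (auto intro: nname.exhaust)

text \<open>Array lengths are bounded uniformly, so that the bound on the footprint survives every update
  without tracking which arrays are already allocated.\<close>

definition small :: "nat \<Rightarrow> ram \<Rightarrow> bool" where
  "small N s \<longleftrightarrow> peak s \<le> 60 * N + 60 \<and> (\<forall>a. length (rarr s a) \<le> 2 * N + 1) \<and>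
     (\<forall>a. length (narr s a) \<le> 4 * N + 1)"

lemma cells_used_le:
  assumes "\<And>a. length (ra a) \<le> 2 * N + 1" "\<And>b. length (na b) \<le> 4 * N + 1" "length h \<le> 2 * N"
  shows "cells_used ra na h \<le> 60 * N + 60"
proof -
  have "(\<Sum>a\<in>UNIV. length (ra a)) \<le> 6 * (2 * N + 1)"
    using assms(1)[of Src] assms(1)[of Tgt] assms(1)[of Zarr] assms(1)[of Sarr] assms(1)[of Qarr] assms(1)[of Carr]
    unfolding UNIV_rname by simp
  moreover have "(\<Sum>a\<in>UNIV. length (na a)) \<le> 9 * (4 * N + 1)"
    using assms(2)[of Kind] assms(2)[of Rarr] assms(2)[of Parr] assms(2)[of Last] assms(2)[of Next] assms(2)[of Prev]
      assms(2)[of Rep] assms(2)[of Rank] assms(2)[of Theta]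
    unfolding UNIV_nname by simp
  \<comment> \<open>Six arrays of reals, nine arrays of naturals and a heap of at most
    \<open>2 * N\<close> triples: together \<open>54 * N + 15\<close> cells.\<close>
  ultimately have "cells_used ra na h \<le> 6 * (2 * N + 1) + 9 * (4 * N + 1) + 3 * (2 * N)"
    using assms(3) unfolding cells_used_def by (intro add_mono mult_le_mono order_refl)
  then show ?thesis by simp
qed

section \<open>The table phase\<close>

locale weighted_circle = circle_atoms +
  fixes w :: real
  assumes w_pos: "0 < w" and N_ge_2: "2 \<le> N"
begin

text \<open>A bound for the charge of one heap access. The heap holds at most \<open>2 * N\<close>
  entries: the initial cells and one new cell per activation.\<close>

definition H :: nat where "H = 1 + floor_log (1 + 2 * N)"

lemma heap_cost: "l \<le> 2 * N \<Longrightarrow> floor_log (1 + l) + 1 \<le> H"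
  by (simp add: H_def floor_log_le_iff)

definition atoms_stored :: "ram \<Rightarrow> bool" where
  "atoms_stored s \<longleftrightarrow> length (rarr s Zarr) = 2 * N + 1 \<and> length (narr s Kind) = 2 * N + 1 \<and>
    (\<forall>i\<in>{1..2 * N}. rarr s Zarr ! i = ext_z i \<and> narr s Kind ! i = of_bool (ext_\<sigma> i = 1))"

definition last_visit :: "nat \<Rightarrow> nat \<Rightarrow> nat \<Rightarrow> bool" where
  "last_visit t r l \<longleftrightarrow> (if l = 0 then \<forall>s<t. Rtab s + 2 * N \<noteq> r
     else l - 1 < t \<and> Rtab (l - 1) + 2 * N = r \<and> (\<forall>s<t. l - 1 < s \<longrightarrow> Rtab s + 2 * N \<noteq> r))"

definition tables_upto :: "nat \<Rightarrow> ram \<Rightarrow> bool" where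
  "tables_upto t s \<longleftrightarrow> ok s \<and> small N s \<and> heap s = [] \<and> atoms_stored s \<and>
    length (narr s Rarr) = 2 * N + 1 \<and> length (rarr s Sarr) = 2 * N + 1 \<and> length (rarr s Qarr) = 2 * N + 1 \<and>
    length (narr s Parr) = 2 * N + 1 \<and> length (narr s Last) = 4 * N + 1 \<and>
    (\<forall>i<t. int (narr s Rarr ! i) = Rtab i + 2 * N \<and> rarr s Sarr ! i = Stab i) \<and>
    is_Qtab w (\<lambda>i. rarr s Qarr ! i) (t - 1) \<and> (\<forall>r\<le>4 * N. last_visit t r (narr s Last ! r))"

lemma abs_Rtab_le: "\<bar>Rtab t\<bar> \<le> t"
proof (induction t)
  case (Suc t)
  then show ?case using ext_\<sigma>_cases[of "Suc t"] by (auto simp: Rtab_Suc)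
qed (simp add: RS_0)

text \<open>The last earlier visit to a level is unique, so the index found through
  \<open>Last\<close> is the one for which the recursion prescribes the value.\<close>

lemma is_Qtab_Suc:
  assumes "is_Qtab w Q t" "\<And>i. i \<le> t \<Longrightarrow> Q' i = Q i"
    and "l = 0 \<Longrightarrow> Q' (Suc t) = 0" "l \<noteq> 0 \<Longrightarrow> Q' (Suc t) = Q (l - 1) + w * \<bar>Stab (Suc t) - Stab (l - 1)\<bar>"
    and "last_visit (Suc t) r l" "int r = Rtab (Suc t) + 2 * N"
  shows "is_Qtab w Q' (Suc t)"
  unfolding is_Qtab_def
proof (intro allI impI)
  fix t' assume t': "t' \<le> Suc t"
  show "((\<forall>s<t'. Rtab s \<noteq> Rtab t') \<longrightarrow> Q' t' = 0) \<and>
    (\<forall>p<t'. Rtab p = Rtab t' \<longrightarrow> (\<forall>s. p < s \<longrightarrow> s < t' \<longrightarrow> Rtab s \<noteq> Rtab t') \<longrightarrow> Q' t' = Q' p + w * \<bar>Stab t' - Stab p\<bar>)"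
  proof (cases "t' = Suc t")
    case False
    then have "t' \<le> t" using t' by simp
    then show ?thesis using assms(1,2) unfolding is_Qtab_def by simp
  next
    case True
    show ?thesis
    proof (cases "l = 0")
      case l: True
      then have "\<forall>s<Suc t. Rtab s \<noteq> Rtab (Suc t)" using assms(5,6) by (auto simp: last_visit_def)
      then show ?thesis using assms(3)[OF l] True by auto
    next
      case l: False
      then have lv: "l - 1 < Suc t" "Rtab (l - 1) = Rtab (Suc t)" "\<And>s. s < Suc t \<Longrightarrow> l - 1 < s \<Longrightarrow> Rtab s \<noteq> Rtab (Suc t)"
        using assms(5,6) by (auto simp: last_visit_def)
      have none: "\<not> (\<forall>s<Suc t. Rtab s \<noteq> Rtab (Suc t))" using lv(1,2) by blast
      have "Q' (Suc t) = Q' p + w * \<bar>Stab (Suc t) - Stab p\<bar>"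
        if "p < Suc t" "Rtab p = Rtab (Suc t)" "\<forall>s. p < s \<longrightarrow> s < Suc t \<longrightarrow> Rtab s \<noteq> Rtab (Suc t)" for p
      proof -
        have "p = l - 1" using that lv by (metis linorder_neqE_nat)
        then show ?thesis using assms(2)[of p] assms(4)[OF l] that(1) by simp
      qed
      then show ?thesis unfolding True using none by blast
    qed
  qed
qed

lemma last_visit_Suc:
  assumes "last_visit t r' l" "int r = Rtab t + 2 * N"
  shows "last_visit (Suc t) r' (if r' = r then t + 1 else l)"
  using assms by (auto simp: last_visit_def less_Suc_eq split: if_splits)

lemma compute_tables_step:
  assumes T: "tables_upto t s" and t: "1 \<le> t" "t < 2 * N + 1"
  shows "wp (do {
       t' \<leftarrow> calc 1 (t - 1);
       r \<leftarrow> nget Rarr t';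
       s \<leftarrow> rget Sarr t';
       z \<leftarrow> rget Zarr t;
       b \<leftarrow> nget Kind t;
       (r, s) \<leftarrow> calc 3 (if b = 1 then (r + 1, s + z) else (r - 1, s - z));
       nput Rarr t r;
       rput Sarr t s;
       p \<leftarrow> nget Last r;
       nput Parr t p;
       none \<leftarrow> calc 1 (p = 0);
       (if none then rput Qarr t 0
       else do {
         p' \<leftarrow> calc 1 (p - 1);
         sp \<leftarrow> rget Sarr p';
         qp \<leftarrow> rget Qarr p';
         q \<leftarrow> calc 4 (qp + w * \<bar>s - sp\<bar>);
         rput Qarr t q
       });
       t1 \<leftarrow> calc 1 (t + 1);
       nput Last r t1
     }) (\<lambda>_ s'. tables_upto (t + 1) s' \<and> time s' \<le> time s + 40) (s\<lparr>time := time s + 2\<rparr>)"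
proof -
  define t0 where "t0 = t - 1"
  have t0: "t = Suc t0" using t by (simp add: t0_def)
  obtain ra na h tp tm pk k where s: "s = ram_of ra na h tp tm pk k"
    by (cases s)
  note T = T[unfolded tables_upto_def small_def atoms_stored_def s ram.simps]
  define r where "r = nat (Rtab t + 2 * N)"
  define st where "st = Stab t"
  have r: "int r = Rtab t + 2 * N" "r \<le> 4 * N" using abs_Rtab_le[of t] t by (auto simp: r_def)
  have old: "int (na Rarr ! t0) = Rtab t0 + 2 * N" "ra Sarr ! t0 = Stab t0" using T t0 by auto
  have kind: "na Kind ! t = of_bool (ext_\<sigma> t = 1)" "ra Zarr ! t = ext_z t"
    using T t by auto
  \<comment> \<open>The stored value is \<open>Rtab\<close> raised by \<open>2 * N\<close>. As the
    walk stays above \<open>- 2 * N\<close>, or reaches it at the earliest at the last index, the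
    natural subtraction \<open>r - 1\<close> is exact.\<close>
  have new: "(if na Kind ! t = 1 then (na Rarr ! t0 + 1, ra Sarr ! t0 + ra Zarr ! t)
      else (na Rarr ! t0 - 1, ra Sarr ! t0 - ra Zarr ! t)) = (r, st)"
  proof -
    have "Rtab t = Rtab t0 + ext_\<sigma> t" "Stab t = Stab t0 + ext_\<sigma> t * ext_z t" by (simp_all add: t0 Rtab_Suc Stab_Suc)
    then show ?thesis
      using ext_\<sigma>_cases[of t] old r(1) unfolding kind st_def by (elim disjE) (simp_all; linarith)+
  qed
  define l where "l = na Last ! r"
  have lv: "last_visit t r l" using T r by (simp add: l_def)
  \<comment> \<open>If there is no earlier visit, \<open>l - 1\<close> is 0 and the bound still
    holds, so the index check can be settled before the branch.\<close>
  have l: "l - 1 < t" using lv t by (auto simp: last_visit_def split: if_splits)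
  have bounds: "t < 2 * N + 1" "t0 < 2 * N + 1" "r < 4 * N + 1" "l - 1 < 2 * N + 1" using t t0 r l by auto
  have last: "\<forall>r'\<le>4 * N. last_visit (t + 1) r' ((na Last)[r := t + 1] ! r')"
  proof (intro allI impI)
    fix r' assume "r' \<le> 4 * N"
    then have "(na Last)[r := t + 1] ! r' = (if r' = r then t + 1 else na Last ! r')" "last_visit t r' (na Last ! r')"
      using T by (auto simp: nth_list_update)
    then show "last_visit (t + 1) r' ((na Last)[r := t + 1] ! r')" using last_visit_Suc r(1) by auto
  qed
  have RS: "int ((na Rarr)[t := r] ! i) = Rtab i + 2 * N" "(ra Sarr)[t := st] ! i = Stab i" if "i < t + 1" for i
    using that T r bounds by (auto simp: nth_list_update st_def less_Suc_eq)
  have Q: "is_Qtab w (\<lambda>i. ra Qarr ! i) t0" using T t0 by simp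
  have Sl: "(ra Sarr)[t := st] ! (l - 1) = Stab (l - 1)" using RS[of "l - 1"] l by simp
  have Q1: "is_Qtab w (\<lambda>i. (ra Qarr)[t := q] ! i) t"
    if "q = (if l = 0 then 0 else ra Qarr ! (l - 1) + w * \<bar>st - Stab (l - 1)\<bar>)" for q
    unfolding t0 by (rule is_Qtab_Suc[OF Q, where l = l and r = r])
      (use that bounds T lv r in \<open>auto simp: t0 st_def nth_list_update\<close>)
  \<comment> \<open>The two branches differ only in the value \<open>q\<close> written to
    \<open>Qarr\<close>. A round takes at most 25 units including the loop counter, so 40 leaves
    slack.\<close>
  have fin: "ra' Zarr = ra Zarr \<and> na' Kind = na Kind \<and> na' Rarr = (na Rarr)[t := r] \<and> ra' Sarr = (ra Sarr)[t := st] \<and>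
      ra' Qarr = (ra Qarr)[t := q] \<and> na' Last = (na Last)[r := t + 1] \<and> length (na' Parr) = 2 * N + 1 \<and>
      (\<forall>a. length (ra' a) = length (ra a)) \<and> (\<forall>a. length (na' a) = length (na a)) \<Longrightarrow>
      q = (if l = 0 then 0 else ra Qarr ! (l - 1) + w * \<bar>st - Stab (l - 1)\<bar>) \<Longrightarrow> tm' \<le> tm + 40 \<Longrightarrow>
      tables_upto (t + 1) (ram_of ra' na' h tp tm' pk True) \<and> tm' \<le> tm + 40"
    for ra' na' q tm'
    unfolding tables_upto_def small_def atoms_stored_def
    using T last RS Q1[of q] by simp
  have len: "length (na Rarr) = 2 * N + 1" "length (ra Sarr) = 2 * N + 1" "length (ra Zarr) = 2 * N + 1"
    "length (na Kind) = 2 * N + 1" "length (na Parr) = 2 * N + 1" "length (na Last) = 4 * N + 1" "length (ra Qarr) = 2 * N + 1" "k"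
    using T by auto
  show ?thesis
    unfolding s
    by (simp only: wp_simps ram.simps t0_def[symmetric] new fun_upd_apply nname.distinct rname.distinct
        simp_thms if_True if_False l_def[symmetric] Sl length_list_update len bounds)
      (rule if_bool_eq_conj[THEN iffD2], rule conjI; rule impI; rule fin; simp add: len)
qed

lemma compute_tables_correct:
  assumes s: "ok s" "small N s" "heap s = []" "atoms_stored s"
    and Q: "\<And>s'. tables_upto (2 * N + 1) s' \<Longrightarrow> time s' \<le> time s + 100 * N + 100 \<Longrightarrow> Q () s'"
  shows "wp (compute_tables N w) Q s"
proof -
  \<comment> \<open>The summand \<open>12 * N\<close> pays for clearing the five tables, four of
    length \<open>2 * N + 1\<close> and one of length \<open>4 * N + 1\<close>.\<close>
  define J where "J t s' \<longleftrightarrow> tables_upto t s' \<and> time s' \<le> time s + 12 * N + 50 + 40 * t" for t s'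
  have RS: "Rtab 0 = 0" "Stab 0 = 0" by (fact RS_0)+
  have Q0: "is_Qtab w (\<lambda>i. q ! i) 0" if "q ! 0 = 0" for q using that by (simp add: is_Qtab_def)
  define la where "la = (replicate (4 * N + 1) 0)[2 * N := 1 :: nat]"
  have lla: "length la = 4 * N + 1" by (simp only: la_def length_list_update length_replicate)
  have lv: "\<forall>r\<le>4 * N. last_visit (Suc 0) r (la ! r)"
  proof (intro allI impI)
    fix r assume "r \<le> 4 * N"
    then have "la ! r = (if r = 2 * N then 1 else 0 :: nat)" unfolding la_def
      by (simp only: nth_list_update nth_replicate length_replicate) (auto simp: nth_list_update)
    then show "last_visit (Suc 0) r (la ! r)" by (auto simp: last_visit_def RS)
  qed
  obtain ra na h tp tm pk k where sd: "s = ram_of ra na h tp tm pk k"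
    by (cases s)
  note s = s[unfolded sd small_def atoms_stored_def ram.simps]
  have len: "length (ra a) \<le> 2 * N + 1" "length (na b) \<le> 4 * N + 1" for a b using s by auto
  have hk: "h = []" "k" "pk \<le> 60 * N + 60" using s by auto
  have c: "cells_used ra' na' [] \<le> 60 * N + 60"
    if "\<And>a. length (ra' a) \<le> 2 * N + 1" "\<And>b. length (na' b) \<le> 4 * N + 1" for ra' na'
    using that by (intro cells_used_le) auto
  have J1: "J 1 (ram_of ra' na' [] tp tm' pk' True)"
    if "ra' Zarr = ra Zarr" "na' Kind = na Kind" "ra' Sarr ! 0 = 0" "na' Rarr ! 0 = 2 * N" "ra' Qarr ! 0 = 0" "na' Last = la"
      "length (na' Rarr) = 2 * N + 1" "length (ra' Sarr) = 2 * N + 1" "length (ra' Qarr) = 2 * N + 1" "length (na' Parr) = 2 * N + 1"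
      "\<And>a. length (ra' a) \<le> 2 * N + 1" "\<And>b. length (na' b) \<le> 4 * N + 1" "pk' \<le> 60 * N + 60" "tm' \<le> tm + 12 * N + 90"
    for ra' na' tm' pk'
    unfolding J_def tables_upto_def small_def atoms_stored_def sd ram.simps
    using that s lv lla Q0[of "ra' Qarr"] RS by simp
  have bnd: "0 < 2 * N + 1" "2 * N < 4 * N + 1" by auto
  show ?thesis
    unfolding compute_tables_def sd hk(1)
    apply (simp only: wp_simps fun_upd_apply nname.distinct rname.distinct simp_thms if_True if_False la_def[symmetric]
      length_replicate length_list_update hk)
    apply (rule wp_foreach[where J = J])
       apply simp
    subgoal
      apply (simp only: bnd simp_thms)
      apply (rule J1)
      using len hk lla by (simp_all add: c del: replicate_Suc)
    subgoal for t s'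
      unfolding J_def
      by (rule wp_mono[OF compute_tables_step[of t s']]) simp_all
    subgoal for s' using Q[of "s'\<lparr>time := time s' + 1\<rparr>"]
      by (simp add: J_def tables_upto_def small_def atoms_stored_def sd)
    done
qed

end

section \<open>List, heap and activation\<close>

text \<open>Turns an array update into a function update, so that results such as
  \<open>greedy_step\<close> apply to memory contents directly.\<close>

lemma nth_fun_update: "u < length l \<Longrightarrow> (!) (l[u := x]) = ((!) l)(u := x)"
  by (auto simp: fun_eq_iff)

lemmas wp_exec = wp_simps fun_upd_apply nname.distinct rname.distinct simp_thms if_True if_False length_list_update

context weighted_circle
begin

definition static :: "(rname \<Rightarrow> real list) \<Rightarrow> (nname \<Rightarrow> nat list) \<Rightarrow> bool" where
  "static ra na \<longleftrightarrow> length (na Kind) = 2 * N + 1 \<and> (\<forall>i\<in>{1..N}. na Kind ! i = of_bool (\<sigma> i = 1)) \<and>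
    length (ra Qarr) = 2 * N + 1 \<and> is_Qtab w ((!) (ra Qarr)) (2 * N)"

lemma wp_key:
  assumes "length (ra Qarr) = 2 * N + 1" "u \<in> {1..N}" "v \<in> {1..N}"
  shows "wp (key N u v) R (ram_of ra na h tp tm pk k) =
    R (cell_key ((!) (ra Qarr)) u v) (ram_of ra na h tp (tm + 11) pk k)"
proof -
  have b: "u < 2 * N + 1" "u - 1 < 2 * N + 1" "v < 2 * N + 1" "v - 1 < 2 * N + 1" "v + N < 2 * N + 1" "v + N - 1 < 2 * N + 1"
    using assms by auto
  have t: "tm + 2 + 1 + 1 + 1 + 1 + 1 + 1 + 3 = tm + 11" by simp
  show ?thesis
  proof (cases "u < v")
    case True
    then show ?thesis unfolding key_def by (simp only: wp_exec assms(1) b cell_key_def Let_def t)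
  next
    case False
    then show ?thesis unfolding key_def by (simp only: wp_exec assms(1) b cell_key_def Let_def t)
  qed
qed

lemma wp_insert_cell:
  assumes "static ra na" "u \<in> {1..N}" "v \<in> {1..N}"
  shows "wp (insert_cell N u v) R (ram_of ra na h tp tm pk k) =
    (if \<sigma> u \<noteq> \<sigma> v then
       R () (ram_of ra na ((cell_key ((!) (ra Qarr)) u v, u, v) # h) tp (tm + 15 + floor_log (1 + length h)) (max pk (cells_used ra na ((cell_key ((!) (ra Qarr)) u v, u, v) # h))) k)
     else R () (ram_of ra na h tp (tm + 3) pk k))"
proof -
  have l: "length (na Kind) = 2 * N + 1" "length (ra Qarr) = 2 * N + 1" "u < 2 * N + 1" "v < 2 * N + 1"
    using assms by (auto simp: static_def)
  have k: "(na Kind ! u \<noteq> na Kind ! v) = (\<sigma> u \<noteq> \<sigma> v)"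
    using assms \<sigma>_cases[of u] \<sigma>_cases[of v] by (auto simp: static_def)
  have t: "tm + 1 + 1 + 1 = tm + 3" "tm + 3 + 11 + 1 + x = tm + 15 + x" for x by simp_all
  show ?thesis unfolding insert_cell_def
    by (simp only: wp_exec l k wp_key[where ra = ra and u = u and v = v, OF l(2) assms(2,3)] t)
qed

definition links_stored :: "nat \<Rightarrow> (rname \<Rightarrow> real list) \<Rightarrow> (nname \<Rightarrow> nat list) \<Rightarrow> bool" where
  "links_stored K ra na \<longleftrightarrow> length (na Next) = N + 1 \<and> length (na Prev) = N + 1 \<and> length (na Rep) = N + 1 \<and>
    length (na Rank) = N + 1 \<and> length (na Theta) = 1 \<and> length (ra Carr) = K + 1"

text \<open>Stale entries may stay in the heap. A key is determined by the two ends alone, so an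
  entry that passes the validity test carries the right key no matter when it was inserted.\<close>

definition heap_ok :: "(rname \<Rightarrow> real list) \<Rightarrow> (nname \<Rightarrow> nat list) \<Rightarrow> (real \<times> nat \<times> nat) list \<Rightarrow> bool" where
  "heap_ok ra na h \<longleftrightarrow>
    (\<forall>(\<kappa>, u, v)\<in>set h. \<kappa> = cell_key ((!) (ra Qarr)) u v \<and> u \<in> {1..N} \<and> v \<in> {1..N}) \<and>
    (\<forall>u\<in>inactive ((!) (na Rank)). \<sigma> u \<noteq> \<sigma> (na Next ! u) \<longrightarrow>
      (cell_key ((!) (ra Qarr)) u (na Next ! u), u, na Next ! u) \<in> set h)"

text \<open>The flows and the dual value are never computed; they exist only as witnesses.
  \<open>Theta\<close> is 0 exactly as long as some atom is inactive.\<close>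

definition progress :: "nat \<Rightarrow> (rname \<Rightarrow> real list) \<Rightarrow> (nname \<Rightarrow> nat list) \<Rightarrow> bool" where
  "progress k ra na \<longleftrightarrow> (\<exists>Fs \<mu>.
    greedy_state k ((!) (na Rank)) ((!) (na Next)) ((!) (na Prev)) ((!) (na Rep)) Fs \<mu> \<and>
    (\<forall>j\<le>k. ra Carr ! j = w * flow_cost (Fs j)) \<and>
    (inactive ((!) (na Rank)) \<noteq> {} \<longrightarrow> na Theta ! 0 = 0) \<and>
    (inactive ((!) (na Rank)) = {} \<longrightarrow> na Theta ! 0 \<in> {1..N} \<and> (\<forall>j\<le>k. Fs j (na Theta ! 0) = 0)))"

text \<open>Every heap entry carries the cost of the iteration of \<^const>\<open>pop_valid\<close> that will discard it.\<close>

definition pop_time :: nat where "pop_time = 14 + H"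

text \<open>The budget of one activation consists of 60 for operations of constant cost,
  \<open>H\<close> for one push, and \<open>pop_time\<close> as the credit deposited on the pushed
  entry.\<close>

definition main_inv :: "nat \<Rightarrow> nat \<Rightarrow> nat \<Rightarrow> ram \<Rightarrow> bool" where
  "main_inv K T k s \<longleftrightarrow> ok s \<and> small N s \<and> static (rarr s) (narr s) \<and> links_stored K (rarr s) (narr s) \<and>
    heap_ok (rarr s) (narr s) (heap s) \<and> length (heap s) \<le> N + k \<and>
    time s + pop_time * length (heap s) \<le> T + k * (60 + H + pop_time) \<and> progress k (rarr s) (narr s)"

lemma init_list_correct:
  assumes s: "tables_upto (2 * N + 1) s" and K: "K \<le> N"
    and Q: "\<And>s'. main_inv K (time s + 100 * N + 100 + N * (2 * H + 40)) 0 s' \<Longrightarrow> Q () s'"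
  shows "wp (init_list N K) Q s"
proof -
  define nxt where "nxt i = (if i = N then 1 else i + 1)" for i
  obtain ra na h tp tm pk k where sd: "s = ram_of ra na h tp tm pk k"
    by (cases s)
  note s = s[unfolded tables_upto_def sd small_def atoms_stored_def ram.simps]
  have h: "h = []" and k: "k" using s by auto
  have ext: "ext_\<sigma> i = \<sigma> i" if "i \<in> {1..N}" for i using that by (simp add: ext_\<sigma>_def)
  have len: "length (ra a) \<le> 2 * N + 1" "length (na b) \<le> 4 * N + 1" "pk \<le> 60 * N + 60" for a b using s by auto
  have st: "static ra na" using s N_pos by (auto simp: static_def ext)
  have stc: "static ra' na'" if "ra' Qarr = ra Qarr" "na' Kind = na Kind" for ra' na'
    using st that by (simp add: static_def)
  have c: "cells_used ra' na' h \<le> 60 * N + 60"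
    if "\<And>a. length (ra' a) \<le> 2 * N + 1" "\<And>b. length (na' b) \<le> 4 * N + 1" "length h \<le> 2 * N" for ra' na' h
    using that by (intro cells_used_le) auto
  \<comment> \<open>Round \<open>i\<close> writes \<open>Prev\<close> at the successor of
    \<open>i\<close>, so the back links are described at \<open>nxt i\<close>; since
    \<open>nxt\<close> is injective, later rounds do not overwrite them.\<close>
  define J where "J t s' \<longleftrightarrow> (\<exists>na' tm' pk'. s' = ram_of (ra(Carr := (replicate (K + 1) 0))) na' [] tp tm' pk' True \<and> pk' \<le> 60 * N + 60 \<and> tm' \<le> tm + 20 + 7 * N + 7 * t \<and>
      na' Kind = na Kind \<and> (\<forall>b. length (na' b) \<le> 4 * N + 1) \<and> links_stored K (ra(Carr := replicate (K + 1) 0)) na' \<and>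
      na' Rank = replicate (N + 1) 0 \<and> na' Theta = [0] \<and>
      (\<forall>i\<in>{1..<t}. na' Next ! i = nxt i \<and> na' Prev ! (nxt i) = i \<and> na' Rep ! i = i))" for t s'
  have lra: "length ((ra(Carr := replicate (K + 1) 0)) a) \<le> 2 * N + 1" for a using s K by simp
  have J1: "J 1 (ram_of (ra(Carr := (replicate (K + 1) 0)[0 := 0])) (na(Next := replicate (N + 1) 0, Prev := replicate (N + 1) 0, Rep := replicate (N + 1) 0, Rank := replicate (N + 1) 0, Theta := replicate 1 0)) [] tp tm' pk' True)" if "tm' \<le> tm + 20 + 7 * N" "pk' \<le> 60 * N + 60" for tm' pk'
  proof -
    have u: "(replicate (K + 1) 0)[0 := 0 :: real] = replicate (K + 1) 0" by simp
    show ?thesis unfolding J_def u using that s by (auto simp: links_stored_def)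
  qed
  have Jstep: "wp (do {
       j \<leftarrow> calc 2 (if i = N then 1 else i + 1);
       nput Next i j;
       nput Prev j i;
       nput Rep i i
     }) (\<lambda>_ s'. J (i + 1) s') (s'\<lparr>time := time s' + 2\<rparr>)" if i: "1 \<le> i" "i < N + 1" and J: "J i s'" for i s'
  proof -
    obtain na' tm' pk' where s': "s' = ram_of (ra(Carr := (replicate (K + 1) 0))) na' [] tp tm' pk' True" and
      J: "pk' \<le> 60 * N + 60" "tm' \<le> tm + 20 + 7 * N + 7 * i" "na' Kind = na Kind"
      "\<forall>b. length (na' b) \<le> 4 * N + 1" "links_stored K (ra(Carr := replicate (K + 1) 0)) na'"
      "na' Rank = replicate (N + 1) 0" "na' Theta = [0]"
      "\<forall>i\<in>{1..<i}. na' Next ! i = nxt i \<and> na' Prev ! (nxt i) = i \<and> na' Rep ! i = i"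
      using J unfolding J_def by (elim exE conjE) (rule that, assumption+)
    have l: "length (na' Next) = N + 1" "length (na' Prev) = N + 1" "length (na' Rep) = N + 1" "i < N + 1" "nxt i < N + 1"
      using J i N_ge_2 by (auto simp: links_stored_def nxt_def)
    have "(na' Next)[i := nxt i] ! j = nxt j \<and> (na' Prev)[nxt i := i] ! nxt j = j \<and> (na' Rep)[i := i] ! j = j"
      if "j \<in> {1..<i + 1}" for j
    proof (cases "j = i")
      case False
      then have "j \<in> {1..<i}" "nxt j \<noteq> nxt i" using that i by (auto simp: nxt_def)
      then show ?thesis using J(8) False by simp
    qed (use l in auto)
    then show ?thesis
      unfolding s'
      apply (simp only: ram.simps wp_exec l nxt_def[symmetric])
      unfolding J_def
      using J by (intro exI conjI) (rule refl, auto simp: links_stored_def)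
  qed
  define J' where "J' t s' \<longleftrightarrow> (\<exists>ra' na' h' tm' pk'. s' = ram_of ra' na' h' tp tm' pk' True \<and> pk' \<le> 60 * N + 60 \<and> tm' \<le> tm + 30 + 14 * N + (t - 1) * (20 + H) \<and>
      (\<forall>a. length (ra' a) \<le> 2 * N + 1) \<and> (\<forall>b. length (na' b) \<le> 4 * N + 1) \<and> ra' Qarr = ra Qarr \<and> na' Kind = na Kind \<and>
      links_stored K ra' na' \<and> ra' Carr ! 0 = 0 \<and>
      na' Rank = replicate (N + 1) 0 \<and> na' Theta = [0] \<and>
      (\<forall>i\<in>{1..N}. na' Next ! i = nxt i \<and> na' Prev ! (nxt i) = i \<and> na' Rep ! i = i) \<and>
      length h' \<le> t - 1 \<and> set h' = {(cell_key ((!) (ra Qarr)) i (nxt i), i, nxt i) | i. i \<in> {1..<t} \<and> \<sigma> i \<noteq> \<sigma> (nxt i)})" for t s'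
  have J1': "J' 1 (s'\<lparr>time := time s' + 1\<rparr>)" if Js: "J (N + 1) s'" for s'
  proof -
    obtain na' tm' pk' where s': "s' = ram_of (ra(Carr := (replicate (K + 1) 0))) na' [] tp tm' pk' True" and
      J: "pk' \<le> 60 * N + 60" "tm' \<le> tm + 20 + 7 * N + 7 * (N + 1)" "na' Kind = na Kind"
      "\<forall>b. length (na' b) \<le> 4 * N + 1" "links_stored K (ra(Carr := replicate (K + 1) 0)) na'"
      "na' Rank = replicate (N + 1) 0" "na' Theta = [0]"
      "\<forall>i\<in>{1..<N + 1}. na' Next ! i = nxt i \<and> na' Prev ! (nxt i) = i \<and> na' Rep ! i = i"
      using Js unfolding J_def by (elim exE conjE) (rule that, assumption+)
    show ?thesis unfolding s' ram.simps J'_def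
      using J lra by (intro exI conjI) (rule refl, auto)
  qed
  have Jstep': "wp (do { j \<leftarrow> nget Next i; insert_cell N i j }) (\<lambda>_ s'. J' (i + 1) s') (s'\<lparr>time := time s' + 2\<rparr>)"
    if i: "1 \<le> i" "i < N + 1" and J: "J' i s'" for i s'
  proof -
    obtain ra' na' h' tm' pk' where s': "s' = ram_of ra' na' h' tp tm' pk' True" and
      J: "pk' \<le> 60 * N + 60" "tm' \<le> tm + 30 + 14 * N + (i - 1) * (20 + H)"
      "\<forall>a. length (ra' a) \<le> 2 * N + 1" "\<forall>b. length (na' b) \<le> 4 * N + 1" "ra' Qarr = ra Qarr" "na' Kind = na Kind"
      "links_stored K ra' na'" "ra' Carr ! 0 = 0"
      "na' Rank = replicate (N + 1) 0" "na' Theta = [0]"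
      "\<forall>i\<in>{1..N}. na' Next ! i = nxt i \<and> na' Prev ! (nxt i) = i \<and> na' Rep ! i = i"
      "length h' \<le> i - 1" "set h' = {(cell_key ((!) (ra Qarr)) j (nxt j), j, nxt j) | j. j \<in> {1..<i} \<and> \<sigma> j \<noteq> \<sigma> (nxt j)}"
      using J unfolding J'_def by (elim exE conjE) (rule that, assumption+)
    have l: "length (na' Next) = N + 1" "i < N + 1" "na' Next ! i = nxt i" "i \<in> {1..N}" "nxt i \<in> {1..N}"
      using J i N_ge_2 by (auto simp: links_stored_def nxt_def)
    have sp: "{1..<i + 1} = insert i {1..<i}" using i by auto
    have fl: "floor_log (1 + length h') + 1 \<le> H" using J(12) i by (intro heap_cost) auto
    have tl: "(i + 1 - 1) * (20 + H) = (i - 1) * (20 + H) + (20 + H)" using i by (cases i) auto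
    have "J' (i + 1) (ram_of ra' na' h' tp (tm' + 2 + 1 + 3) pk' True)"
      if "\<not> \<sigma> i \<noteq> \<sigma> (nxt i)"
      unfolding J'_def
      by (intro exI conjI, rule refl; (fact J)?) (use J i tl sp that in auto)
    moreover have "J' (i + 1) (ram_of ra' na' ((cell_key ((!) (ra Qarr)) i (nxt i), i, nxt i) # h') tp (tm' + 2 + 1 + 15 + floor_log (1 + length h')) (max pk' (cells_used ra' na' ((cell_key ((!) (ra Qarr)) i (nxt i), i, nxt i) # h'))) True)"
      if "\<sigma> i \<noteq> \<sigma> (nxt i)"
      unfolding J'_def
      by (intro exI conjI, rule refl; (fact J)?) (use J i tl fl sp that in \<open>auto intro!: c\<close>)
    moreover have stc': "static ra' na'" by (rule stc) (fact J)+
    ultimately show ?thesis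
      unfolding s'
      by (simp only: ram.simps wp_exec l wp_insert_cell[where ra = ra' and na = na' and u = i and v = "nxt i", OF stc' l(4,5)] J(5) split: if_split) blast
  qed
  have fin: "main_inv K (tm + 100 * N + 100 + N * (2 * H + 40)) 0 (s'\<lparr>time := time s' + 1\<rparr>)" if Js: "J' (N + 1) s'" for s'
  proof -
    obtain ra' na' h' tm' pk' where s': "s' = ram_of ra' na' h' tp tm' pk' True" and
      J: "pk' \<le> 60 * N + 60" "tm' \<le> tm + 30 + 14 * N + (N + 1 - 1) * (20 + H)"
      "\<forall>a. length (ra' a) \<le> 2 * N + 1" "\<forall>b. length (na' b) \<le> 4 * N + 1" "ra' Qarr = ra Qarr" "na' Kind = na Kind"
      "links_stored K ra' na'" "ra' Carr ! 0 = 0"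
      "na' Rank = replicate (N + 1) 0" "na' Theta = [0]"
      "\<forall>i\<in>{1..N}. na' Next ! i = nxt i \<and> na' Prev ! (nxt i) = i \<and> na' Rep ! i = i"
      "length h' \<le> N + 1 - 1" "set h' = {(cell_key ((!) (ra Qarr)) j (nxt j), j, nxt j) | j. j \<in> {1..<N + 1} \<and> \<sigma> j \<noteq> \<sigma> (nxt j)}"
      using Js unfolding J'_def by (elim exE conjE) (rule that, assumption+)
    have rk: "na' Rank ! i = 0" if "i \<in> {1..N}" for i unfolding J(9) using that by (intro nth_replicate) simp
    have I: "inactive ((!) (na' Rank)) = {1..N}" using rk by (auto simp: inactive_def)
    have pv: "na' Prev ! i = (if i = 1 then N else i - 1)" if "i \<in> {1..N}" for i
    proof -
      define j where "j = (if i = 1 then N else i - 1)"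
      have "j \<in> {1..N}" "nxt j = i" using that N_ge_2 by (auto simp: j_def nxt_def)
      then have "na' Prev ! i = j" using J(11) by metis
      then show ?thesis by (simp only: j_def)
    qed
    have G: "greedy_state 0 ((!) (na' Rank)) ((!) (na' Next)) ((!) (na' Prev)) ((!) (na' Rep)) (\<lambda>_ _. 0) 0"
      by (rule greedy_init) (use rk J(11) pv in \<open>auto simp: nxt_def\<close>)
    have P: "progress 0 ra' na'"
      unfolding progress_def
      by (rule exI[of _ "\<lambda>_ _. 0"], rule exI[of _ 0]) (use G J(8,10) I N_pos in \<open>auto simp: flow_cost_def\<close>)
    have hp: "heap_ok ra' na' h'"
      unfolding heap_ok_def I J(13) using J(5,11) N_ge_2 by (auto simp: nxt_def)
    \<comment> \<open>The credits of the initial entries account for \<open>N * (14 + H)\<close> of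
      the starting budget, and their insertion for \<open>N * (20 + H)\<close>.\<close>
    have "pop_time * length h' \<le> pop_time * N" using J(12) by simp
    then show ?thesis unfolding s' main_inv_def ram.simps small_def
      using J P hp stc[of ra' na'] by (auto simp: pop_time_def algebra_simps)
  qed
  have u: "length (replicate (K + 1) (0::real)) = K + 1" "0 < K + 1" by auto
  show ?thesis
    unfolding init_list_def sd h
    apply (simp only: wp_exec u)
    apply (rule wp_foreach[where J = J])
       apply simp
    subgoal
      using len K k apply (simp only: simp_thms fun_upd_upd)
      by (rule J1) (simp_all add: c del: replicate_Suc)
    subgoal for t s' by (rule Jstep)
    subgoal for s'
      apply (rule wp_foreach[where J = J'])
         apply simp
        apply (erule J1')
      subgoal for t s' by (rule Jstep')
      subgoal for s' by (rule Q) (use fin[of s'] in \<open>simp add: sd\<close>)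
      done
    done
qed

section \<open>Extraction of a valid heap entry and the effect of one activation\<close>

definition valid_entry :: "(nname \<Rightarrow> nat list) \<Rightarrow> real \<times> nat \<times> nat \<Rightarrow> bool" where
  "valid_entry na e \<longleftrightarrow> (case e of (\<kappa>, u, v) \<Rightarrow>
    na Rank ! u = 0 \<and> na Rank ! v = 0 \<and> v = na Next ! u \<and> na Kind ! u \<noteq> na Kind ! v)"

text \<open>Only invalid entries are discarded, so all valid ones stay in the heap until one of them
  is popped, and that one is minimal among them all. The existence of a valid entry keeps the heap
  nonempty until then.\<close>

lemma wp_pop_valid:
  assumes len: "length (na Rank) = N + 1" "length (na Next) = N + 1" "length (na Kind) = 2 * N + 1"
    and entries: "\<And>\<kappa> u v. (\<kappa>, u, v) \<in> set h \<Longrightarrow> u \<in> {1..N} \<and> v \<in> {1..N}"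
    and ex: "\<exists>e\<in>set h. valid_entry na e" and lh: "length h \<le> 2 * N"
    and R: "\<And>\<kappa> u v h' tp' tm'. (\<kappa>, u, v) \<in> set h \<Longrightarrow> valid_entry na (\<kappa>, u, v) \<Longrightarrow>
      (\<And>e. e \<in> set h \<Longrightarrow> valid_entry na e \<Longrightarrow> \<kappa> \<le> fst e) \<Longrightarrow> set h' \<subseteq> set h \<Longrightarrow>
      (\<And>e. e \<in> set h \<Longrightarrow> valid_entry na e \<Longrightarrow> e \<noteq> (\<kappa>, u, v) \<Longrightarrow> e \<in> set h') \<Longrightarrow>
      length h' < length h \<Longrightarrow> tm' + pop_time * length h' \<le> tm + pop_time * length h \<Longrightarrow>
      R (\<kappa>, u, v) (ram_of ra na h' tp' tm' pk True)"
  shows "wp pop_valid R (ram_of ra na h tp tm pk True)"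
proof -
  define J where "J s \<longleftrightarrow> (\<exists>h' tp' tm'. s = ram_of ra na h' tp' tm' pk True \<and>
    set h' \<subseteq> set h \<and> (\<forall>e\<in>set h. valid_entry na e \<longrightarrow> e \<in> set h') \<and> length h' \<le> length h \<and>
    tm' + pop_time * length h' \<le> tm + pop_time * length h)" for s
  show ?thesis
    unfolding pop_valid_def
  proof (rule wp_until[where J = J and m = "\<lambda>s. length (heap s)"])
    show "J (ram_of ra na h tp tm pk True)"
      unfolding J_def by blast
    fix s assume Js: "J s"
    then obtain h1 tp1 tm1 where s: "s = ram_of ra na h1 tp1 tm1 pk True"
      and h1: "set h1 \<subseteq> set h" "\<And>e. e \<in> set h \<Longrightarrow> valid_entry na e \<Longrightarrow> e \<in> set h1" "length h1 \<le> length h"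
      "tm1 + pop_time * length h1 \<le> tm + pop_time * length h"
      unfolding J_def by blast
    have ne: "h1 \<noteq> []" using ex h1(2) by force
    have fl: "floor_log (1 + length h1) + 1 \<le> H" using h1(3) lh by (intro heap_cost) simp
    have body: "wp (do {
       ru \<leftarrow> nget Rank u;
       rv \<leftarrow> nget Rank v;
       v' \<leftarrow> nget Next u;
       bu \<leftarrow> nget Kind u;
       bv \<leftarrow> nget Kind v;
       valid \<leftarrow> calc 7 (ru = 0 \<and> rv = 0 \<and> v = v' \<and> bu \<noteq> bv);
       State_Monad.return (if valid then Some (\<kappa>, u, v) else None)
      }) (\<lambda>r s'. case r of None \<Rightarrow> J s' \<and> length (heap s') < length (heap s) | Some x \<Rightarrow> R x s')
      (ram_of ra na (remove1 (\<kappa>, u, v) h1) tp2 (tm1 + 1 + 2 + floor_log (1 + length h1)) pk True)"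
      if e: "(\<kappa>, u, v) \<in> set h1" "\<And>e'. e' \<in> set h1 \<Longrightarrow> fst (\<kappa>, u, v) \<le> fst e'" for \<kappa> u v tp2
    proof -
      have uv: "u \<in> {1..N}" "v \<in> {1..N}" using entries e(1) h1(1) by blast+
      then have b: "u < N + 1" "v < N + 1" "u < 2 * N + 1" "v < 2 * N + 1" by auto
      have lr: "length (remove1 (\<kappa>, u, v) h1) < length h1" "length h1 = length (remove1 (\<kappa>, u, v) h1) + 1"
        using e(1) length_pos_if_in_set[OF e(1)] by (auto simp: length_remove1)
      \<comment> \<open>The 14 in \<open>pop_time\<close> is the loop tick, the tape access, five
        array reads and the test of cost 7. The charge for the heap access is at most
        \<open>H\<close>.\<close>
      have t: "(tm1 + 1 + 2 + floor_log (1 + length h1) + 1 + 1 + 1 + 1 + 1 + 7) + pop_time * length (remove1 (\<kappa>, u, v) h1)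
        \<le> tm + pop_time * length h"
        using h1(4) fl unfolding lr(2) pop_time_def by simp
      have sub: "set (remove1 (\<kappa>, u, v) h1) \<subseteq> set h" using h1(1) set_remove1_subset by fastforce
      have v: "(na Rank ! u = 0 \<and> na Rank ! v = 0 \<and> v = na Next ! u \<and> na Kind ! u \<noteq> na Kind ! v) = valid_entry na (\<kappa>, u, v)"
        by (simp add: valid_entry_def)
      show ?thesis
      proof (cases "valid_entry na (\<kappa>, u, v)")
        case True
        have "R (\<kappa>, u, v) (ram_of ra na (remove1 (\<kappa>, u, v) h1) tp2 (tm1 + 1 + 2 + floor_log (1 + length h1) + 1 + 1 + 1 + 1 + 1 + 7) pk True)"
          by (rule R) (use True e h1 sub t lr in \<open>auto simp: in_set_remove1\<close>)
        then show ?thesis by (simp only: wp_exec len b v True option.case)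
      next
        case False
        have "J (ram_of ra na (remove1 (\<kappa>, u, v) h1) tp2 (tm1 + 1 + 2 + floor_log (1 + length h1) + 1 + 1 + 1 + 1 + 1 + 7) pk True)"
          unfolding J_def
        proof (intro exI conjI, rule refl)
          show "\<forall>e\<in>set h. valid_entry na e \<longrightarrow> e \<in> set (remove1 (\<kappa>, u, v) h1)"
          proof (intro ballI impI)
            fix e assume "e \<in> set h" "valid_entry na e"
            then have "e \<in> set h1" "e \<noteq> (\<kappa>, u, v)" using h1(2) False by auto
            then show "e \<in> set (remove1 (\<kappa>, u, v) h1)" by (simp add: in_set_remove1)
          qed
        qed (use sub t lr h1(3) in auto)
        then show ?thesis using lr(1) by (simp only: wp_exec len b v False option.case s ram.simps)
      qed
    qed
    show "wp (do {
       (\<kappa>, u, v) \<leftarrow> pop;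
       ru \<leftarrow> nget Rank u;
       rv \<leftarrow> nget Rank v;
       v' \<leftarrow> nget Next u;
       bu \<leftarrow> nget Kind u;
       bv \<leftarrow> nget Kind v;
       valid \<leftarrow> calc 7 (ru = 0 \<and> rv = 0 \<and> v = v' \<and> bu \<noteq> bv);
       State_Monad.return (if valid then Some (\<kappa>, u, v) else None)
      }) (\<lambda>r s'. case r of None \<Rightarrow> J s' \<and> length (heap s') < length (heap s) | Some x \<Rightarrow> R x s')
      (s\<lparr>time := time s + 1\<rparr>)"
      unfolding wp_bind[of pop]
      apply (simp only: s ram.simps)
      apply (rule wp_pop[OF ne])
      subgoal for e tp2
        apply (cases e)
        subgoal for \<kappa> u v using body[of \<kappa> u v tp2] by (simp only: prod.case s ram.simps)
        done
      done
  qed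
qed

text \<open>Every opposite cell has an entry, so minimality in the heap is minimality over all
  cells, as \<open>greedy_step\<close> requires. Cells that survive keep their entries; only the
  merged cell from \<open>p\<close> to \<open>q\<close> may need a new one.\<close>

lemma progress_step:
  assumes P: "progress k ra na" and S: "static ra na" and Lk: "links_stored K ra na" and k: "k < K"
    and h: "heap_ok ra na h"
    and e: "(\<kappa>, u, v) \<in> set h" "valid_entry na (\<kappa>, u, v)"
    and min: "\<forall>e\<in>set h. valid_entry na e \<longrightarrow> \<kappa> \<le> fst e"
    and h': "set h' \<subseteq> set h" "\<forall>e\<in>set h. valid_entry na e \<longrightarrow> e \<noteq> (\<kappa>, u, v) \<longrightarrow> e \<in> set h'"
  defines "p \<equiv> na Prev ! u" and "q \<equiv> na Next ! v"
    and "ra' \<equiv> ra(Carr := (ra Carr)[k + 1 := ra Carr ! k + \<kappa>])"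
    and "na1 \<equiv> na(Rank := (na Rank)[u := k + 1, v := k + 1])"
  shows "u \<in> {1..N}" "v \<in> {1..N}"
    "q = u \<Longrightarrow> progress (k + 1) ra' (na1(Theta := (na Theta)[0 := na Rep ! v])) \<and>
       heap_ok ra' (na1(Theta := (na Theta)[0 := na Rep ! v])) h'"
    "q \<noteq> u \<Longrightarrow> p \<in> {1..N} \<and> q \<in> {1..N}"
    "q \<noteq> u \<Longrightarrow> g \<in> {na Rep ! p, na Rep ! v} \<Longrightarrow>
       na2 = na1(Next := (na Next)[p := q], Prev := (na Prev)[q := p], Rep := (na Rep)[p := g]) \<Longrightarrow>
       progress (k + 1) ra' na2 \<and>
       (\<sigma> p = \<sigma> q \<longrightarrow> heap_ok ra' na2 h') \<and>
       (\<sigma> p \<noteq> \<sigma> q \<longrightarrow> heap_ok ra' na2 ((cell_key ((!) (ra Qarr)) p q, p, q) # h'))"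
proof -
  obtain Fs \<mu> where G: "greedy_state k ((!) (na Rank)) ((!) (na Next)) ((!) (na Prev)) ((!) (na Rep)) Fs \<mu>"
    and C: "\<forall>j\<le>k. ra Carr ! j = w * flow_cost (Fs j)"
    and th: "inactive ((!) (na Rank)) \<noteq> {} \<Longrightarrow> na Theta ! 0 = 0"
    using P unfolding progress_def by blast
  let ?I = "inactive ((!) (na Rank))" and ?key = "cell_key ((!) (ra Qarr))"
  have Q: "is_Qtab w ((!) (ra Qarr)) (2 * N)" using S by (simp add: static_def)
  have R: "ring_links ?I ((!) (na Next)) ((!) (na Prev))" using G by (simp add: greedy_state_def)
  have hk: "\<kappa> = ?key u v" and u: "u \<in> {1..N}" and v: "v \<in> {1..N}" using h e(1) by (auto simp: heap_ok_def)
  show "u \<in> {1..N}" "v \<in> {1..N}" by fact+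
  have ve: "na Rank ! u = 0" "na Rank ! v = 0" "v = na Next ! u" "na Kind ! u \<noteq> na Kind ! v"
    using e(2) by (auto simp: valid_entry_def)
  have kind: "(na Kind ! a \<noteq> na Kind ! b) = (\<sigma> a \<noteq> \<sigma> b)" if "a \<in> {1..N}" "b \<in> {1..N}" for a b
    using S that \<sigma>_cases[of a] \<sigma>_cases[of b] by (auto simp: static_def)
  have uI: "u \<in> ?I" and vI: "v \<in> ?I" using u v ve by (auto simp: inactive_def)
  have opp: "\<sigma> u \<noteq> \<sigma> (na Next ! u)" using kind[OF u v] ve by simp
  have uv: "u \<noteq> v" using opp ve(3) by auto
  have valid: "valid_entry na (?key a (na Next ! a), a, na Next ! a)" if "a \<in> ?I" "\<sigma> a \<noteq> \<sigma> (na Next ! a)" for a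
  proof -
    have "na Next ! a \<in> ?I" "a \<in> {1..N}" using ring_linksD[OF R that(1)] by auto
    then show ?thesis using that kind[of a "na Next ! a"] by (auto simp: valid_entry_def inactive_def)
  qed
  have stored: "(?key a (na Next ! a), a, na Next ! a) \<in> set h" if "a \<in> ?I" "\<sigma> a \<noteq> \<sigma> (na Next ! a)" for a
    using h that by (auto simp: heap_ok_def)
  \<comment> \<open>The key without the weight, which is the scale of
    \<open>greedy_step\<close>.\<close>
  define d where "d = shift (Fs k) (cell u (na Next ! u)) (\<sigma> u)"
  have \<kappa>d: "\<kappa> = w * d" using greedy_cell_key[OF G Q uI opp] hk ve(3) by (simp add: d_def)
  have dmin: "\<forall>a\<in>?I. \<sigma> a \<noteq> \<sigma> (na Next ! a) \<longrightarrow> d \<le> shift (Fs k) (cell a (na Next ! a)) (\<sigma> a)"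
  proof (intro ballI impI)
    fix a assume that: "a \<in> ?I" "\<sigma> a \<noteq> \<sigma> (na Next ! a)"
    show "d \<le> shift (Fs k) (cell a (na Next ! a)) (\<sigma> a)"
    using min[rule_format, OF stored[OF that] valid[OF that]] greedy_cell_key[OF G Q that] w_pos by (simp add: \<kappa>d)
  qed
  define F' where "F' = (\<lambda>g. Fs k g + (if g \<in> cell u (na Next ! u) then \<sigma> u else 0))"
  define rk' where "rk' = ((!) (na Rank))(u := k + 1, na Next ! u := k + 1)"
  note step = greedy_step[OF G uI opp d_def dmin, folded rk'_def F'_def, folded ve(3), folded p_def q_def]
  have len: "length (na Rank) = N + 1" "length (na Next) = N + 1" "length (na Prev) = N + 1" "length (na Rep) = N + 1"
    "length (na Theta) = 1" "length (ra Carr) = K + 1" using Lk by (auto simp: links_stored_def)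
  have rank: "(!) ((na Rank)[u := k + 1, v := k + 1]) = rk'"
    using u v len by (simp add: nth_fun_update rk'_def ve(3)[symmetric])
  have C': "\<forall>j\<le>k + 1. ra' Carr ! j = w * flow_cost ((Fs(k + 1 := F')) j)"
    using C step(1) k len by (auto simp: ra'_def nth_list_update \<kappa>d distrib_left le_Suc_eq)
  have I': "inactive rk' = ?I - {u, v}"
    using u v by (auto simp: inactive_def rk'_def ve(3)[symmetric])
  have entries: "\<forall>(\<kappa>, u, v)\<in>set h'. \<kappa> = ?key u v \<and> u \<in> {1..N} \<and> v \<in> {1..N}"
    using h h'(1) by (auto simp: heap_ok_def)
  have Q': "ra' Qarr = ra Qarr" by (simp add: ra'_def)
  have keep: "(?key a (na Next ! a), a, na Next ! a) \<in> set h'" if "a \<in> ?I - {u, v}" "\<sigma> a \<noteq> \<sigma> (na Next ! a)" for a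
    using h'(2)[rule_format, OF stored valid] that by auto
  {
    assume q: "q = u"
    note st = step(2)[OF q]
    define nT where "nT = na1(Theta := (na Theta)[0 := na Rep ! v])"
    have "nT Rank = (na Rank)[u := k + 1, v := k + 1]" by (simp add: nT_def na1_def)
    then have fT: "(!) (nT Rank) = rk'" by (simp only: rank)
    have nT: "nT Next = na Next" "nT Prev = na Prev" "nT Rep = na Rep" "nT Theta ! 0 = na Rep ! v"
      using len by (simp_all add: nT_def na1_def)
    show "progress (k + 1) ra' (na1(Theta := (na Theta)[0 := na Rep ! v])) \<and>
       heap_ok ra' (na1(Theta := (na Theta)[0 := na Rep ! v])) h'"
      unfolding nT_def[symmetric]
    proof
      show "progress (k + 1) ra' nT"
        unfolding progress_def fT nT
        by (rule exI[of _ "Fs(k + 1 := F')"], rule exI[of _ d]) (use st C' in blast)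
      show "heap_ok ra' nT h'"
        unfolding heap_ok_def fT Q' using st entries by simp
    qed
  }
  assume q: "q \<noteq> u"
  have nuv: "u \<noteq> na Next ! u" using uv ve(3) by simp
  have nq: "na Next ! (na Next ! u) \<noteq> u" using q by (simp add: q_def ve(3)[symmetric])
  note RR = ring_remove[OF R uI nuv nq, folded ve(3), folded p_def q_def]
  show pq: "p \<in> {1..N} \<and> q \<in> {1..N}" using RR(1,2) by (auto simp: inactive_def)
  assume g: "g \<in> {na Rep ! p, na Rep ! v}"
    and na2: "na2 = na1(Next := (na Next)[p := q], Prev := (na Prev)[q := p], Rep := (na Rep)[p := g])"
  note st = step(3)[OF q g]
  have b: "p < N + 1" "q < N + 1" using pq by auto
  have fns: "(!) (na2 Rank) = rk'" "(!) (na2 Next) = ((!) (na Next))(p := q)" "(!) (na2 Prev) = ((!) (na Prev))(q := p)"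
    "(!) (na2 Rep) = ((!) (na Rep))(p := g)" "na2 Theta = na Theta"
  proof -
    have "na2 Rank = (na Rank)[u := k + 1, v := k + 1]" by (simp add: na2 na1_def)
    then show "(!) (na2 Rank) = rk'" by (simp only: rank)
  qed (use b len in \<open>simp_all add: na2 na1_def nth_fun_update\<close>)
  have th0: "na Theta ! 0 = 0" using th uI by blast
  have "progress (k + 1) ra' na2"
    unfolding progress_def fns
    by (rule exI[of _ "Fs(k + 1 := F')"], rule exI[of _ d]) (use st C' th0 in blast)
  moreover have nx2: "na2 Next ! a = (if a = p then q else na Next ! a)" for a
    using fns(2) by (metis fun_upd_apply)
  moreover have "heap_ok ra' na2 h'" if "\<sigma> p = \<sigma> q"
    unfolding heap_ok_def fns(1) nx2 Q' I' using entries keep that by auto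
  moreover have "heap_ok ra' na2 ((?key p q, p, q) # h')"
    unfolding heap_ok_def fns(1) nx2 Q' I' using entries keep pq by auto
  ultimately show "progress (k + 1) ra' na2 \<and>
       (\<sigma> p = \<sigma> q \<longrightarrow> heap_ok ra' na2 h') \<and>
       (\<sigma> p \<noteq> \<sigma> q \<longrightarrow> heap_ok ra' na2 ((?key p q, p, q) # h'))" by blast
qed


lemma small_record:
  "small N (ram_of ra na h tp tm pk k) \<longleftrightarrow>
    pk \<le> 60 * N + 60 \<and> (\<forall>a. length (ra a) \<le> 2 * N + 1) \<and> (\<forall>b. length (na b) \<le> 4 * N + 1)"
  by (simp add: small_def)

lemma activate_correct:
  assumes M: "main_inv K T k s" and k: "k < K" and K: "K \<le> card src" "K \<le> card tgt"
  shows "wp (activate N k) (\<lambda>_ s'. main_inv K T (k + 1) s') (s\<lparr>time := time s + 2\<rparr>)"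
proof -
  obtain ra na h tp tm pk b where s: "s = ram_of ra na h tp tm pk b"
    by (cases s)
  have b: "b" and sm: "pk \<le> 60 * N + 60" "\<forall>a. length (ra a) \<le> 2 * N + 1" "\<forall>b. length (na b) \<le> 4 * N + 1"
    and st: "static ra na" and lk: "links_stored K ra na" and hp: "heap_ok ra na h" and lh: "length h \<le> N + k"
    and tm: "tm + pop_time * length h \<le> T + k * (60 + H + pop_time)" and P: "progress k ra na"
    using M unfolding main_inv_def s by (simp_all add: small_record)
  have len: "length (na Rank) = N + 1" "length (na Next) = N + 1" "length (na Prev) = N + 1" "length (na Rep) = N + 1"
    "length (na Theta) = 1" "length (ra Carr) = K + 1" "length (na Kind) = 2 * N + 1"
    using lk st by (auto simp: links_stored_def static_def)
  have "card src + card tgt = N"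
    using card_Un_disjoint[OF src_tgt(3,4,1)] src_tgt(2) by simp
  \<comment> \<open>A heap of length at most \<open>N + k\<close> stays within the
    \<open>2 * N\<close> entries for which \<open>H\<close> is valid.\<close>
  then have kN: "k < N" "2 * K \<le> N" using k K by auto
  have ex: "\<exists>e\<in>set h. valid_entry na e"
  proof -
    obtain Fs \<mu> where G: "greedy_state k ((!) (na Rank)) ((!) (na Next)) ((!) (na Prev)) ((!) (na Rep)) Fs \<mu>"
      using P unfolding progress_def by blast
    have R: "ring_links (inactive ((!) (na Rank))) ((!) (na Next)) ((!) (na Prev))" using G by (simp add: greedy_state_def)
    obtain u where u: "u \<in> inactive ((!) (na Rank))" "\<sigma> u \<noteq> \<sigma> (na Next ! u)"
      using greedy_opposite_exists[OF G] k K by force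
    note U = ring_linksD[OF R u(1)]
    have nN: "na Next ! u \<in> {1..N}" using ring_linksD(1)[OF R U(2)] .
    have kd: "na Kind ! i = of_bool (\<sigma> i = 1)" if "i \<in> {1..N}" for i using st that by (simp add: static_def)
    have "na Kind ! u \<noteq> na Kind ! (na Next ! u)"
      using u(2) \<sigma>_cases[of u] \<sigma>_cases[of "na Next ! u"] unfolding kd[OF U(1)] kd[OF nN] by auto
    then have "valid_entry na (cell_key ((!) (ra Qarr)) u (na Next ! u), u, na Next ! u)"
      using u U(2) by (simp add: valid_entry_def inactive_def)
    then show ?thesis using hp u unfolding heap_ok_def by blast
  qed
  have entries: "u \<in> {1..N} \<and> v \<in> {1..N}" if "(\<kappa>, u, v) \<in> set h" for \<kappa> u v
    using hp that unfolding heap_ok_def by blast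
  have lh2: "length h \<le> 2 * N" using lh kN by simp
  have c: "cells_used ra' na' h \<le> 60 * N + 60"
    if "\<forall>a. length (ra' a) \<le> 2 * N + 1" "\<forall>b. length (na' b) \<le> 4 * N + 1" "length h \<le> 2 * N" for ra' na' h
    using that by (intro cells_used_le) auto
  have main: "main_inv K T (k + 1) (ram_of ra' na' h2 tp2 tm2 pk2 True)"
    if "pk2 \<le> 60 * N + 60" "\<forall>a. length (ra' a) = length (ra a)" "\<forall>b. length (na' b) = length (na b)"
      "ra' Qarr = ra Qarr" "na' Kind = na Kind" "progress (k + 1) ra' na'" "heap_ok ra' na' h2"
      "length h2 \<le> length h" "tm2 + pop_time * length h2 \<le> tm + pop_time * length h + (60 + H + pop_time)"
    for ra' na' h2 tp2 tm2 pk2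
    unfolding main_inv_def ram.simps small_record
    using that sm st lk lh tm by (simp add: static_def links_stored_def)
  show ?thesis
    unfolding activate_def wp_bind[of pop_valid] s ram.simps
  proof (subst iffD2[OF eq_True b], rule wp_pop_valid[OF len(1,2,7) entries ex lh2])
    fix \<kappa> u v h' tp' tm'
    assume e: "(\<kappa>, u, v) \<in> set h" "valid_entry na (\<kappa>, u, v)"
      and min: "\<And>e. e \<in> set h \<Longrightarrow> valid_entry na e \<Longrightarrow> \<kappa> \<le> fst e"
      and sub: "set h' \<subseteq> set h" "\<And>e. e \<in> set h \<Longrightarrow> valid_entry na e \<Longrightarrow> e \<noteq> (\<kappa>, u, v) \<Longrightarrow> e \<in> set h'"
      and lh': "length h' < length h" and tm': "tm' + pop_time * length h' \<le> tm + 2 + pop_time * length h"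
    have min': "\<forall>e\<in>set h. valid_entry na e \<longrightarrow> \<kappa> \<le> fst e"
      and sub': "\<forall>e\<in>set h. valid_entry na e \<longrightarrow> e \<noteq> (\<kappa>, u, v) \<longrightarrow> e \<in> set h'"
      using min sub(2) by blast+
    define p where "p = na Prev ! u"
    define q where "q = na Next ! v"
    define gv where "gv = na Rep ! v"
    define gp where "gp = na Rep ! p"
    define rks where "rks = (na Rank)[u := k + 1, v := k + 1]"
    define cs where "cs = (ra Carr)[k + 1 := ra Carr ! k + \<kappa>]"
    note PS = progress_step[OF P st lk k hp e min' sub(1) sub', folded p_def q_def, folded gv_def gp_def rks_def cs_def]
    have lr: "length rks = N + 1" "length cs = K + 1" using len by (simp_all add: rks_def cs_def)
    have bnd: "u < N + 1" "v < N + 1" "k + 1 < K + 1" "k < K + 1" "(0::nat) < 1" using entries[OF e(1)] k by auto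
    show "wp (case (\<kappa>, u, v) of (\<kappa>, u, v) \<Rightarrow> do {
     k' \<leftarrow> calc 1 (k + 1);
     nput Rank u k';
     nput Rank v k';
     c \<leftarrow> rget Carr k;
     c' \<leftarrow> calc 1 (c + \<kappa>);
     rput Carr k' c';
     q \<leftarrow> nget Next v;
     gv \<leftarrow> nget Rep v;
     last_two \<leftarrow> calc 1 (q = u);
     if last_two then nput Theta 0 gv
     else do {
       p \<leftarrow> nget Prev u;
       gp \<leftarrow> nget Rep p;
       nput Next p q;
       nput Prev q p;
       d \<leftarrow> pick_below 2;
       g \<leftarrow> calc 1 (if d = 0 then gp else gv);
       nput Rep p g;
       insert_cell N p q
     }
   }) (\<lambda>_. main_inv K T (k + 1)) (ram_of ra na h' tp' tm' pk True)"
    proof (cases "q = u")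
      case True
      have "main_inv K T (k + 1) (ram_of (ra(Carr := cs)) (na(Rank := rks, Theta := (na Theta)[0 := gv])) h' tp' (tm' + 1 + 1 + 1 + 1 + 1 + 1 + 1 + 1 + 1 + 1) pk True)"
        by (rule main) (use PS(3)[OF True] sm tm' lh' lr len in auto)
      then show ?thesis
        by (simp only: wp_exec len bnd q_def[symmetric] gv_def[symmetric] True rks_def[symmetric] cs_def[symmetric] fun_upd_upd)
    next
      case False
      have pq: "p \<in> {1..N}" "q \<in> {1..N}" using PS(4)[OF False] by auto
      then have bnd2: "p < N + 1" "q < N + 1" by auto
      define g where "g = (if tp' 0 mod 2 = 0 then gp else gv)"
      have g: "g \<in> {gp, gv}" by (simp add: g_def)
      define na2 where "na2 = na(Rank := rks, Next := (na Next)[p := q], Prev := (na Prev)[q := p], Rep := (na Rep)[p := g])"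
      note PS5 = PS(5)[OF False g na2_def]
      have st2: "static (ra(Carr := cs)) na2" using st by (simp add: static_def na2_def)
      have la: "\<forall>a. length ((ra(Carr := cs)) a) = length (ra a)" "\<forall>b. length (na2 b) = length (na b)"
        using lr len by (auto simp: na2_def)
      have fl: "floor_log (1 + length h') + 1 \<le> H" using lh' lh2 by (intro heap_cost) simp
      have lc: "Suc (length h') \<le> 2 * N" using lh' lh2 by simp
      let ?t = "tm' + 1 + 1 + 1 + 1 + 1 + 1 + 1 + 1 + 1 + 1 + 1 + 1 + 1 + 1 + 1 + 1"
      have 1: "main_inv K T (k + 1) (ram_of (ra(Carr := cs)) na2 h' (\<lambda>i. tp' (Suc i)) (?t + 3) pk True)" if "\<sigma> p = \<sigma> q"
        by (rule main) (use PS5 that sm tm' lh' la in \<open>auto simp: na2_def\<close>)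
      have 2: "main_inv K T (k + 1) (ram_of (ra(Carr := cs)) na2 ((cell_key ((!) (ra Qarr)) p q, p, q) # h') (\<lambda>i. tp' (Suc i)) (?t + 15 + floor_log (1 + length h')) (max pk (cells_used (ra(Carr := cs)) na2 ((cell_key ((!) (ra Qarr)) p q, p, q) # h'))) True)" if "\<sigma> p \<noteq> \<sigma> q"
      proof (rule main)
        show "max pk (cells_used (ra(Carr := cs)) na2 ((cell_key ((!) (ra Qarr)) p q, p, q) # h')) \<le> 60 * N + 60"
          using c[of "ra(Carr := cs)" na2] la sm lc by simp
        show "?t + 15 + floor_log (1 + length h') + pop_time * length ((cell_key ((!) (ra Qarr)) p q, p, q) # h')
            \<le> tm + pop_time * length h + (60 + H + pop_time)"
          using tm' fl by simp
      qed (use PS5 that la lh' in \<open>auto simp: na2_def\<close>)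
      show ?thesis
        using 1 2
        by (simp only: wp_exec len bnd bnd2 q_def[symmetric] gv_def[symmetric] p_def[symmetric] gp_def[symmetric] False
            rks_def[symmetric] cs_def[symmetric] fun_upd_upd g_def[symmetric] na2_def[symmetric]
            wp_insert_cell[where ra = "ra(Carr := cs)" and na = na2 and u = p and v = q, OF st2 pq] split: if_split) blast
    qed
  qed
qed

section \<open>The choice of a gap when atoms remain\<close>

definition scan_inv :: "nat \<Rightarrow> nat \<Rightarrow> ram \<Rightarrow> nat \<Rightarrow> ram \<Rightarrow> bool" where
  "scan_inv K T s0 t s \<longleftrightarrow> ok s \<and> small N s \<and> time s \<le> T + 12 * t \<and> rarr s = rarr s0 \<and>
    narr s Rank = narr s0 Rank \<and> narr s Rep = narr s0 Rep \<and> links_stored K (rarr s) (narr s) \<and>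
    (narr s Theta ! 0 = 0 \<and> (\<forall>i\<in>{1..<t}. narr s0 Rank ! i \<noteq> 0) \<or>
     (\<exists>i\<in>inactive ((!) (narr s0 Rank)). narr s Theta ! 0 = narr s0 Rep ! i))"

text \<open>The tape may replace a chosen representative but cannot prevent a first choice: as long
  as \<open>Theta\<close> is 0, the first inactive atom met is taken. Hence both alternatives of the
  invariant survive every tape.\<close>

lemma any_remaining_cell_correct:
  assumes s0: "scan_inv K T s0 1 s0"
    and Q: "\<And>s. scan_inv K (T + 20 + 12 * N) s0 (N + 1) s \<Longrightarrow> Q () s"
  shows "wp (any_remaining_cell N) Q s0"
  unfolding any_remaining_cell_def
proof (rule wp_foreach[where J = "scan_inv K T s0"])
  fix i s
  assume i: "1 \<le> i" "i < N + 1" and J: "scan_inv K T s0 i s"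
  obtain ra na h tp tm pk b where s: "s = ram_of ra na h tp tm pk b"
    by (cases s)
  have b: "b" and sm: "pk \<le> 60 * N + 60" "\<forall>a. length (ra a) \<le> 2 * N + 1" "\<forall>b. length (na b) \<le> 4 * N + 1"
    and tm: "tm \<le> T + 12 * i" and eq: "ra = rarr s0" "na Rank = narr s0 Rank" "na Rep = narr s0 Rep"
    and lk: "links_stored K ra na" and th: "na Theta ! 0 = 0 \<and> (\<forall>i\<in>{1..<i}. narr s0 Rank ! i \<noteq> 0) \<or>
     (\<exists>i\<in>inactive ((!) (narr s0 Rank)). na Theta ! 0 = narr s0 Rep ! i)"
    using J unfolding scan_inv_def s ram.simps small_record by blast+
  have len: "length (na Rank) = N + 1" "length (na Theta) = 1" "length (na Rep) = N + 1" using lk by (auto simp: links_stored_def)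
  have sp: "{1..<i + 1} = insert i {1..<i}" using i by auto
  have bnd: "i < N + 1" "(0::nat) < 1" using i by auto
  let ?tp = "\<lambda>i. tp (Suc i)"
  have 1: "scan_inv K T s0 (i + 1) (ram_of ra na h ?tp (tm + 2 + 1 + 1 + 1 + 5) pk True)"
    if "\<not> (na Rank ! i = 0 \<and> (na Theta ! 0 = 0 \<or> tp 0 mod 2 = 0))"
    unfolding scan_inv_def ram.simps small_record sp using that sm tm eq lk th i by auto
  have 2: "scan_inv K T s0 (i + 1) (ram_of ra (na(Theta := (na Theta)[0 := na Rep ! i])) h ?tp (tm + 2 + 1 + 1 + 1 + 5 + 1 + 1) pk True)"
    if "na Rank ! i = 0"
  proof -
    have "i \<in> inactive ((!) (narr s0 Rank))" using that i eq by (simp add: inactive_def)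
    then show ?thesis
      unfolding scan_inv_def ram.simps small_record using sm tm eq lk i len by (auto simp: links_stored_def)
  qed
  show "wp (do {
     r \<leftarrow> nget Rank i;
     \<theta> \<leftarrow> nget Theta 0;
     d \<leftarrow> pick_below 2;
     take_it \<leftarrow> calc 5 (r = 0 \<and> (\<theta> = 0 \<or> d = 0));
     if take_it then do { g \<leftarrow> nget Rep i; nput Theta 0 g }
     else State_Monad.return ()
   }) (\<lambda>_. scan_inv K T s0 (i + 1)) (s\<lparr>time := time s + 2\<rparr>)"
    unfolding s using 1 2 b
    by (simp only: ram.simps wp_exec len bnd split: if_split) blast
qed (use s0 Q in \<open>auto simp: scan_inv_def small_def links_stored_def\<close>)

end

section \<open>Sorting and the whole run\<close>

locale pawc_input =
  fixes L w :: real and xs ys :: "real list"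
  assumes valid: "valid_input L w xs ys"
begin

definition total :: nat where "total = length xs + length ys"
abbreviation pt :: "nat \<Rightarrow> real" where "pt i \<equiv> atom (set xs) (set ys) i"
definition charge :: "nat \<Rightarrow> int" where "charge i = (if pt i \<in> set xs then 1 else -1)"

lemma input: "0 < L" "0 < w" "xs \<noteq> []" "ys \<noteq> []" "distinct xs" "distinct ys" "set xs \<inter> set ys = {}"
  "set xs \<union> set ys \<subseteq> {0..<L}"
  using valid by (auto simp: valid_input_def)

lemma card_atoms: "card (set xs \<union> set ys) = total"
  using input by (simp add: card_Un_disjoint distinct_card total_def)

lemma atoms_image: "pt ` {1..total} = set xs \<union> set ys"
proof -
  have "set (sorted_list_of_set (set xs \<union> set ys)) = set xs \<union> set ys" by simp
  moreover have "set l = (\<lambda>i. l ! (i - 1)) ` {1..length l}" for l :: "real list"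
  proof -
    have "(\<lambda>i. l ! (i - 1)) ` {1..length l} = (\<lambda>i. l ! (i - 1)) ` Suc ` {0..<length l}"
      by (simp only: image_Suc_atLeastLessThan atLeastLessThanSuc_atLeastAtMost One_nat_def)
    then show ?thesis unfolding image_image by (simp add: set_conv_nth) (auto simp: image_iff)
  qed
  ultimately show ?thesis using card_atoms by (simp add: atom_def)
qed

lemma total_ge_2: "2 \<le> total"
proof -
  have "0 < length xs" "0 < length ys" using input by auto
  then show ?thesis unfolding total_def by linarith
qed

end

sublocale pawc_input \<subseteq> weighted_circle L total pt charge w
proof
  fix i j :: nat assume "1 \<le> i" "i < j" "j \<le> total"
  then show "pt i < pt j"
    unfolding atom_def using sorted_list_of_set.strict_sorted_key_list_of_set[of "set xs \<union> set ys"] card_atoms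
    by (auto simp: sorted_wrt_iff_nth_less)
next
  fix i :: nat assume "1 \<le> i" "i \<le> total"
  then have "pt i \<in> pt ` {1..total}" by (intro imageI) simp
  then show "pt i \<in> {0..<L}" unfolding atoms_image using input(8) by blast
next
  show "1 \<le> total" using total_ge_2 by simp
qed (use input total_ge_2 in \<open>simp_all add: charge_def\<close>)

context pawc_input
begin

lemma src_pts_eq: "src_pts = set xs" and tgt_pts_eq: "tgt_pts = set ys"
proof -
  have "src = {i\<in>{1..total}. pt i \<in> set xs}" by (auto simp: src_def charge_def)
  then have "src_pts = pt ` {1..total} \<inter> set xs" unfolding src_pts_def by auto
  then show "src_pts = set xs" unfolding atoms_image by auto
  have "tgt = {i\<in>{1..total}. pt i \<notin> set xs}" by (auto simp: tgt_def charge_def)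
  then have "tgt_pts = pt ` {1..total} - set xs" unfolding tgt_pts_def by auto
  then show "tgt_pts = set ys" unfolding atoms_image using input by auto
qed

lemma card_src: "card src = length xs" and card_tgt: "card tgt = length ys"
  using card_image[OF inj_z_types(1)] card_image[OF inj_z_types(2)] src_pts_eq tgt_pts_eq input
  by (simp_all add: src_pts_def tgt_pts_def distinct_card)

lemma gap_eq: "i \<in> {1..total} \<Longrightarrow> gap i = support_gap L (set xs) (set ys) i"
  by (cases "i = total") (simp_all add: gap_def support_gap_def card_atoms)

definition entry :: "nat \<Rightarrow> real \<times> nat \<times> nat" where "entry i = (pt i, of_bool (charge i = 1), 0)"

lemma entry_image: "entry ` {1..total} = (\<lambda>x. (x, 1, 0)) ` set xs \<union> (\<lambda>y. (y, 0, 0)) ` set ys"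
proof -
  have "entry ` {1..total} = (\<lambda>x. (x, of_bool (x \<in> set xs), 0)) ` pt ` {1..total}"
    unfolding image_image by (rule image_cong) (auto simp: entry_def charge_def)
  then show ?thesis unfolding atoms_image using input(7) by (auto simp: image_Un image_iff intro!: bexI)
qed

lemma inj_entry: "inj_on entry {1..total}"
proof (rule inj_onI)
  fix i j assume "i \<in> {1..total}" "j \<in> {1..total}" "entry i = entry j"
  then show "i = j" using inj_onD[OF inj_z] by (metis entry_def prod.inject)
qed

text \<open>The coordinates are distinct, so the minimum is unique and the \<open>i\<close>-th
  extraction yields atom \<open>i\<close> for every tape. The initial time 2 comes from the
  computation of \<open>N\<close> and \<open>K\<close>.\<close>

lemma sort_atoms_correct:
  assumes Q: "\<And>s. ok s \<Longrightarrow> small total s \<Longrightarrow> heap s = [] \<Longrightarrow> atoms_stored s \<Longrightarrow> time s \<le> 100 + 10 * total + total * (3 * H + 30) \<Longrightarrow> Q () s"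
    and s0: "s0 = init_ram xs ys ch\<lparr>time := 2\<rparr>"
  shows "wp (sort_atoms (length xs) (length ys) total L) Q s0"
proof -
  let ?N = total
  define ra0 where "ra0 = (\<lambda>_. [])(Src := xs, Tgt := ys)"
  define ra1 where "ra1 = ra0(Zarr := replicate (2 * ?N + 1) 0)"
  define na1 where "na1 = (\<lambda>_::nname. [])(Kind := replicate (2 * ?N + 1) (0::nat))"
  have lra0: "length (ra0 a) \<le> 2 * ?N + 1" for a by (simp add: ra0_def total_def)
  have lens: "length (ra1 a) \<le> 2 * ?N + 1" "length (na1 b) \<le> 4 * ?N + 1" for a b
    using lra0 by (simp_all add: ra1_def na1_def del: replicate_Suc)
  have c: "cells_used ra' na' h \<le> 60 * ?N + 60"
    if "\<And>a. length (ra' a) \<le> 2 * ?N + 1" "\<And>b. length (na' b) \<le> 4 * ?N + 1" "length h \<le> 2 * ?N" for ra' na' h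
    using that by (intro cells_used_le) auto
  define h1 where "h1 i = rev (map (\<lambda>x. (x, 1 :: nat, 0 :: nat)) (take i xs))" for i
  \<comment> \<open>The heap while the targets are inserted, listed with the latest entry first and
    the sources at the end.\<close>
  define h2 where "h2 j = rev (map (\<lambda>y. (y, 0 :: nat, 0 :: nat)) (take j ys)) @ h1 (length xs)" for j
  have h1: "h1 0 = []" "length (h1 i) \<le> length xs" "i < length xs \<Longrightarrow> h1 (i + 1) = (xs ! i, 1, 0) # h1 i" for i
    by (simp_all add: h1_def take_Suc_conv_app_nth)
  have h2: "h2 0 = h1 (length xs)" "length (h2 i) \<le> ?N" "i < length ys \<Longrightarrow> h2 (i + 1) = (ys ! i, 0, 0) # h2 i" for i
    using h1(2)[of "length xs"] by (simp_all add: h2_def take_Suc_conv_app_nth total_def)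
  define J1 where "J1 i s \<longleftrightarrow> (\<exists>tm pk. s = ram_of ra1 na1 (h1 i) ch tm pk True \<and>
      pk \<le> 60 * ?N + 60 \<and> tm \<le> 20 + 4 * ?N + i * (H + 5))" for i s
  define J2 where "J2 i s \<longleftrightarrow> (\<exists>tm pk. s = ram_of ra1 na1 (h2 i) ch tm pk True \<and>
      pk \<le> 60 * ?N + 60 \<and> tm \<le> 30 + 4 * ?N + (length xs + i) * (H + 5))" for i s
  define stored where "stored i ra na \<longleftrightarrow> length (ra Zarr) = 2 * ?N + 1 \<and> length (na Kind) = 2 * ?N + 1 \<and>
      (\<forall>a. length (ra a) \<le> 2 * ?N + 1) \<and> (\<forall>b. length (na b) \<le> 4 * ?N + 1) \<and>
      (\<forall>k\<in>{1..<i}. ra Zarr ! k = pt k \<and> na Kind ! k = of_bool (charge k = 1) \<and>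
         ra Zarr ! (k + ?N) = pt k + L \<and> na Kind ! (k + ?N) = of_bool (charge k = 1))"
    for i :: nat and ra :: "rname \<Rightarrow> real list" and na :: "nname \<Rightarrow> nat list"
  define J3 where "J3 i s \<longleftrightarrow> (\<exists>ra na h tp tm pk. s = ram_of ra na h tp tm pk True \<and>
      pk \<le> 60 * ?N + 60 \<and> tm \<le> 40 + 4 * ?N + ?N * (H + 5) + i * (H + 10) \<and> distinct h \<and> set h = entry ` {i..?N} \<and> stored i ra na)" for i s
  have step1: "wp (do { x \<leftarrow> rget Src i; push (x, 1, 0) }) (\<lambda>_ s'. J1 (i + 1) s') (s\<lparr>time := time s + 2\<rparr>)"
    if i: "i < length xs" and Js: "J1 i s" for i s
  proof -
    obtain tm pk where s: "s = ram_of ra1 na1 (h1 i) ch tm pk True"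
      and J: "pk \<le> 60 * ?N + 60" "tm \<le> 20 + 4 * ?N + i * (H + 5)" using Js unfolding J1_def by blast
    have S: "ra1 Src = xs" by (simp add: ra1_def ra0_def)
    have fl: "floor_log (1 + length (h1 i)) + 1 \<le> H" using h1(2)[of i] by (intro heap_cost) (simp add: total_def)
    have cc: "cells_used ra1 na1 (h1 (i + 1)) \<le> 60 * ?N + 60" using lens h1(2)[of "i + 1"] by (intro c) (auto simp: total_def)
    show ?thesis unfolding s
      by (simp only: ram.simps wp_exec S i h1(3)[OF i, symmetric]) (use J fl cc in \<open>auto simp: J1_def\<close>)
  qed
  have step2: "wp (do { y \<leftarrow> rget Tgt i; push (y, 0, 0) }) (\<lambda>_ s'. J2 (i + 1) s') (s\<lparr>time := time s + 2\<rparr>)"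
    if i: "i < length ys" and Js: "J2 i s" for i s
  proof -
    obtain tm pk where s: "s = ram_of ra1 na1 (h2 i) ch tm pk True"
      and J: "pk \<le> 60 * ?N + 60" "tm \<le> 30 + 4 * ?N + (length xs + i) * (H + 5)" using Js unfolding J2_def by blast
    have S: "ra1 Tgt = ys" by (simp add: ra1_def ra0_def)
    have fl: "floor_log (1 + length (h2 i)) + 1 \<le> H" using h2(2)[of i] by (intro heap_cost) simp
    have "length (h2 (i + 1)) \<le> 2 * ?N" by (rule order_trans[OF h2(2)]) simp
    then have cc: "cells_used ra1 na1 (h2 (i + 1)) \<le> 60 * ?N + 60" using lens by (intro c)
    show ?thesis unfolding s
      by (simp only: ram.simps wp_exec S i h2(3)[OF i, symmetric]) (use J fl cc in \<open>auto simp: J2_def\<close>)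
  qed
  have step3: "wp (do {
       (z, b, _) \<leftarrow> pop;
       i' \<leftarrow> calc 1 (i + ?N);
       z' \<leftarrow> calc 1 (z + L);
       rput Zarr i z;
       nput Kind i b;
       rput Zarr i' z';
       nput Kind i' b
     }) (\<lambda>_ s'. J3 (i + 1) s') (s\<lparr>time := time s + 2\<rparr>)"
    if i: "1 \<le> i" "i < ?N + 1" and Js: "J3 i s" for i s
  proof -
    obtain ra na h tp tm pk where s: "s = ram_of ra na h tp tm pk True"
      and J: "pk \<le> 60 * ?N + 60" "tm \<le> 40 + 4 * ?N + ?N * (H + 5) + i * (H + 10)" "distinct h"
        "set h = entry ` {i..?N}" "stored i ra na"
      using Js unfolding J3_def by blast
    have "card (set h) \<le> ?N" unfolding J(4) using i card_image_le[of "{i..?N}" entry] by simp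
    then have lh: "length h \<le> ?N" using distinct_card[OF J(3)] by simp
    have fl: "floor_log (1 + length h) + 1 \<le> H" using lh by (intro heap_cost) simp
    have ne: "h \<noteq> []" using J(4) i by auto
    have len: "length (ra Zarr) = 2 * ?N + 1" "length (na Kind) = 2 * ?N + 1" using J(5) by (auto simp: stored_def)
    have bnd: "i < 2 * ?N + 1" "i + ?N < 2 * ?N + 1" using i by auto
    show ?thesis
      unfolding s ram.simps wp_bind[of pop]
    proof (rule wp_pop[OF ne])
      fix e tp'
      assume e: "e \<in> set h" "\<And>e'. e' \<in> set h \<Longrightarrow> fst e \<le> fst e'"
      obtain k where k: "e = entry k" "k \<in> {i..?N}" using e(1) J(4) by auto
      have "entry i \<in> set h" using J(4) i by auto
      then have "pt k \<le> pt i" using e(2) by (auto simp: k entry_def)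
      then have "\<not> i < k" using z_less_iff[of i k] k i by auto
      then have ki: "e = (pt i, of_bool (charge i = 1), 0)" using k by (simp add: entry_def)
      have ei: "e = entry i" by (simp add: ki entry_def)
      have "{i..?N} = insert i {i + 1..?N}" using i by auto
      moreover have "entry i \<notin> entry ` {i + 1..?N}" using inj_onD[OF inj_entry] i by fastforce
      ultimately have rem: "set (remove1 e h) = entry ` {i + 1..?N}" using J(3,4) unfolding ei by auto
      have st: "stored (i + 1) (ra(Zarr := (ra Zarr)[i := pt i, i + ?N := pt i + L]))
          (na(Kind := (na Kind)[i := of_bool (charge i = 1), i + ?N := of_bool (charge i = 1)]))"
      proof -
        have "(ra Zarr)[i := pt i, i + ?N := pt i + L] ! k = pt k \<and>
           (na Kind)[i := of_bool (charge i = 1), i + ?N := of_bool (charge i = 1)] ! k = of_bool (charge k = 1) \<and>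
           (ra Zarr)[i := pt i, i + ?N := pt i + L] ! (k + ?N) = pt k + L \<and>
           (na Kind)[i := of_bool (charge i = 1), i + ?N := of_bool (charge i = 1)] ! (k + ?N) = of_bool (charge k = 1)"
          if k: "k \<in> {1..<i + 1}" for k
        proof (cases "k = i")
          case True
          then show ?thesis using len bnd total_ge_2 by (simp add: nth_list_update)
        next
          case False
          then have "k \<in> {1..<i}" using k by auto
          then show ?thesis using J(5) False i by (simp add: stored_def nth_list_update)
        qed
        then show ?thesis using J(5) len by (simp add: stored_def)
      qed
      have "J3 (i + 1) (ram_of (ra(Zarr := (ra Zarr)[i := pt i, i + ?N := pt i + L])) (na(Kind := (na Kind)[i := of_bool (charge i = 1), i + ?N := of_bool (charge i = 1)])) (remove1 e h) tp' (tm + 2 + 2 + floor_log (1 + length h) + 1 + 1 + 1 + 1 + 1 + 1) pk True)"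
        unfolding J3_def by (intro exI conjI, rule refl) (use J st rem fl in auto)
      then show "wp (case e of (z, b, _) \<Rightarrow> do {
         i' \<leftarrow> calc 1 (i + ?N);
         z' \<leftarrow> calc 1 (z + L);
         rput Zarr i z;
         nput Kind i b;
         rput Zarr i' z';
         nput Kind i' b
       }) (\<lambda>_. J3 (i + 1)) (ram_of ra na (remove1 e h) tp' (tm + 2 + 2 + floor_log (1 + length h)) pk True)"
        by (simp only: ki wp_exec len bnd fun_upd_upd)
    qed
  qed
  have init: "s0 = ram_of ra0 (\<lambda>_. []) [] ch 2 (cells_used ra0 (\<lambda>_. []) []) True"
    unfolding s0 init_ram_def update_peak_def ra0_def cells_used_def footprint_def by simp
  have J23: "J3 1 (s\<lparr>time := time s + 1\<rparr>)" if Js: "J2 (length ys) s" for s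
  proof -
    obtain tm pk where s: "s = ram_of ra1 na1 (h2 (length ys)) ch tm pk True"
      and J: "pk \<le> 60 * ?N + 60" "tm \<le> 30 + 4 * ?N + ?N * (H + 5)" using Js unfolding J2_def total_def by blast
    have a: "set (h2 (length ys)) = entry ` {1..?N}" unfolding entry_image by (auto simp: h2_def h1_def)
    have b: "distinct (h2 (length ys))" using input by (auto simp: h2_def h1_def distinct_map inj_on_def)
    have c: "stored 1 ra1 na1" using lens by (simp add: stored_def ra1_def na1_def del: replicate_Suc)
    show ?thesis unfolding J3_def s ram.simps
      by (intro exI conjI, rule refl) (use J a b c in auto)
  qed
  have J10: "J1 0 (ram_of ra1 na1 [] ch tm pk True)"
    if "tm \<le> 20 + 4 * ?N" "pk \<le> 60 * ?N + 60" for tm pk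
    unfolding J1_def h1(1) using that by auto
  have J12: "J2 0 (s\<lparr>time := time s + 1\<rparr>)" if Js: "J1 (length xs) s" for s
  proof -
    obtain tm pk where s: "s = ram_of ra1 na1 (h1 (length xs)) ch tm pk True"
      and J: "pk \<le> 60 * ?N + 60" "tm \<le> 20 + 4 * ?N + length xs * (H + 5)" using Js unfolding J1_def by blast
    show ?thesis unfolding J2_def s ram.simps h2(1)
      by (intro exI conjI, rule refl) (use J in auto)
  qed
  have fin: "Q () (s\<lparr>time := time s + 1\<rparr>)" if Js: "J3 (?N + 1) s" for s
  proof -
    obtain ra na h tp tm pk where s: "s = ram_of ra na h tp tm pk True"
      and J: "pk \<le> 60 * ?N + 60" "tm \<le> 40 + 4 * ?N + ?N * (H + 5) + (?N + 1) * (H + 10)"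
        "set h = entry ` {?N + 1..?N}" "stored (?N + 1) ra na"
      using Js unfolding J3_def by blast
    have HN: "1 * H \<le> ?N * H" using total_ge_2 by (intro mult_le_mono1) simp
    have "ra Zarr ! i = ext_z i \<and> na Kind ! i = of_bool (ext_\<sigma> i = 1)" if i: "i \<in> {1..2 * ?N}" for i
    proof (cases "i \<le> ?N")
      case True
      then show ?thesis using J(4) i by (simp add: stored_def ext_z_def ext_\<sigma>_def)
    next
      case False
      then obtain k where k: "k \<in> {1..<?N + 1}" "i = k + ?N" using i by (intro that[of "i - ?N"]) auto
      then have "ra Zarr ! i = pt k + L \<and> na Kind ! i = of_bool (charge k = 1)"
        using J(4) unfolding stored_def by blast
      then show ?thesis using k by (simp add: ext_z_def ext_\<sigma>_def)
    qed
    then have "atoms_stored (s\<lparr>time := time s + 1\<rparr>)" using J(4) unfolding s by (simp add: atoms_stored_def stored_def)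
    moreover have "small total (s\<lparr>time := time s + 1\<rparr>)" using J(1,4) unfolding s by (simp add: small_def stored_def)
    moreover have "tm + 1 \<le> 100 + 10 * total + total * (3 * H + 30)"
    proof -
      define x where "x = ?N * H"
      have e: "?N * (3 * H + 30) = 3 * x + 30 * ?N" "?N * (H + 5) = x + 5 * ?N" "(?N + 1) * (H + 10) = x + H + 10 * ?N + 10" "H \<le> x"
        using HN by (simp_all add: x_def algebra_simps)
      have "tm \<le> 40 + 4 * ?N + (x + 5 * ?N) + (x + H + 10 * ?N + 10)" using J(2) unfolding e(2,3) .
      then have "tm + 1 \<le> 100 + 10 * ?N + (3 * x + 30 * ?N)" using e(4) by linarith
      then show ?thesis unfolding e(1) .
    qed
    ultimately show ?thesis using J(3) by (intro Q) (auto simp: s)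
  qed
  have c0: "cells_used ra0 (\<lambda>_. []) [] \<le> 60 * ?N + 60" "cells_used ra1 (\<lambda>_. []) [] \<le> 60 * ?N + 60"
    "cells_used ra1 na1 [] \<le> 60 * ?N + 60"
    by (rule c; use lens lra0 in simp)+
  show ?thesis
    unfolding sort_atoms_def init
    apply (simp only: wp_exec ra1_def[symmetric] na1_def[symmetric])
    apply (rule wp_foreach[where J = J1])
       apply simp
    subgoal
      by (rule J10) (use c0 in simp_all)
    subgoal for i s by (rule step1; assumption)
    subgoal for s
      apply (subst wp_bind)
      apply (rule wp_foreach[where J = J2])
         apply simp
        apply (erule J12)
      subgoal for i s by (rule step2; assumption)
      subgoal for s
        apply (rule wp_foreach[where J = J3])
           apply simp
          apply (erule J23)
        subgoal premises prems for i s by (rule step3[OF prems(3,4,5)])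
        subgoal premises prems for s by (rule fin[OF prems(3)])
        done
      done
    done
qed

section \<open>Composition of the phases and the output\<close>

definition pairs :: nat where "pairs = min (length xs) (length ys)"

text \<open>Phrased with flows that vanish on the returned gap, because
  \<open>optimal_flow_costs\<close> obtains the cost, the optimal active set and the line cost from
  such a flow.\<close>

definition solved :: "nat \<Rightarrow> ram \<Rightarrow> bool" where
  "solved T s \<longleftrightarrow> ok s \<and> small total s \<and> time s \<le> T \<and> length (rarr s Carr) = pairs + 1 \<and> out_gap s \<in> {1..total} \<and>
    (\<exists>Fs. \<forall>k\<le>pairs. optimal_flow (active ((!) (narr s Rank)) k) k (Fs k) \<and>
      rarr s Carr ! k = w * flow_cost (Fs k) \<and> Fs k (out_gap s) = 0)"

lemma wp_calc_any: "wp (calc c e) Q s = Q e (s\<lparr>time := time s + c\<rparr>)"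
  by (cases s) (simp add: wp_calc)

lemma finish_correct:
  assumes M: "main_inv pairs T pairs s" and le: "T + pairs * (60 + H + pop_time) + 60 + 24 * total \<le> T'"
  shows "wp (do {
     \<theta> \<leftarrow> nget Theta 0;
     unset \<leftarrow> calc 1 (\<theta> = 0);
     if unset then any_remaining_cell total else State_Monad.return ()
   }) (\<lambda>_ s'. solved T' s') (s\<lparr>time := time s + 1\<rparr>)"
proof -
  let ?T = "T + pairs * (60 + H + pop_time)"
  obtain ra na h tp tm pk b where s: "s = ram_of ra na h tp tm pk b"
    by (cases s)
  have b: "b" and sm: "pk \<le> 60 * total + 60" "\<forall>a. length (ra a) \<le> 2 * total + 1" "\<forall>b. length (na b) \<le> 4 * total + 1"
    and lk: "links_stored pairs ra na" and tm: "tm + pop_time * length h \<le> ?T" and P: "progress pairs ra na"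
    using M unfolding main_inv_def s by (simp_all add: small_record)
  have tm: "tm \<le> ?T" using tm by simp
  let ?I = "inactive ((!) (na Rank))"
  obtain Fs \<mu> where G: "greedy_state pairs ((!) (na Rank)) ((!) (na Next)) ((!) (na Prev)) ((!) (na Rep)) Fs \<mu>"
    and C: "\<forall>j\<le>pairs. ra Carr ! j = w * flow_cost (Fs j)"
    and th: "?I \<noteq> {} \<Longrightarrow> na Theta ! 0 = 0"
      "?I = {} \<Longrightarrow> na Theta ! 0 \<in> {1..total} \<and> (\<forall>j\<le>pairs. Fs j (na Theta ! 0) = 0)"
    using P unfolding progress_def by blast
  have O: "\<forall>j\<le>pairs. optimal_flow (active ((!) (na Rank)) j) j (Fs j)" using G by (simp add: greedy_state_def)
  have rep: "na Rep ! u \<in> {1..total} \<and> (\<forall>j\<le>pairs. Fs j (na Rep ! u) = 0)" if u: "u \<in> ?I" for u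
  proof -
    have R: "ring_links ?I ((!) (na Next)) ((!) (na Prev))" using G by (simp add: greedy_state_def)
    have "na Rep ! u \<in> cell u (na Next ! u)" "\<forall>j\<le>pairs. Fs j (na Rep ! u) = 0" using G u by (auto simp: greedy_state_def)
    then show ?thesis using cell_subset[OF ring_linksD(1)[OF R u] ring_linksD(1)[OF R ring_linksD(2)[OF R u]]] by blast
  qed
  have lth: "length (na Theta) = 1" "(0::nat) < 1" and lC: "length (ra Carr) = pairs + 1" using lk by (auto simp: links_stored_def)
  define s1 where "s1 = ram_of ra na h tp (tm + 1 + 1 + 1) pk True"
  show ?thesis
  proof (cases "?I = {}")
    case True
    then have ne: "(na Theta ! 0 = 0) = False" using th(2) by auto
    have "solved T' s1"
      unfolding solved_def s1_def ram.simps small_record out_gap_def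
      using sm lC th(2)[OF True] tm O C le by (auto simp: out_gap_def)
    then show ?thesis unfolding s s1_def
      by (simp only: ram.simps wp_exec lth ne b)
  next
    case False
    then have z: "na Theta ! 0 = 0" using th(1) by blast
    have "wp (any_remaining_cell total) (\<lambda>_ s'. solved T' s') s1"
    proof (rule any_remaining_cell_correct)
      show "scan_inv pairs (?T + 3) s1 1 s1"
        unfolding scan_inv_def using sm tm lk z by (simp add: s1_def small_record)
    next
      fix s' assume S: "scan_inv pairs (?T + 3 + 20 + 12 * total) s1 (total + 1) s'"
      have S1: "narr s1 Rank = na Rank" "narr s1 Rep = na Rep" "rarr s1 = ra" by (simp_all add: s1_def)
      have eq: "narr s' Rank = na Rank" "rarr s' = ra" using S by (simp_all add: scan_inv_def S1)
      \<comment> \<open>An inactive atom lies in the scanned range, which excludes the alternative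
        of the scan invariant that leaves \<open>Theta\<close> at 0.\<close>
      have "\<not> (\<forall>i\<in>{1..<total + 1}. na Rank ! i \<noteq> 0)" using False by (auto simp: inactive_def)
      then obtain i where i: "i \<in> ?I" "narr s' Theta ! 0 = na Rep ! i"
        using S unfolding scan_inv_def S1 by blast
      show "solved T' s'"
        unfolding solved_def out_gap_def i(2) eq
        using S rep[OF i(1)] lC O C le unfolding scan_inv_def by auto
    qed
    then show ?thesis unfolding s s1_def
      by (simp only: ram.simps wp_exec lth z b)
  qed
qed

lemma pawc_prog_correct:
  "wp (pawc_prog (length xs) (length ys) w L) (\<lambda>_ s. solved (1000 * (total * H)) s) (init_ram xs ys ch)"
proof -
  let ?N = total
  have H: "1 \<le> H" "pairs \<le> ?N" "pairs \<le> card src" "pairs \<le> card tgt"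
    unfolding card_src card_tgt by (simp add: H_def, simp_all add: pairs_def total_def)
  have init: "init_ram xs ys ch\<lparr>time := time (init_ram xs ys ch) + 1, time := time (init_ram xs ys ch\<lparr>time := time (init_ram xs ys ch) + 1\<rparr>) + 1\<rparr>
    = init_ram xs ys ch\<lparr>time := 2\<rparr>"
    by (simp add: init_ram_def update_peak_def)
  \<comment> \<open>Both 1 and \<open>N\<close> are at most \<open>N * H\<close>, so the
    coefficients add up to 745, below 1000.\<close>
  have bound: "T \<le> 1000 * (?N * H)" if T: "T \<le> 360 + 378 * ?N + 7 * (?N * H)" for T
  proof -
    have "?N * 1 \<le> ?N * H" "1 \<le> ?N" using mult_le_mono2[OF H(1)] total_ge_2 by auto
    then show ?thesis using T by linarith
  qed
  show ?thesis
    unfolding pawc_prog_def wp_bind wp_calc_any init total_def[symmetric] pairs_def[symmetric]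
    apply (rule sort_atoms_correct[OF _ refl])
    subgoal premises s1 for s1
      apply (rule compute_tables_correct[OF s1(1-4)])
      subgoal premises s2 for s2
        apply (rule init_list_correct[OF s2(1) H(2)])
        subgoal premises s3 for s3
          apply (rule wp_foreach[where J = "main_inv pairs (time s2 + 100 * ?N + 100 + ?N * (2 * H + 40))"])
          subgoal by simp
          subgoal using s3 by simp
          subgoal premises prems for k s by (rule activate_correct[OF prems(3,2) H(3,4)])
          subgoal premises M for s
          proof -
            have "pairs * (60 + H + pop_time) \<le> ?N * (60 + H + pop_time)" using H(2) by simp
            then have "time s2 + 100 * ?N + 100 + ?N * (2 * H + 40) + pairs * (60 + H + pop_time) + 60 + 24 * ?N
                \<le> 360 + 378 * ?N + 7 * (?N * H)"
              using s1(5) s2(2) by (simp add: pop_time_def algebra_simps)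
            then show ?thesis by (intro finish_correct[OF M(1) bound, unfolded wp_bind wp_calc_any])
          qed
          done
        done
      done
    done
qed

lemma pawc_run_solved: "solved (1000 * (total * H)) (pawc_run L w xs ys ch)"
  using pawc_prog_correct[of ch] by (simp add: wp_def pawc_run_def split: prod.splits)

lemma active_set_eq: "active_set (set xs) (set ys) s k = pt ` active ((!) (narr s Rank)) k"
  unfolding active_set_def active_def out_rank_def card_atoms by auto

lemma H_le_log: "real H \<le> 1 + log 2 (1 + 2 * real total)"
proof -
  have "0 \<le> log 2 (1 + 2 * real total)" by simp
  then show ?thesis by (simp add: H_def floor_log_altdef add.commute)
qed

lemma pawc_run_output:
  fixes ch
  defines "s \<equiv> pawc_run L w xs ys ch"
  shows "ok s" "length (out_costs s) = pairs + 1" "out_gap s \<in> {1..total}"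
    "k \<le> pairs \<Longrightarrow> out_costs s ! k = circ_cost L w (set xs) (set ys) k"
    "k \<le> pairs \<Longrightarrow> optimal_active_set L w (set xs) (set ys) k (active_set (set xs) (set ys) s k)"
    "k \<le> pairs \<Longrightarrow> \<theta> \<in> support_gap L (set xs) (set ys) (out_gap s) \<Longrightarrow>
      line_cost L w \<theta> (set xs) (set ys) k = circ_cost L w (set xs) (set ys) k"
    "real (time s) \<le> 1000 * real total * (1 + log 2 (1 + 2 * real total))"
    "real (peak s) \<le> 60 * real total + 60"
proof -
  have S: "solved (1000 * (total * H)) s" unfolding s_def by (rule pawc_run_solved)
  then show "ok s" "length (out_costs s) = pairs + 1" and g: "out_gap s \<in> {1..total}"
    by (simp_all add: solved_def out_costs_def)
  obtain Fs where F: "\<And>k. k \<le> pairs \<Longrightarrow> optimal_flow (active ((!) (narr s Rank)) k) k (Fs k)"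
    "\<And>k. k \<le> pairs \<Longrightarrow> rarr s Carr ! k = w * flow_cost (Fs k)" "\<And>k. k \<le> pairs \<Longrightarrow> Fs k (out_gap s) = 0"
    using S unfolding solved_def by blast
  note opt = optimal_flow_costs[OF F(1) active_subset(1) g F(3) w_pos, unfolded src_pts_eq tgt_pts_eq gap_eq[OF g]]
  show "k \<le> pairs \<Longrightarrow> out_costs s ! k = circ_cost L w (set xs) (set ys) k"
    using opt(1)[of k] F(2)[of k] by (simp add: out_costs_def)
  show "k \<le> pairs \<Longrightarrow> optimal_active_set L w (set xs) (set ys) k (active_set (set xs) (set ys) s k)"
    using opt(2)[of k] by (simp add: active_set_eq)
  show "k \<le> pairs \<Longrightarrow> \<theta> \<in> support_gap L (set xs) (set ys) (out_gap s) \<Longrightarrow>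
      line_cost L w \<theta> (set xs) (set ys) k = circ_cost L w (set xs) (set ys) k"
    using opt(1,3)[of k] by simp
  have "time s \<le> 1000 * (total * H)" using S by (simp add: solved_def)
  then have "real (time s) \<le> 1000 * real total * real H" by (metis (mono_tags) of_nat_le_iff of_nat_mult of_nat_numeral mult.assoc)
  also have "\<dots> \<le> 1000 * real total * (1 + log 2 (1 + 2 * real total))"
    using H_le_log by (intro mult_left_mono) auto
  finally show "real (time s) \<le> 1000 * real total * (1 + log 2 (1 + 2 * real total))" .
  have "peak s \<le> 60 * total + 60" using S by (simp add: solved_def small_def)
  then show "real (peak s) \<le> 60 * real total + 60" by simp
qed

end

theorem theorem5:
  shows "(\<forall>L w xs ys ch. valid_input L w xs ys \<longrightarrow>
            (let X = set xs; Y = set ys; N = length xs + length ys; K = min (length xs) (length ys);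
                 s = pawc_run L w xs ys ch
             in ok s \<and>
                length (out_costs s) = K + 1 \<and>
                (\<forall>k\<le>K. out_costs s ! k = circ_cost L w X Y k) \<and>
                (\<forall>k\<le>K. optimal_active_set L w X Y k (active_set X Y s k)) \<and>
                out_gap s \<in> {1..N} \<and>
                (\<forall>\<theta>\<in>support_gap L X Y (out_gap s). \<forall>k\<le>K.
                   line_cost L w \<theta> X Y k = circ_cost L w X Y k)))
       \<and> (\<exists>T S :: nat \<Rightarrow> real.
            T \<in> O(\<lambda>N. real N * ln (real N)) \<and> S \<in> O(\<lambda>N. real N) \<and>
            (\<forall>L w xs ys ch. valid_input L w xs ys \<longrightarrow>
               (let N = length xs + length ys; s = pawc_run L w xs ys ch
                in real (time s) \<le> T N \<and> real (peak s) \<le> S N)))"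
proof (rule conjI, intro allI impI, goal_cases)
  case (1 L w xs ys ch)
  then interpret pawc_input L w xs ys by unfold_locales
  show ?case
    unfolding Let_def total_def[symmetric] pairs_def[symmetric]
    using pawc_run_output[where ch = ch] by blast
next
  case 2
  \<comment> \<open>The bounds must depend on \<open>N\<close> alone and be fixed before the input,
    so they are the explicit ones of \<open>pawc_run_output\<close>, with \<open>H\<close> replaced
    by its logarithmic bound.\<close>
  let ?T = "\<lambda>N. 1000 * real N * (1 + log 2 (1 + 2 * real N))" and ?S = "\<lambda>N. 60 * real N + 60"
  show ?case
  proof (rule exI[of _ ?T], rule exI[of _ ?S], intro conjI allI impI)
    show "?T \<in> O(\<lambda>N. real N * ln (real N))" by real_asymp
    show "?S \<in> O(\<lambda>N. real N)" by real_asymp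
    fix L w xs ys ch assume "valid_input L w xs ys"
    then interpret pawc_input L w xs ys by unfold_locales
    show "let N = length xs + length ys; s = pawc_run L w xs ys ch in real (time s) \<le> ?T N \<and> real (peak s) \<le> ?S N"
      unfolding Let_def total_def[symmetric] using pawc_run_output(7,8)[where ch = ch] by blast
  qed
qed

end
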